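(* Let $(\mathcal B,d_B)\to(\mathcal B\otimes\land W,D)$ be a relative model such that the projection $\mathcal B\otimes\land W\to\mathcal B$ is a DG algebra map, with a fibrewise multiplication of models $C$. Suppose $W$ and $\mathcal B$ are of finite type, (1) $H^{\mathrm{odd}}(\mathcal B,d_B)=0$, and (2) $W$ is concentrated in odd degrees. If $C$ is associative, then $(D,C)\equiv^{\mathcal B}_{\mathcal B}(d_B\otimes1,C_0)$, where $C_0$ is the standard multiplication $C_0(w)=w+w'$ for $w\in W$ (and $C_0$ the identity on $\mathcal B$).
   Context: Relative model: $(\mathcal B,d_B)$ a commutative cochain DG algebra over $\mathbb Q$, $W$ a positively graded rational vector space, and $(\mathcal B\otimes\land W,D)$ a DG algebra containing $(\mathcal B,d_B)$ as a sub-DG algebra, with $W$ having a well-ordered basis $\{w_i\}$ with $D(w_i)\in\mathcal B\otimes\land W(i)$, $W(i)=\mathrm{span}\{w_j:j<i\}$. $d_B\otimes1$ is $d_B$ on $\mathcal B$ and zero on $W$. In $\mathcal B\otimes\land W^{\otimes k}$ (the $k$-fold tensor product over $\mathcal B$ of copies of $\mathcal B\otimes\land W$) write $w,w',w''$ for $w\in W$ in the first, second, third factor. A fibrewise multiplication of models is a DG algebra map $C\colon\mathcal B\otimes\land W\to\mathcal B\otimes\land W\otimes\land W$, identity on $\mathcal B$, commuting with projections onto $\mathcal B$, with $C(w)-w-w'\in\mathcal B\otimes\land^+W\otimes\land^+W$. DG maps are DG homotopic under and over $\mathcal B$ if there is a DG algebra map into (target)$\otimes\land(t,dt)$ ($|t|=0$,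 $d(t)=dt$), identity on $\mathcal B$, commuting with projections onto $\mathcal B$, restricting to the two maps at $t=0,1$. $C$ is associative if $(C\otimes_{\mathcal B}1)\circ C$ and $(1\otimes_{\mathcal B}C)\circ C\colon\mathcal B\otimes\land W\to\mathcal B\otimes\land W\otimes\land W\otimes\land W$ are DG homotopic under and over $\mathcal B$. $(D_1,C_1)\equiv^{\mathcal B}_{\mathcal B}(D_2,C_2)$ means there is a DG algebra isomorphism $\phi\colon(\mathcal B\otimes\land W,D_2)\to(\mathcal B\otimes\land W,D_1)$, identity on $\mathcal B$ and commuting with projections, with $C_1\circ\phi$ and $(1\otimes\phi\otimes\phi)\circ C_2$ DG homotopic under and over $\mathcal B$. *)

theory Defs
  imports Complex_Main "HOL-Library.Multiset" "HOL-Library.Function_Algebras"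
begin

text \<open>Generators of the free graded-commutative extensions used below.
  Gn j i is the basis element w_i of W in the j-th tensor factor (j = 0,1,2,...),
  Tg is t (degree 0) and DTg is dt (degree 1) of the algebra of polynomial forms.\<close>

datatype 'i gen = Gn nat 'i | Tg | DTg

fun gle :: "'i::linorder gen \<Rightarrow> 'i gen \<Rightarrow> bool" where
  "gle (Gn j i) (Gn j' i') = (j < j' \<or> (j = j' \<and> i \<le> i'))"
| "gle (Gn _ _) _ = True"
| "gle Tg (Gn _ _) = False"
| "gle Tg _ = True"
| "gle DTg DTg = True"
| "gle DTg _ = False"

instantiation gen :: (linorder) linorder
begin
definition less_eq_gen :: "'a gen \<Rightarrow> 'a gen \<Rightarrow> bool" where "less_eq_gen = gle"
definition less_gen :: "'a gen \<Rightarrow> 'a gen \<Rightarrow> bool" where "less_gen x y = (gle x y \<and> \<not> gle y x)"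
instance
proof
  fix x y z :: "'a gen"
  show "(x < y) = (x \<le> y \<and> \<not> y \<le> x)" by (simp add: less_gen_def less_eq_gen_def)
  show "x \<le> x" by (cases x) (auto simp: less_eq_gen_def)
  show "x \<le> y \<Longrightarrow> y \<le> z \<Longrightarrow> x \<le> z"
    by (cases x; cases y; cases z) (auto simp: less_eq_gen_def)
  show "x \<le> y \<Longrightarrow> y \<le> x \<Longrightarrow> x = y"
    by (cases x; cases y) (auto simp: less_eq_gen_def)
  show "x \<le> y \<or> y \<le> x"
    by (cases x; cases y) (auto simp: less_eq_gen_def)
qed
end

text \<open>B is the whole type 'b (a unital ring); bc n is the projection onto B^n,
  dB is the differential.  Being an algebra over Q is expressed by requiring every
  positive integer to be invertible (this determines the Q-algebra structure uniquely).\<close>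

definition cdga :: "(nat \<Rightarrow> 'b::ring_1 \<Rightarrow> 'b) \<Rightarrow> ('b \<Rightarrow> 'b) \<Rightarrow> bool" where
  "cdga bc dB \<longleftrightarrow>
     (\<forall>n::nat. n > 0 \<longrightarrow> (\<exists>u. of_nat n * u = (1::'b) \<and> u * of_nat n = 1)) \<and>
     (\<forall>n x y. bc n (x + y) = bc n x + bc n y) \<and>
     (\<forall>n m x. bc n (bc m x) = (if n = m then bc m x else 0)) \<and>
     (\<forall>x. finite {n. bc n x \<noteq> 0} \<and> x = (\<Sum>n\<in>{n. bc n x \<noteq> 0}. bc n x)) \<and>
     bc 0 1 = 1 \<and>
     (\<forall>p q x y. bc p x = x \<longrightarrow> bc q y = y \<longrightarrow> bc (p + q) (x * y) = x * y) \<and>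
     (\<forall>p q x y. bc p x = x \<longrightarrow> bc q y = y \<longrightarrow> x * y = (-1) ^ (p * q) * (y * x)) \<and>
     (\<forall>x y. dB (x + y) = dB x + dB y) \<and>
     (\<forall>n x. bc n x = x \<longrightarrow> bc (n + 1) (dB x) = dB x) \<and>
     (\<forall>x. dB (dB x) = 0) \<and>
     (\<forall>p x y. bc p x = x \<longrightarrow> dB (x * y) = dB x * y + (-1) ^ p * (x * dB y))"

text \<open>Rational scalar multiplication (well defined in a cdga, where denominators are invertible).\<close>
definition qsc :: "rat \<Rightarrow> 'b::ring_1 \<Rightarrow> 'b" where
  "qsc q x = (case quotient_of q of (a, b) \<Rightarrow> of_int a * (THE y. of_int b * y = x))"

definition finite_type_B :: "(nat \<Rightarrow> 'b::ring_1 \<Rightarrow> 'b) \<Rightarrow> bool" where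
  "finite_type_B bc \<longleftrightarrow> (\<forall>n. \<exists>S. finite S \<and> S \<subseteq> {x. bc n x = x} \<and>
      (\<forall>x. bc n x = x \<longrightarrow> (\<exists>c. x = (\<Sum>s\<in>S. qsc (c s) s))))"

definition odd_cohomology_vanishes :: "(nat \<Rightarrow> 'b::ring_1 \<Rightarrow> 'b) \<Rightarrow> ('b \<Rightarrow> 'b) \<Rightarrow> bool" where
  "odd_cohomology_vanishes bc dB \<longleftrightarrow>
     (\<forall>n x. odd n \<longrightarrow> bc n x = x \<longrightarrow> dB x = 0 \<longrightarrow> (\<exists>y. bc (n - 1) y = y \<and> x = dB y))"

definition binv :: "(nat \<Rightarrow> 'b::ring_1 \<Rightarrow> 'b) \<Rightarrow> 'b \<Rightarrow> 'b" where
  "binv bc x = (\<Sum>q\<in>{q. bc q x \<noteq> 0}. (-1) ^ q * bc q x)"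

text \<open>An element of B \<otimes> \<Lambda>V (V spanned by generators) is a finitely supported
  function from monomials (multisets of generators; odd generators at most once) to B.
  The value at m is the coefficient b of b \<otimes> m, m being the product of its generators
  in increasing order.  dg i is the degree of w_i.\<close>

definition gdeg :: "('i \<Rightarrow> nat) \<Rightarrow> 'i gen \<Rightarrow> nat" where
  "gdeg dg x = (case x of Gn _ i \<Rightarrow> dg i | Tg \<Rightarrow> 0 | DTg \<Rightarrow> 1)"

definition mdeg :: "('i \<Rightarrow> nat) \<Rightarrow> 'i gen multiset \<Rightarrow> nat" where
  "mdeg dg m = sum_mset (image_mset (gdeg dg) m)"

definition valid :: "('i \<Rightarrow> nat) \<Rightarrow> 'i gen multiset \<Rightarrow> bool" where
  "valid dg m \<longleftrightarrow> (\<forall>x. odd (gdeg dg x) \<longrightarrow> count m x \<le> 1)"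

definition msign :: "('i \<Rightarrow> nat) \<Rightarrow> 'i::linorder gen multiset \<Rightarrow> 'i gen multiset \<Rightarrow> int" where
  "msign dg m1 m2 = (-1) ^ card {(x, y). x \<in># m1 \<and> y \<in># m2 \<and> odd (gdeg dg x) \<and> odd (gdeg dg y) \<and> y < x}"

type_synonym ('i, 'b) elt = "'i gen multiset \<Rightarrow> 'b"

definition elems :: "('i \<Rightarrow> nat) \<Rightarrow> 'i gen set \<Rightarrow> ('i, 'b::zero) elt set" where
  "elems dg G = {f. finite {m. f m \<noteq> 0} \<and> (\<forall>m. f m \<noteq> 0 \<longrightarrow> valid dg m \<and> set_mset m \<subseteq> G)}"

definition gensk :: "nat \<Rightarrow> 'i gen set" where
  "gensk k = {Gn j i | j i. j < k}"

definition gensT :: "nat \<Rightarrow> 'i gen set" where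
  "gensT k = gensk k \<union> {Tg, DTg}"

definition incl :: "'b::zero \<Rightarrow> ('i, 'b) elt" where
  "incl b = (\<lambda>m. if m = {#} then b else 0)"

definition gel :: "'i gen \<Rightarrow> ('i, 'b::{zero,one}) elt" where
  "gel x = (\<lambda>m. if m = {#x#} then 1 else 0)"

definition qsm :: "rat \<Rightarrow> ('i, 'b::ring_1) elt \<Rightarrow> ('i, 'b) elt" where
  "qsm q f = (\<lambda>m. qsc q (f m))"

definition isc :: "int \<Rightarrow> ('i, 'b::ring_1) elt \<Rightarrow> ('i, 'b) elt" where
  "isc k f = (\<lambda>m. of_int k * f m)"

text \<open>Product: (b \<otimes> m)(b' \<otimes> m') = (-1)^{|m||b'|} bb' \<otimes> mm'.\<close>
definition tmul :: "('i \<Rightarrow> nat) \<Rightarrow> (nat \<Rightarrow> 'b::ring_1 \<Rightarrow> 'b) \<Rightarrow>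
    ('i::linorder, 'b) elt \<Rightarrow> ('i, 'b) elt \<Rightarrow> ('i, 'b) elt" where
  "tmul dg bc f g = (\<lambda>n. if valid dg n then
      (\<Sum>m1\<in>{m. m \<subseteq># n}. of_int (msign dg m1 (n - m1)) *
          (f m1 * (if even (mdeg dg m1) then g (n - m1) else binv bc (g (n - m1)))))
     else 0)"

definition comp :: "('i \<Rightarrow> nat) \<Rightarrow> (nat \<Rightarrow> 'b::ring_1 \<Rightarrow> 'b) \<Rightarrow> nat \<Rightarrow> ('i, 'b) elt \<Rightarrow> ('i, 'b) elt" where
  "comp dg bc n f = (\<lambda>m. if mdeg dg m \<le> n then bc (n - mdeg dg m) (f m) else 0)"

definition lprod :: "('i \<Rightarrow> nat) \<Rightarrow> (nat \<Rightarrow> 'b::ring_1 \<Rightarrow> 'b) \<Rightarrow>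
    ('i::linorder, 'b) elt list \<Rightarrow> ('i, 'b) elt" where
  "lprod dg bc xs = foldr (tmul dg bc) xs (incl 1)"

definition ext_hom :: "('i \<Rightarrow> nat) \<Rightarrow> (nat \<Rightarrow> 'b::ring_1 \<Rightarrow> 'b) \<Rightarrow>
    ('i::linorder gen \<Rightarrow> ('i, 'b) elt) \<Rightarrow> ('i, 'b) elt \<Rightarrow> ('i, 'b) elt" where
  "ext_hom dg bc img f = (\<Sum>m\<in>{m. f m \<noteq> 0}.
      tmul dg bc (incl (f m)) (lprod dg bc (map img (sorted_list_of_multiset m))))"

definition ext_der :: "('i \<Rightarrow> nat) \<Rightarrow> (nat \<Rightarrow> 'b::ring_1 \<Rightarrow> 'b) \<Rightarrow> ('b \<Rightarrow> 'b) \<Rightarrow>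
    ('i::linorder gen \<Rightarrow> ('i, 'b) elt) \<Rightarrow> ('i, 'b) elt \<Rightarrow> ('i, 'b) elt" where
  "ext_der dg bc dB img f = (\<Sum>m\<in>{m. f m \<noteq> 0}.
      (let xs = sorted_list_of_multiset m in
        tmul dg bc (incl (dB (f m))) (lprod dg bc (map gel xs)) +
        tmul dg bc (incl (binv bc (f m)))
          (\<Sum>s<length xs. isc ((-1) ^ mdeg dg (mset (take s xs)))
             (tmul dg bc (lprod dg bc (map gel (take s xs)))
               (tmul dg bc (img (xs ! s)) (lprod dg bc (map gel (drop (Suc s) xs))))))))"

definition copy_to :: "('i \<Rightarrow> nat) \<Rightarrow> (nat \<Rightarrow> 'b::ring_1 \<Rightarrow> 'b) \<Rightarrow> nat \<Rightarrow> ('i::linorder, 'b) elt \<Rightarrow> ('i, 'b) elt" where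
  "copy_to dg bc j = ext_hom dg bc (\<lambda>x. case x of Gn _ i \<Rightarrow> gel (Gn j i) | Tg \<Rightarrow> gel Tg | DTg \<Rightarrow> gel DTg)"

text \<open>Given a differential D on B \<otimes> \<Lambda>W, the induced differential on
  B \<otimes> \<Lambda>W \<otimes>_B ... \<otimes>_B \<Lambda>W (\<otimes> \<Lambda>(t,dt)), i.e. D on every factor and d(t) = dt.\<close>
definition Dx :: "('i \<Rightarrow> nat) \<Rightarrow> (nat \<Rightarrow> 'b::ring_1 \<Rightarrow> 'b) \<Rightarrow> ('b \<Rightarrow> 'b) \<Rightarrow>
    (('i::linorder, 'b) elt \<Rightarrow> ('i, 'b) elt) \<Rightarrow> ('i, 'b) elt \<Rightarrow> ('i, 'b) elt" where
  "Dx dg bc dB D = ext_der dg bc dB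
     (\<lambda>x. case x of Gn j i \<Rightarrow> copy_to dg bc j (D (gel (Gn 0 i))) | Tg \<Rightarrow> gel DTg | DTg \<Rightarrow> 0)"

definition D0 :: "('b \<Rightarrow> 'b) \<Rightarrow> ('i, 'b) elt \<Rightarrow> ('i, 'b) elt" where
  "D0 dB f = (\<lambda>m. dB (f m))"

definition is_dga :: "('i \<Rightarrow> nat) \<Rightarrow> (nat \<Rightarrow> 'b::ring_1 \<Rightarrow> 'b) \<Rightarrow>
    ('i::linorder, 'b) elt set \<Rightarrow> (('i, 'b) elt \<Rightarrow> ('i, 'b) elt) \<Rightarrow> bool" where
  "is_dga dg bc S D \<longleftrightarrow>
     (\<forall>f\<in>S. D f \<in> S) \<and>
     (\<forall>f\<in>S. \<forall>g\<in>S. D (f + g) = D f + D g) \<and>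
     (\<forall>q. \<forall>f\<in>S. D (qsm q f) = qsm q (D f)) \<and>
     (\<forall>n. \<forall>f\<in>S. comp dg bc (n + 1) (D f) = D (comp dg bc n f)) \<and>
     (\<forall>f\<in>S. comp dg bc 0 (D f) = 0) \<and>
     (\<forall>f\<in>S. D (D f) = 0) \<and>
     (\<forall>n. \<forall>f\<in>S. \<forall>g\<in>S. comp dg bc n f = f \<longrightarrow>
        D (tmul dg bc f g) = tmul dg bc (D f) g + isc ((-1) ^ n) (tmul dg bc f (D g)))"

definition dgmap :: "('i \<Rightarrow> nat) \<Rightarrow> (nat \<Rightarrow> 'b::ring_1 \<Rightarrow> 'b) \<Rightarrow>
    ('i::linorder, 'b) elt set \<Rightarrow> (('i, 'b) elt \<Rightarrow> ('i, 'b) elt) \<Rightarrow>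
    ('i, 'b) elt set \<Rightarrow> (('i, 'b) elt \<Rightarrow> ('i, 'b) elt) \<Rightarrow>
    (('i, 'b) elt \<Rightarrow> ('i, 'b) elt) \<Rightarrow> bool" where
  "dgmap dg bc S D1 T D2 \<phi> \<longleftrightarrow>
     (\<forall>f\<in>S. \<phi> f \<in> T) \<and>
     (\<forall>f\<in>S. \<forall>g\<in>S. \<phi> (f + g) = \<phi> f + \<phi> g) \<and>
     (\<forall>q. \<forall>f\<in>S. \<phi> (qsm q f) = qsm q (\<phi> f)) \<and>
     \<phi> (incl 1) = incl 1 \<and>
     (\<forall>f\<in>S. \<forall>g\<in>S. \<phi> (tmul dg bc f g) = tmul dg bc (\<phi> f) (\<phi> g)) \<and>
     (\<forall>n. \<forall>f\<in>S. \<phi> (comp dg bc n f) = comp dg bc n (\<phi> f)) \<and>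
     (\<forall>f\<in>S. \<phi> (D1 f) = D2 (\<phi> f))"

text \<open>Identity on B and commuting with the projections onto B (coefficient of the empty monomial).\<close>
definition under_over :: "('i, 'b::zero) elt set \<Rightarrow> (('i, 'b) elt \<Rightarrow> ('i, 'b) elt) \<Rightarrow> bool" where
  "under_over S \<phi> \<longleftrightarrow> (\<forall>b. \<phi> (incl b) = incl b) \<and> (\<forall>f\<in>S. \<phi> f {#} = f {#})"

definition ev :: "('i \<Rightarrow> nat) \<Rightarrow> (nat \<Rightarrow> 'b::ring_1 \<Rightarrow> 'b) \<Rightarrow> 'b \<Rightarrow> ('i::linorder, 'b) elt \<Rightarrow> ('i, 'b) elt" where
  "ev dg bc c = ext_hom dg bc (\<lambda>x. case x of Gn j i \<Rightarrow> gel (Gn j i) | Tg \<Rightarrow> incl c | DTg \<Rightarrow> 0)"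

text \<open>DG homotopy under and over B between maps \<phi>, \<psi> : (B \<otimes> \<Lambda>W, D1) \<rightarrow>
  (B \<otimes> \<Lambda>W^{\<otimes> k}, induced by D2).  "Over B" means that composing with the projection
  (target) \<otimes> \<Lambda>(t,dt) \<rightarrow> B \<otimes> \<Lambda>(t,dt) gives the projection onto B followed by inclusion.\<close>
definition dg_htpy :: "('i \<Rightarrow> nat) \<Rightarrow> (nat \<Rightarrow> 'b::ring_1 \<Rightarrow> 'b) \<Rightarrow> ('b \<Rightarrow> 'b) \<Rightarrow>
    (('i::linorder, 'b) elt \<Rightarrow> ('i, 'b) elt) \<Rightarrow> nat \<Rightarrow> (('i, 'b) elt \<Rightarrow> ('i, 'b) elt) \<Rightarrow>
    (('i, 'b) elt \<Rightarrow> ('i, 'b) elt) \<Rightarrow> (('i, 'b) elt \<Rightarrow> ('i, 'b) elt) \<Rightarrow> bool" where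
  "dg_htpy dg bc dB D1 k D2 \<phi> \<psi> \<longleftrightarrow>
     (\<exists>H. dgmap dg bc (elems dg (gensk 1)) D1 (elems dg (gensT k)) (Dx dg bc dB D2) H \<and>
          (\<forall>b. H (incl b) = incl b) \<and>
          (\<forall>f\<in>elems dg (gensk 1). \<forall>m. set_mset m \<subseteq> {Tg, DTg} \<longrightarrow>
              H f m = (if m = {#} then f {#} else 0)) \<and>
          (\<forall>f\<in>elems dg (gensk 1). ev dg bc 0 (H f) = \<phi> f \<and> ev dg bc 1 (H f) = \<psi> f))"

definition relative_model :: "('i::wellorder \<Rightarrow> nat) \<Rightarrow> (nat \<Rightarrow> 'b::ring_1 \<Rightarrow> 'b) \<Rightarrow> ('b \<Rightarrow> 'b) \<Rightarrow>
    (('i, 'b) elt \<Rightarrow> ('i, 'b) elt) \<Rightarrow> bool" where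
  "relative_model dg bc dB D \<longleftrightarrow>
     (\<forall>i. dg i > 0) \<and>
     is_dga dg bc (elems dg (gensk 1)) D \<and>
     (\<forall>b. D (incl b) = incl (dB b)) \<and>
     (\<forall>i. D (gel (Gn 0 i)) \<in> elems dg {Gn 0 j | j. j < i})"

definition projection_dg :: "('b \<Rightarrow> 'b) \<Rightarrow> ('i, 'b::zero) elt set \<Rightarrow> (('i, 'b) elt \<Rightarrow> ('i, 'b) elt) \<Rightarrow> bool" where
  "projection_dg dB S D \<longleftrightarrow> (\<forall>f\<in>S. D f {#} = dB (f {#}))"

definition plusplus :: "('i \<Rightarrow> nat) \<Rightarrow> ('i, 'b::zero) elt set" where
  "plusplus dg = {f \<in> elems dg (gensk 2). \<forall>m. f m \<noteq> 0 \<longrightarrow>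
       (\<exists>i. Gn 0 i \<in># m) \<and> (\<exists>i. Gn 1 i \<in># m)}"

definition fibrewise_mult :: "('i::linorder \<Rightarrow> nat) \<Rightarrow> (nat \<Rightarrow> 'b::ring_1 \<Rightarrow> 'b) \<Rightarrow> ('b \<Rightarrow> 'b) \<Rightarrow>
    (('i, 'b) elt \<Rightarrow> ('i, 'b) elt) \<Rightarrow> (('i, 'b) elt \<Rightarrow> ('i, 'b) elt) \<Rightarrow> bool" where
  "fibrewise_mult dg bc dB D C \<longleftrightarrow>
     dgmap dg bc (elems dg (gensk 1)) D (elems dg (gensk 2)) (Dx dg bc dB D) C \<and>
     under_over (elems dg (gensk 1)) C \<and>
     (\<forall>i. C (gel (Gn 0 i)) - gel (Gn 0 i) - gel (Gn 1 i) \<in> plusplus dg)"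

definition C0 :: "('i \<Rightarrow> nat) \<Rightarrow> (nat \<Rightarrow> 'b::ring_1 \<Rightarrow> 'b) \<Rightarrow> ('i::linorder, 'b) elt \<Rightarrow> ('i, 'b) elt" where
  "C0 dg bc = ext_hom dg bc (\<lambda>x. case x of Gn _ i \<Rightarrow> gel (Gn 0 i) + gel (Gn 1 i) | _ \<Rightarrow> 0)"

definition C_tens_1 :: "('i \<Rightarrow> nat) \<Rightarrow> (nat \<Rightarrow> 'b::ring_1 \<Rightarrow> 'b) \<Rightarrow> (('i::linorder, 'b) elt \<Rightarrow> ('i, 'b) elt) \<Rightarrow> ('i, 'b) elt \<Rightarrow> ('i, 'b) elt" where
  "C_tens_1 dg bc C = ext_hom dg bc
     (\<lambda>x. case x of Gn j i \<Rightarrow> (if j = 0 then C (gel (Gn 0 i)) else gel (Gn 2 i)) | _ \<Rightarrow> 0)"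

definition shift1 :: "('i \<Rightarrow> nat) \<Rightarrow> (nat \<Rightarrow> 'b::ring_1 \<Rightarrow> 'b) \<Rightarrow> ('i::linorder, 'b) elt \<Rightarrow> ('i, 'b) elt" where
  "shift1 dg bc = ext_hom dg bc (\<lambda>x. case x of Gn j i \<Rightarrow> gel (Gn (Suc j) i) | Tg \<Rightarrow> gel Tg | DTg \<Rightarrow> gel DTg)"

definition one_tens_C :: "('i \<Rightarrow> nat) \<Rightarrow> (nat \<Rightarrow> 'b::ring_1 \<Rightarrow> 'b) \<Rightarrow> (('i::linorder, 'b) elt \<Rightarrow> ('i, 'b) elt) \<Rightarrow> ('i, 'b) elt \<Rightarrow> ('i, 'b) elt" where
  "one_tens_C dg bc C = ext_hom dg bc
     (\<lambda>x. case x of Gn j i \<Rightarrow> (if j = 0 then gel (Gn 0 i) else shift1 dg bc (C (gel (Gn 0 i)))) | _ \<Rightarrow> 0)"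

definition associative :: "('i::linorder \<Rightarrow> nat) \<Rightarrow> (nat \<Rightarrow> 'b::ring_1 \<Rightarrow> 'b) \<Rightarrow> ('b \<Rightarrow> 'b) \<Rightarrow>
    (('i, 'b) elt \<Rightarrow> ('i, 'b) elt) \<Rightarrow> (('i, 'b) elt \<Rightarrow> ('i, 'b) elt) \<Rightarrow> bool" where
  "associative dg bc dB D C \<longleftrightarrow>
     dg_htpy dg bc dB D 3 D (C_tens_1 dg bc C \<circ> C) (one_tens_C dg bc C \<circ> C)"

definition tens2 :: "('i \<Rightarrow> nat) \<Rightarrow> (nat \<Rightarrow> 'b::ring_1 \<Rightarrow> 'b) \<Rightarrow> (('i::linorder, 'b) elt \<Rightarrow> ('i, 'b) elt) \<Rightarrow> ('i, 'b) elt \<Rightarrow> ('i, 'b) elt" where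
  "tens2 dg bc \<phi> = ext_hom dg bc
     (\<lambda>x. case x of Gn j i \<Rightarrow> copy_to dg bc j (\<phi> (gel (Gn 0 i))) | _ \<Rightarrow> 0)"

definition equiv_BB :: "('i::linorder \<Rightarrow> nat) \<Rightarrow> (nat \<Rightarrow> 'b::ring_1 \<Rightarrow> 'b) \<Rightarrow> ('b \<Rightarrow> 'b) \<Rightarrow>
    (('i, 'b) elt \<Rightarrow> ('i, 'b) elt) \<Rightarrow> (('i, 'b) elt \<Rightarrow> ('i, 'b) elt) \<Rightarrow>
    (('i, 'b) elt \<Rightarrow> ('i, 'b) elt) \<Rightarrow> (('i, 'b) elt \<Rightarrow> ('i, 'b) elt) \<Rightarrow> bool" where
  "equiv_BB dg bc dB D1 C1 D2 C2 \<longleftrightarrow>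
     (\<exists>\<phi>. dgmap dg bc (elems dg (gensk 1)) D2 (elems dg (gensk 1)) D1 \<phi> \<and>
          bij_betw \<phi> (elems dg (gensk 1)) (elems dg (gensk 1)) \<and>
          under_over (elems dg (gensk 1)) \<phi> \<and>
          dg_htpy dg bc dB D2 2 D1 (C1 \<circ> \<phi>) (tens2 dg bc \<phi> \<circ> C2))"

end

theory Submission
  imports Defs
begin

text \<open>Composing C with the multiplication of the two factors gives a DG endomorphism P of the model that acts on words of length n, up to longer
  words, as multiplication by the n-th power of 2. Hence a generator can be corrected by the
  operators (P - 2^n)/(2 - 2^n), n = 2, 3, ..., until its differential, which they kill in every
  word length, vanishes, provided that the differential had no linear part; the linear part has
  coefficients of odd degree and is removed by induction along the well-order, because
  the odd cohomology of the base vanishes. So D may be assumed to be d_B on coefficients.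
  For such D the defect of primitivity of a generator is improved one word length n at a time: its
  leading part has closed coefficients, which for even n have odd degree and are exact. For odd
  n associativity makes the leading part a 2-cocycle of the cobar complex of an exterior coalgebra,
  and in word length at least 3 such a cocycle is the coboundary of a change of the generator.
  Finally a primitive closed generator up to an exact term yields a homotopy that is linear in t.\<close>

text \<open>The corrections run over word length because the generators have odd, hence positive,
  degree: in a fixed total degree only finitely many word lengths occur, so each scheme stops after
  finitely many steps with error zero. Hypothesis (1) reaches only coefficients of odd degree, and
  the coefficient of a word has the parity of the total degree minus the word length. The defect of
  primitivity has odd total degree, so even word lengths are covered and odd ones are left to
  associativity. The cobar complex of an exterior coalgebra has the symmetric algebra as cohomology;
  its classes in degree two live in word length two, and that length is even. Associativity holds
  only up to homotopy: integrating the homotopy over [0,1] turns it into an identity modulo exact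
  terms, and this only on cycles. Hence generators are made closed before associativity is used, and
  the cocycle identity is treated modulo exact coefficients.\<close>

lemma sum_fun_apply: "(\<Sum>x\<in>A. f x) m = (\<Sum>x\<in>A. f x m)"
  by (induction A rule: infinite_finite_induct) auto

lemma additive_sum:
  fixes F :: "'x::comm_monoid_add \<Rightarrow> 'y::comm_monoid_add"
  assumes "\<And>x y. F (x + y) = F x + F y" and "F 0 = 0"
  shows "F (sum f A) = (\<Sum>a\<in>A. F (f a))"
  by (induction A rule: infinite_finite_induct) (auto simp: assms)

section \<open>The base algebra: components, sign involution, differential and division by
  integers\<close>

locale cdga_base =
  fixes bc :: "nat \<Rightarrow> 'b::ring_1 \<Rightarrow> 'b" and dB :: "'b \<Rightarrow> 'b"
  assumes cdga: "cdga bc dB"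
begin

lemmas cdga_laws = cdga[unfolded cdga_def]

lemma nat_invertible: "n > 0 \<Longrightarrow> \<exists>u. of_nat n * u = (1::'b) \<and> u * of_nat n = 1"
  by (rule cdga_laws[THEN conjunct1, rule_format])

lemma bc_add: "bc n (x + y) = bc n x + bc n y"
  by (rule cdga_laws[THEN conjunct2, THEN conjunct1, rule_format])

lemma bc_bc: "bc n (bc m x) = (if n = m then bc m x else 0)"
  by (rule cdga_laws[THEN conjunct2, THEN conjunct2, THEN conjunct1, rule_format])

lemma bc_finite: "finite {n. bc n x \<noteq> 0}"
  by (rule cdga_laws[THEN conjunct2, THEN conjunct2, THEN conjunct2, THEN conjunct1, rule_format, THEN conjunct1])

lemma bc_expand: "x = (\<Sum>n\<in>{n. bc n x \<noteq> 0}. bc n x)"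
  by (rule cdga_laws[THEN conjunct2, THEN conjunct2, THEN conjunct2, THEN conjunct1, rule_format, THEN conjunct2])

lemma bc_one: "bc 0 1 = 1"
  by (rule cdga_laws[THEN conjunct2, THEN conjunct2, THEN conjunct2, THEN conjunct2, THEN conjunct1, rule_format])

lemma bc_mult: "bc p x = x \<Longrightarrow> bc q y = y \<Longrightarrow> bc (p + q) (x * y) = x * y"
  by (rule cdga_laws[THEN conjunct2, THEN conjunct2, THEN conjunct2, THEN conjunct2, THEN conjunct2, THEN conjunct1, rule_format])

lemma bc_commute: "bc p x = x \<Longrightarrow> bc q y = y \<Longrightarrow> x * y = (-1) ^ (p * q) * (y * x)"
  by (rule cdga_laws[THEN conjunct2, THEN conjunct2, THEN conjunct2, THEN conjunct2, THEN conjunct2, THEN conjunct2, THEN conjunct1, rule_format])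

lemma dB_add: "dB (x + y) = dB x + dB y"
  by (rule cdga_laws[THEN conjunct2, THEN conjunct2, THEN conjunct2, THEN conjunct2, THEN conjunct2, THEN conjunct2, THEN conjunct2, THEN conjunct1, rule_format])

lemma dB_degree: "bc n x = x \<Longrightarrow> bc (n + 1) (dB x) = dB x"
  by (rule cdga_laws[THEN conjunct2, THEN conjunct2, THEN conjunct2, THEN conjunct2, THEN conjunct2, THEN conjunct2, THEN conjunct2, THEN conjunct2, THEN conjunct1, rule_format])

lemma dB_dB: "dB (dB x) = 0"
  by (rule cdga_laws[THEN conjunct2, THEN conjunct2, THEN conjunct2, THEN conjunct2, THEN conjunct2, THEN conjunct2, THEN conjunct2, THEN conjunct2, THEN conjunct2, THEN conjunct1, rule_format])

lemma dB_mult_homogeneous: "bc p x = x \<Longrightarrow> dB (x * y) = dB x * y + (-1) ^ p * (x * dB y)"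
  by (rule cdga_laws[THEN conjunct2, THEN conjunct2, THEN conjunct2, THEN conjunct2, THEN conjunct2, THEN conjunct2, THEN conjunct2, THEN conjunct2, THEN conjunct2, THEN conjunct2, rule_format])

lemma bc_zero [simp]: "bc n 0 = 0"
  using bc_add[of n 0 0] by simp

lemma bc_minus: "bc n (- x) = - bc n x"
  using bc_add[of n x "- x"] by (simp add: eq_neg_iff_add_eq_0 add.commute)

lemma bc_diff: "bc n (x - y) = bc n x - bc n y"
  using bc_add[of n x "- y"] by (simp add: bc_minus)

lemma bc_sum: "bc n (sum f A) = (\<Sum>a\<in>A. bc n (f a))"
  by (induction A rule: infinite_finite_induct) (auto simp: bc_add)

lemma dB_zero [simp]: "dB 0 = 0"
  using dB_add[of 0 0] by simp

lemma dB_minus: "dB (- x) = - dB x"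
  using dB_add[of x "- x"] by (simp add: eq_neg_iff_add_eq_0 add.commute)

lemma dB_diff: "dB (x - y) = dB x - dB y"
  using dB_add[of x "- y"] by (simp add: dB_minus)

lemma dB_sum: "dB (sum f A) = (\<Sum>a\<in>A. dB (f a))"
  by (induction A rule: infinite_finite_induct) (auto simp: dB_add)

text \<open>Every element is the finite sum of its components, so an additive identity with signs
  depending on degrees can be checked on homogeneous elements.\<close>

lemma homogeneous_induct [case_names add homogeneous]:
  assumes "\<And>x y. P x \<Longrightarrow> P y \<Longrightarrow> P (x + y)" and "\<And>p x. bc p x = x \<Longrightarrow> P x"
  shows "P (x::'b)"
proof -
  have "P (\<Sum>n\<in>A. bc n x)" if "finite A" for A
    using that by (induction A) (auto intro!: assms(1) assms(2)[of 0 0] assms(2)[of _ "bc _ x"] simp: bc_bc)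
  then show ?thesis
    using bc_expand[of x] bc_finite[of x] by metis
qed

lemma bc_pm: "bc n ((-1) ^ k * x) = (-1) ^ k * bc n x"
  by (cases "even k") (auto simp: bc_minus)

lemma dB_pm: "dB ((-1) ^ k * x) = (-1) ^ k * dB x"
  by (cases "even k") (auto simp: dB_minus)

lemma binv_superset:
  assumes "finite A" "{q. bc q x \<noteq> 0} \<subseteq> A"
  shows "binv bc x = (\<Sum>q\<in>A. (-1) ^ q * bc q x)"
  unfolding binv_def by (rule sum.mono_neutral_left) (use assms in auto)

lemma binv_add: "binv bc (x + y) = binv bc x + binv bc y"
proof -
  let ?A = "{q. bc q x \<noteq> 0} \<union> {q. bc q y \<noteq> 0}"
  have f: "finite ?A" by (simp add: bc_finite)
  have s: "{q. bc q (x + y) \<noteq> 0} \<subseteq> ?A" by (auto simp: bc_add)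
  show ?thesis
    by (simp add: binv_superset[OF f s] binv_superset[OF f, of x] binv_superset[OF f, of y]
        bc_add distrib_left sum.distrib)
qed

lemma binv_zero [simp]: "binv bc 0 = 0"
  using binv_add[of 0 0] by simp

lemma binv_minus: "binv bc (- x) = - binv bc x"
  using binv_add[of x "- x"] by (simp add: eq_neg_iff_add_eq_0 add.commute)

lemma binv_pm: "binv bc ((-1) ^ k * x) = (-1) ^ k * binv bc x"
  by (cases "even k") (auto simp: binv_minus)

lemma binv_homogeneous:
  assumes "bc p x = x"
  shows "binv bc x = (-1) ^ p * x"
proof -
  have "bc q x = (if q = p then x else 0)" for q
    using bc_bc[of q p x] assms by auto
  then have "binv bc x = (\<Sum>q\<in>{p}. (-1) ^ q * bc q x)"
    by (intro binv_superset) auto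
  then show ?thesis using assms by simp
qed

lemma binv_one [simp]: "binv bc 1 = 1"
  using binv_homogeneous[OF bc_one] by simp

lemma bc_binv: "bc n (binv bc x) = (-1) ^ n * bc n x"
proof (induction x rule: homogeneous_induct)
  case (add x y)
  then show ?case by (simp add: binv_add bc_add distrib_left)
next
  case (homogeneous p x)
  have "bc n x = (if n = p then x else 0)"
    using bc_bc[of n p x] homogeneous by auto
  then show ?case by (simp add: binv_homogeneous[OF homogeneous] bc_pm)
qed

lemma binv_binv [simp]: "binv bc (binv bc x) = x"
proof (induction x rule: homogeneous_induct)
  case (add x y)
  then show ?case by (simp add: binv_add)
next
  case (homogeneous p x)
  then show ?case by (simp add: binv_homogeneous binv_pm flip: mult.assoc power_add)
qed

lemma binv_mult: "binv bc (x * y) = binv bc x * binv bc y"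
proof (induction x rule: homogeneous_induct)
  case (add x x')
  then show ?case by (simp add: binv_add distrib_right)
next
  case (homogeneous p x)
  show ?case
  proof (induction y rule: homogeneous_induct)
    case (add y y')
    then show ?case by (simp add: binv_add distrib_left)
  next
    case (homogeneous q y)
    from bc_mult[OF \<open>bc p x = x\<close> this] have "binv bc (x * y) = (-1) ^ (p + q) * (x * y)"
      by (rule binv_homogeneous)
    then show ?case
      by (cases "even p"; cases "even q")
         (simp_all add: binv_homogeneous[OF homogeneous] binv_homogeneous[OF \<open>bc p x = x\<close>])
  qed
qed

lemma dB_binv: "dB (binv bc x) = - binv bc (dB x)"
proof (induction x rule: homogeneous_induct)
  case (add x y)
  then show ?case by (simp add: binv_add dB_add)
next
  case (homogeneous p x)
  then show ?case by (simp add: binv_homogeneous dB_pm binv_homogeneous[OF dB_degree])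
qed

lemma dB_mult: "dB (x * y) = dB x * y + binv bc x * dB y"
proof (induction x rule: homogeneous_induct)
  case (add x x')
  then show ?case by (simp add: binv_add dB_add distrib_right)
next
  case (homogeneous p x)
  then show ?case by (simp add: binv_homogeneous dB_mult_homogeneous mult.assoc)
qed

lemma bc_dB: "bc (Suc n) (dB x) = dB (bc n x)"
proof (induction x rule: homogeneous_induct)
  case (add x y)
  then show ?case by (simp add: bc_add dB_add)
next
  case (homogeneous p x)
  have "bc (Suc n) (dB x) = (if n = p then dB x else 0)"
    using bc_bc[of "Suc n" "Suc p" "dB x"] dB_degree[OF homogeneous] by simp
  moreover have "bc n x = (if n = p then x else 0)"
    using bc_bc[of n p x] homogeneous by auto
  ultimately show ?case by auto
qed

lemma bc_0_dB: "bc 0 (dB x) = 0"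
proof (induction x rule: homogeneous_induct)
  case (add x y)
  then show ?case by (simp add: bc_add dB_add)
next
  case (homogeneous p x)
  show ?case using bc_bc[of 0 "Suc p" "dB x"] dB_degree[OF homogeneous] by simp
qed

lemma dB_one [simp]: "dB 1 = 0"
  using dB_mult[of 1 1] by simp

text \<open>The Koszul sign that a coefficient picks up when something of degree \<open>k\<close>
  moves past it: the \<open>k\<close>-th iterate of the sign involution, which has order
  two.\<close>

definition bet :: "nat \<Rightarrow> 'b \<Rightarrow> 'b" where "bet k x = (if even k then x else binv bc x)"

lemma bet_add: "bet k (x + y) = bet k x + bet k y"
  and bet_zero [simp]: "bet k 0 = 0"
  and bet_minus: "bet k (- x) = - bet k x"
  and bet_one [simp]: "bet k 1 = 1"
  and bet_mult: "bet k (x * y) = bet k x * bet k y"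
  and bet_bet: "bet k (bet l x) = bet (k + l) x"
  and bet_0 [simp]: "bet 0 x = x"
  and bet_pm: "bet k ((-1) ^ l * x) = (-1) ^ l * bet k x"
  and bet_homogeneous: "bc p x = x \<Longrightarrow> bet k x = (-1) ^ (p * k) * x"
  and bet_binv: "bet k (binv bc x) = binv bc (bet k x)"
  and dB_bet: "dB (bet k x) = (-1) ^ k * bet k (dB x)"
  by (auto simp: bet_def binv_add binv_minus binv_mult binv_homogeneous dB_binv bc_binv
      minus_one_power_iff)

lemma bet_sum: "bet k (sum f A) = (\<Sum>a\<in>A. bet k (f a))"
  by (induction A rule: infinite_finite_induct) (auto simp: bet_add)

lemma bet_of_int [simp]: "bet k (of_int i) = of_int i"
proof -
  have n: "bet k (of_nat n) = of_nat n" for n by (induction n) (auto simp: bet_add)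
  show ?thesis by (cases i rule: int_diff_cases) (simp add: n bet_add bet_minus flip: add_uminus_conv_diff)
qed

text \<open>Only one factor has to be homogeneous, since \<open>bet\<close> distributes the sign
  over the components of the other. In this form commutativity applies to arbitrary
  coefficients.\<close>

lemma commute_homogeneous: "bc p x = x \<Longrightarrow> x * y = bet p y * x"
proof (induction y rule: homogeneous_induct)
  case (add y z)
  then show ?case by (simp add: distrib_left distrib_right bet_add)
next
  case (homogeneous q y)
  then show ?case
    by (simp add: bet_homogeneous bc_commute[of p x q y] mult.commute[of q p] mult.assoc)
qed

subsection \<open>Rational scalars\<close>

definition ninv :: "nat \<Rightarrow> 'b" where "ninv n = (SOME u. of_nat n * u = 1 \<and> u * of_nat n = 1)"

lemma ninv: "n > 0 \<Longrightarrow> of_nat n * ninv n = 1" "n > 0 \<Longrightarrow> ninv n * of_nat n = 1"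
  unfolding ninv_def using someI_ex[OF nat_invertible, of n] by auto

lemma of_nat_cancel:
  assumes "n > 0" "of_nat n * x = of_nat n * (y::'b)"
  shows "x = y"
proof -
  have "ninv n * (of_nat n * x) = ninv n * (of_nat n * y)" using assms(2) by simp
  then show ?thesis by (simp add: ninv assms(1) flip: mult.assoc)
qed

lemma of_nat_commute: "of_nat n * x = x * (of_nat n :: 'b)"
  by (induction n) (auto simp: distrib_left distrib_right)

lemma of_int_commute: "of_int n * x = x * (of_int n :: 'b)"
  by (cases n rule: int_diff_cases) (simp add: left_diff_distrib right_diff_distrib of_nat_commute)

lemma bc_of_nat: "bc p (of_nat n * x) = of_nat n * bc p x"
  by (induction n) (auto simp: distrib_right bc_add)

lemma dB_of_nat: "dB (of_nat n * x) = of_nat n * dB x"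
  by (induction n) (auto simp: distrib_right dB_add)

lemma bc_of_int: "bc p (of_int n * x) = of_int n * bc p x"
  by (cases n rule: int_diff_cases) (simp add: left_diff_distrib bc_of_nat bc_diff)

lemma dB_of_int: "dB (of_int n * x) = of_int n * dB x"
  by (cases n rule: int_diff_cases) (simp add: left_diff_distrib dB_of_nat dB_diff)

lemma bc_ninv: "n > 0 \<Longrightarrow> bc p (ninv n * x) = ninv n * bc p x"
  by (rule of_nat_cancel, assumption)
     (metis bc_of_nat mult.assoc mult_1 ninv(1))

lemma dB_ninv: "n > 0 \<Longrightarrow> dB (ninv n * x) = ninv n * dB x"
  by (rule of_nat_cancel, assumption)
     (metis dB_of_nat mult.assoc mult_1 ninv(1))

text \<open>Integers are invertible, so the description operator in \<open>qsc\<close> has a unique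
  solution, namely multiplication by the chosen inverse. From here on rational scalars are ordinary
  multiplications.\<close>

lemma qsc_eq:
  obtains n :: int and d :: nat where "d > 0" "\<And>x. qsc q x = of_int n * (ninv d * x)"
proof -
  obtain a b where ab: "quotient_of q = (a, b)" by (cases "quotient_of q")
  then have b: "b > 0" by (rule quotient_of_denom_pos)
  then have ob: "of_int b = (of_nat (nat b) :: 'b)" by simp
  have "(THE y. of_int b * y = x) = ninv (nat b) * x" for x :: 'b
    unfolding ob
  proof (rule the_equality)
    show "of_nat (nat b) * (ninv (nat b) * x) = x"
      using b ninv(1)[of "nat b"] by (metis mult.assoc mult_1 zero_less_nat_eq)
    show "y = ninv (nat b) * x" if "of_nat (nat b) * y = x" for y
      unfolding that[symmetric] using b ninv(2)[of "nat b"] by (metis mult.assoc mult_1 zero_less_nat_eq)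
  qed
  then have "qsc q x = of_int a * (ninv (nat b) * x)" for x :: 'b
    by (simp add: qsc_def ab)
  with b show thesis using that[of "nat b" a] by simp
qed

lemma qsc_mult: "qsc q (x::'b) = qsc q 1 * x"
  by (rule qsc_eq[of q]) (simp add: mult.assoc)

end

text \<open>The union is disjoint exactly when \<open>x\<close> is a new letter, which is the case
  when words of odd letters are split.\<close>

lemma submultisets_add:
  "{k. k \<subseteq># add_mset x m} = {k. k \<subseteq># m} \<union> add_mset x ` {k. k \<subseteq># m}"
proof (intro equalityI subsetI)
  fix k assume "k \<in> {k. k \<subseteq># add_mset x m}"
  then have k: "k \<subseteq># add_mset x m" by simp
  show "k \<in> {k. k \<subseteq># m} \<union> add_mset x ` {k. k \<subseteq># m}"
  proof (cases "x \<in># k")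
    case True
    then have "k = add_mset x (k - {#x#})" by simp
    moreover have "k - {#x#} \<subseteq># m" using k by (simp add: subset_eq_diff_conv)
    ultimately show ?thesis by blast
  next
    case False
    then have "k \<subseteq># m" using k
      by (metis diff_single_trivial subset_eq_diff_conv add_mset_add_single)
    then show ?thesis by simp
  qed
next
  fix k assume "k \<in> {k. k \<subseteq># m} \<union> add_mset x ` {k. k \<subseteq># m}"
  then show "k \<in> {k. k \<subseteq># add_mset x m}"
    by (auto intro: subset_mset.order_trans[of _ m])
qed

lemma finite_submultisets: "finite {k. k \<subseteq># (m :: 'a multiset)}"
  by (induction m) (simp_all add: submultisets_add)

locale cdga_ext = cdga_base bc dB for bc :: "nat \<Rightarrow> 'b::ring_1 \<Rightarrow> 'b" and dB +
  fixes dg :: "'i::linorder \<Rightarrow> nat"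
begin

subsection \<open>Monomials and signs\<close>

abbreviation vld :: "'i gen multiset \<Rightarrow> bool" where "vld \<equiv> valid dg"
abbreviation odg :: "'i gen \<Rightarrow> bool" where "odg x \<equiv> odd (gdeg dg x)"

lemma mdeg_empty [simp]: "mdeg dg {#} = 0"
  and mdeg_add_mset [simp]: "mdeg dg (add_mset x m) = gdeg dg x + mdeg dg m"
  and mdeg_add [simp]: "mdeg dg (m + n) = mdeg dg m + mdeg dg n"
  by (auto simp: mdeg_def)

lemma mdeg_diff: "m \<subseteq># n \<Longrightarrow> mdeg dg n = mdeg dg m + mdeg dg (n - m)"
  by (metis mdeg_add subset_mset.add_diff_inverse)

lemma valid_empty [simp]: "vld {#}" and valid_single [simp]: "vld {#x#}"
  by (auto simp: valid_def)

lemma valid_subset: "m \<subseteq># n \<Longrightarrow> vld n \<Longrightarrow> vld m"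
  unfolding valid_def by (meson le_trans mset_subset_eq_count)

lemma valid_add_iff:
  "vld (m + n) \<longleftrightarrow> vld m \<and> vld n \<and> (\<forall>x. odg x \<longrightarrow> x \<in># m \<longrightarrow> x \<notin># n)"
proof
  assume v: "vld (m + n)"
  have "x \<notin># n" if "odg x" "x \<in># m" for x
  proof
    assume "x \<in># n"
    then have "count m x \<ge> 1" "count n x \<ge> 1" using that by (simp_all add: Suc_le_eq)
    moreover have "count m x + count n x \<le> 1" using v that unfolding valid_def by auto
    ultimately show False by linarith
  qed
  then show "vld m \<and> vld n \<and> (\<forall>x. odg x \<longrightarrow> x \<in># m \<longrightarrow> x \<notin># n)"
    using valid_subset[OF _ v] by auto
next
  assume a: "vld m \<and> vld n \<and> (\<forall>x. odg x \<longrightarrow> x \<in># m \<longrightarrow> x \<notin># n)"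
  show "vld (m + n)"
    unfolding valid_def
  proof (intro allI impI)
    fix x assume "odg x"
    then show "count (m + n) x \<le> 1"
      using a unfolding valid_def
      by (cases "x \<in># m") (auto simp: not_in_iff)
  qed
qed

lemma valid_add_mset_iff: "vld (add_mset x n) \<longleftrightarrow> vld n \<and> (odg x \<longrightarrow> x \<notin># n)"
  using valid_add_iff[of "{#x#}" n] by auto

definition msign_pairs :: "'i gen multiset \<Rightarrow> 'i gen multiset \<Rightarrow> ('i gen \<times> 'i gen) set" where
  "msign_pairs m n = {(x, y). x \<in># m \<and> y \<in># n \<and> odg x \<and> odg y \<and> y < x}"

lemma msign_eq: "msign dg m n = (-1) ^ card (msign_pairs m n)"
  by (simp add: msign_def msign_pairs_def)

lemma finite_msign_pairs: "finite (msign_pairs m n)"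
  by (rule finite_subset[of _ "set_mset m \<times> set_mset n"]) (auto simp: msign_pairs_def)

text \<open>\<open>msign\<close> counts pairs of distinct generators and ignores multiplicities, so
  it is multiplicative only if no odd generator occurs in both summands. Validity of the sum
  guarantees this.\<close>

lemma msign_add_left: "vld (m1 + m2) \<Longrightarrow> msign dg (m1 + m2) n = msign dg m1 n * msign dg m2 n"
proof -
  assume "vld (m1 + m2)"
  then have "msign_pairs m1 n \<inter> msign_pairs m2 n = {}"
    by (auto simp: msign_pairs_def valid_add_iff)
  moreover have "msign_pairs (m1 + m2) n = msign_pairs m1 n \<union> msign_pairs m2 n"
    by (auto simp: msign_pairs_def)
  ultimately show ?thesis
    by (simp add: msign_eq card_Un_disjoint finite_msign_pairs power_add)
qed

lemma msign_add_right: "vld (n1 + n2) \<Longrightarrow> msign dg m (n1 + n2) = msign dg m n1 * msign dg m n2"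
proof -
  assume "vld (n1 + n2)"
  then have "msign_pairs m n1 \<inter> msign_pairs m n2 = {}"
    by (auto simp: msign_pairs_def valid_add_iff)
  moreover have "msign_pairs m (n1 + n2) = msign_pairs m n1 \<union> msign_pairs m n2"
    by (auto simp: msign_pairs_def)
  ultimately show ?thesis
    by (simp add: msign_eq card_Un_disjoint finite_msign_pairs power_add)
qed

lemma msign_empty [simp]: "msign dg {#} n = 1" "msign dg m {#} = 1"
  by (auto simp: msign_def)

lemma msign_single: "msign dg {#x#} {#y#} = (if odg x \<and> odg y \<and> y < x then -1 else 1)"
proof -
  have "msign_pairs {#x#} {#y#} = (if odg x \<and> odg y \<and> y < x then {(x, y)} else {})"
    by (auto simp: msign_pairs_def)
  then show ?thesis by (simp add: msign_eq)
qed

lemma msign_eq_1: "(\<And>x y. x \<in># m \<Longrightarrow> y \<in># n \<Longrightarrow> odg x \<Longrightarrow> odg y \<Longrightarrow> x \<le> y) \<Longrightarrow> msign dg m n = 1"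
proof -
  assume "\<And>x y. x \<in># m \<Longrightarrow> y \<in># n \<Longrightarrow> odg x \<Longrightarrow> odg y \<Longrightarrow> x \<le> y"
  then have "msign_pairs m n = {}" unfolding msign_pairs_def by fastforce
  then show ?thesis by (simp add: msign_eq)
qed

lemma msign_square: "msign dg m n * msign dg m n = 1"
  by (simp add: msign_eq flip: power_add)

text \<open>Validity excludes equal odd generators, so every odd pair is an inversion in exactly one
  of the two orders, and the number of odd pairs has the parity of the product of the
  degrees.\<close>

lemma msign_swap: "vld (m + n) \<Longrightarrow> msign dg n m = msign dg m n * (-1) ^ (mdeg dg m * mdeg dg n)"
proof (induction m)
  case empty
  then show ?case by simp
next
  case (add x m)
  have 1: "msign dg n {#x#} = msign dg {#x#} n * (-1) ^ (gdeg dg x * mdeg dg n)"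
    if "vld (add_mset x n)" for x n
    using that
  proof (induction n)
    case empty
    then show ?case by simp
  next
    case (add y n)
    have v: "vld ({#y#} + n)" "vld (add_mset x n)"
      using add.prems by (auto simp: valid_add_iff valid_add_mset_iff)
    have "msign dg {#y#} {#x#} = msign dg {#x#} {#y#} * (-1) ^ (gdeg dg x * gdeg dg y)"
      using add.prems by (auto simp: msign_single valid_add_mset_iff)
    then show ?case
      using msign_add_left[OF v(1), of "{#x#}"] msign_add_right[OF v(1), of "{#x#}"] add.IH[OF v(2)]
      by (simp add: distrib_left power_add)
  qed
  have v: "vld ({#x#} + m)" "vld (m + n)" "vld (add_mset x n)"
    using add.prems by (auto simp: valid_add_iff valid_add_mset_iff)
  show ?case
    using msign_add_left[OF v(1), of n] msign_add_right[OF v(1), of n] add.IH[OF v(2)] 1[OF v(3)]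
    by (simp add: distrib_right power_add)
qed

text \<open>The 2-cocycle identity of the sign, which is what associativity of the product amounts
  to on monomials.\<close>

lemma msign_cocycle:
  assumes "vld (a + b + c)"
  shows "msign dg a b * msign dg (a + b) c = msign dg b c * msign dg a (b + c)"
proof -
  have "vld (a + b)" "vld (b + c)" using assms by (auto simp: valid_add_iff)
  then show ?thesis by (simp add: msign_add_left msign_add_right)
qed

subsection \<open>The product\<close>

definition tm :: "('i, 'b) elt \<Rightarrow> ('i, 'b) elt \<Rightarrow> ('i, 'b) elt" (infixl \<open>\<odot>\<close> 70) where
  "f \<odot> g = tmul dg bc f g"

lemma tm_apply:
  "(f \<odot> g) n = (if vld n then
     \<Sum>m\<in>{m. m \<subseteq># n}. of_int (msign dg m (n - m)) * (f m * bet (mdeg dg m) (g (n - m))) else 0)"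
  unfolding tm_def tmul_def bet_def by simp

lemma of_int_left_commute: "x * (of_int k * y) = of_int k * (x * (y::'b))"
  by (metis mult.assoc of_int_commute)

theorem tm_assoc: "(f \<odot> g) \<odot> h = f \<odot> (g \<odot> h)"
proof
  fix n
  show "((f \<odot> g) \<odot> h) n = (f \<odot> (g \<odot> h)) n"
  proof (cases "vld n")
    case False
    then show ?thesis by (simp add: tm_apply)
  next
    case True
    \<comment> \<open>The common summand of both bracketings: the contribution of an ordered
      decomposition of \<open>n\<close> into three parts.\<close>
    define F where "F a b c = of_int (msign dg a b * msign dg (a + b) c) *
      (f a * (bet (mdeg dg a) (g b) * bet (mdeg dg a + mdeg dg b) (h c)))" for a b c
    have *: "m - k \<subseteq># n - k" "k \<subseteq># n" if "k \<subseteq># m" "m \<subseteq># n" for m k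
      using that by (auto simp: subseteq_mset_def intro: diff_le_mono le_trans)
    have **: "k + l \<subseteq># n" "n - (k + l) = n - k - l" if "k \<subseteq># n" "l \<subseteq># n - k" for k l
      using that by (auto simp: subset_mset.le_diff_conv2 add.commute)
    have "((f \<odot> g) \<odot> h) n = (\<Sum>m\<in>{m. m \<subseteq># n}. \<Sum>k\<in>{k. k \<subseteq># m}. F k (m - k) (n - m))"
      unfolding tm_apply[of "f \<odot> g"]
    proof (simp only: True if_True, rule sum.cong[OF refl])
      fix m assume "m \<in> {m. m \<subseteq># n}"
      then have m: "m \<subseteq># n" by simp
      then have "vld m" using True valid_subset by blast
      then show "of_int (msign dg m (n - m)) * ((f \<odot> g) m * bet (mdeg dg m) (h (n - m)))
         = (\<Sum>k\<in>{k. k \<subseteq># m}. F k (m - k) (n - m))"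
        unfolding tm_apply[of f g m] if_P[OF \<open>vld m\<close>] sum_distrib_left sum_distrib_right
      proof (intro sum.cong refl)
        fix k assume "k \<in> {k. k \<subseteq># m}"
        then have k: "k \<subseteq># m" by simp
        show "of_int (msign dg m (n - m)) * (of_int (msign dg k (m - k)) *
            (f k * bet (mdeg dg k) (g (m - k))) * bet (mdeg dg m) (h (n - m))) = F k (m - k) (n - m)"
          unfolding F_def mdeg_diff[OF k] subset_mset.add_diff_inverse[OF k] of_int_mult mult.assoc
          by (rule of_int_left_commute)
      qed
    qed
    also have "\<dots> = (\<Sum>(m, k)\<in>Sigma {m. m \<subseteq># n} (\<lambda>m. {k. k \<subseteq># m}). F k (m - k) (n - m))"
      by (rule sum.Sigma) (auto simp: finite_submultisets)
    \<comment> \<open>Chains \<open>k\<close> inside \<open>m\<close> inside \<open>n\<close>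
      correspond to decompositions into \<open>k\<close>, \<open>m - k\<close> and
      \<open>n - m\<close>.\<close>
    also have "\<dots> = (\<Sum>(k, l)\<in>Sigma {k. k \<subseteq># n} (\<lambda>k. {l. l \<subseteq># n - k}). F k l (n - k - l))"
      by (rule sum.reindex_bij_witness[where i = "\<lambda>(k, l). (k + l, k)" and j = "\<lambda>(m, k). (k, m - k)"])
         (auto simp: *(1) ** dest: *(2))
    also have "\<dots> = (\<Sum>k\<in>{k. k \<subseteq># n}. \<Sum>l\<in>{l. l \<subseteq># n - k}. F k l (n - k - l))"
      by (rule sum.Sigma[symmetric]) (auto simp: finite_submultisets)
    also have "\<dots> = (f \<odot> (g \<odot> h)) n"
      unfolding tm_apply[of f]
    proof (simp only: True if_True, rule sum.cong[OF refl])
      fix k assume "k \<in> {k. k \<subseteq># n}"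
      then have k: "k \<subseteq># n" by simp
      then have v: "vld (n - k)" using True valid_subset by (meson diff_subset_eq_self)
      have "F k l (n - k - l) = of_int (msign dg k (n - k)) * (f k * bet (mdeg dg k)
          (of_int (msign dg l (n - k - l)) * (g l * bet (mdeg dg l) (h (n - k - l)))))"
        if l: "l \<subseteq># n - k" for l
      proof -
        have n: "l + (n - k - l) = n - k" by (rule subset_mset.add_diff_inverse[OF l])
        then have n': "k + l + (n - k - l) = n"
          by (simp only: add.assoc subset_mset.add_diff_inverse[OF k])
        have "vld (k + l + (n - k - l))" unfolding n' by (rule True)
        from msign_cocycle[OF this] show ?thesis
          unfolding F_def n by (simp only: bet_mult bet_bet bet_of_int of_int_mult mult.assoc of_int_left_commute[of "f k"])
               (rule of_int_left_commute)
      qed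
      then show "(\<Sum>l\<in>{l. l \<subseteq># n - k}. F k l (n - k - l)) =
          of_int (msign dg k (n - k)) * (f k * bet (mdeg dg k) ((g \<odot> h) (n - k)))"
        unfolding tm_apply using v
        by (simp add: sum_distrib_left bet_sum)
    qed
    finally show ?thesis .
  qed
qed

lemma tm_add_left: "(f + g) \<odot> h = f \<odot> h + g \<odot> h"
  by (rule ext) (auto simp: tm_apply distrib_left distrib_right sum.distrib)

lemma tm_add_right: "f \<odot> (g + h) = f \<odot> g + f \<odot> h"
  by (rule ext) (auto simp: tm_apply distrib_left distrib_right sum.distrib bet_add)

lemma tm_zero [simp]: "0 \<odot> h = 0" "h \<odot> 0 = 0"
  by (rule ext, simp add: tm_apply)+

lemma tm_minus_left: "(- f) \<odot> h = - (f \<odot> h)"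
  using tm_add_left[of f "- f" h] by (simp add: eq_neg_iff_add_eq_0 add.commute)

lemma tm_minus_right: "f \<odot> (- h) = - (f \<odot> h)"
  using tm_add_right[of f h "- h"] by (simp add: eq_neg_iff_add_eq_0 add.commute)

lemma tm_diff_left: "(f - g) \<odot> h = f \<odot> h - g \<odot> h"
  using tm_add_left[of f "- g" h] by (simp add: tm_minus_left)

lemma tm_diff_right: "f \<odot> (g - h) = f \<odot> g - f \<odot> h"
  using tm_add_right[of f g "- h"] by (simp add: tm_minus_right)

lemma tm_sum_left: "sum f A \<odot> h = (\<Sum>a\<in>A. f a \<odot> h)"
  by (rule additive_sum[of "\<lambda>f. f \<odot> h"]) (simp_all add: tm_add_left)

lemma tm_sum_right: "h \<odot> sum f A = (\<Sum>a\<in>A. h \<odot> f a)"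
  by (rule additive_sum[of "\<lambda>f. h \<odot> f"]) (simp_all add: tm_add_right)

definition mono :: "'b \<Rightarrow> 'i gen multiset \<Rightarrow> ('i, 'b) elt" where
  "mono b m = (\<lambda>n. if n = m then b else 0)"

abbreviation inc :: "'b \<Rightarrow> ('i, 'b) elt" where "inc \<equiv> incl"

lemma incl_eq_mono: "incl b = mono b {#}" and gel_eq_mono: "gel x = mono 1 {#x#}"
  by (simp_all add: incl_def gel_def mono_def)

lemma mono_zero [simp]: "mono 0 m = 0"
  and mono_add: "mono (b + c) m = mono b m + mono c m"
  and mono_minus: "mono (- b) m = - mono b m"
  by (auto simp: mono_def)

lemma tm_mono_right:
  "(f \<odot> mono b m) n = (if vld n \<and> m \<subseteq># n
     then of_int (msign dg (n - m) m) * (f (n - m) * bet (mdeg dg (n - m)) b) else 0)"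
proof (cases "vld n")
  case True
  have "(f \<odot> mono b m) n = (\<Sum>k\<in>{k. k \<subseteq># n}. if m \<subseteq># n \<and> k = n - m
     then of_int (msign dg (n - m) m) * (f (n - m) * bet (mdeg dg (n - m)) b) else 0)"
    unfolding tm_apply if_P[OF True]
  proof (rule sum.cong[OF refl])
    fix k assume "k \<in> {k. k \<subseteq># n}"
    then have k: "k \<subseteq># n" by simp
    have "n - k = m \<longleftrightarrow> m \<subseteq># n \<and> k = n - m"
      using k by (metis diff_subset_eq_self subset_mset.add_diff_inverse add_diff_cancel_left'
          subset_mset.diff_add add_diff_cancel_right')
    then show "of_int (msign dg k (n - k)) * (f k * bet (mdeg dg k) (mono b m (n - k))) =
       (if m \<subseteq># n \<and> k = n - m
     then of_int (msign dg (n - m) m) * (f (n - m) * bet (mdeg dg (n - m)) b) else 0)"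
      by (auto simp: mono_def)
  qed
  also have "\<dots> = (if m \<subseteq># n then of_int (msign dg (n - m) m) * (f (n - m) * bet (mdeg dg (n - m)) b) else 0)"
    by (simp add: finite_submultisets)
  finally show ?thesis using True by simp
qed (simp add: tm_apply)

lemma mono_mult:
  "mono b m \<odot> mono c n = (if vld (m + n)
     then mono (of_int (msign dg m n) * (b * bet (mdeg dg m) c)) (m + n) else 0)"
proof
  fix k
  have *: "n \<subseteq># k \<and> k - n = m \<longleftrightarrow> k = m + n" by auto
  show "(mono b m \<odot> mono c n) k = (if vld (m + n)
     then mono (of_int (msign dg m n) * (b * bet (mdeg dg m) c)) (m + n) else 0) k"
    unfolding tm_mono_right using * by (auto simp: mono_def)
qed

lemma incl_tm: "(incl b \<odot> f) n = (if vld n then b * f n else 0)"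
proof (cases "vld n")
  case True
  have "(incl b \<odot> f) n = (\<Sum>m\<in>{{#}}. of_int (msign dg m (n - m)) * (incl b m * bet (mdeg dg m) (f (n - m))))"
    unfolding tm_apply if_P[OF True]
    by (rule sum.mono_neutral_right) (auto simp: finite_submultisets incl_def)
  then show ?thesis using True by (simp add: incl_def)
qed (simp add: tm_apply)

lemma tm_incl: "(f \<odot> incl b) n = (if vld n then f n * bet (mdeg dg n) b else 0)"
  unfolding incl_eq_mono tm_mono_right by simp

lemma incl_mult: "incl b \<odot> incl c = incl (b * c)"
  by (simp add: incl_eq_mono mono_mult)

lemma incl_add: "inc (b + c) = inc b + inc c" and incl_zero [simp]: "inc 0 = 0"
  and incl_minus: "inc (- b) = - inc b"
  by (simp_all add: incl_eq_mono mono_add mono_minus)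

text \<open>Multiplies the part of total degree p by (-1)^(k p).\<close>
definition par :: "nat \<Rightarrow> ('i, 'b) elt \<Rightarrow> ('i, 'b) elt" where
  "par k f = (\<lambda>m. (-1) ^ (k * mdeg dg m) * bet k (f m))"

lemma par_add: "par k (f + g) = par k f + par k g" and par_zero [simp]: "par k 0 = 0"
  by (auto simp: par_def bet_add distrib_left)

lemma par_0 [simp]: "par 0 f = f"
  by (simp add: par_def)

lemma par_par: "par k (par l f) = par (k + l) f"
  by (auto simp: par_def bet_pm bet_bet distrib_right power_add mult.assoc)

lemma par_even: "even k \<Longrightarrow> par k f = f"
  by (simp add: par_def bet_def)

lemma par_mono: "par k (mono b m) = mono ((-1) ^ (k * mdeg dg m) * bet k b) m"
  by (auto simp: par_def mono_def)

lemma par_incl: "par k (incl b) = incl (bet k b)"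
  by (simp add: incl_eq_mono par_mono)

lemma par_mult: "par k (f \<odot> g) = par k f \<odot> par k g"
proof
  fix n
  show "par k (f \<odot> g) n = (par k f \<odot> par k g) n"
  proof (cases "vld n")
    case True
    show ?thesis
      unfolding par_def tm_apply if_P[OF True] bet_sum sum_distrib_left
    proof (rule sum.cong[OF refl])
      fix m assume "m \<in> {m. m \<subseteq># n}"
      then have "mdeg dg n = mdeg dg m + mdeg dg (n - m)" by (simp add: mdeg_diff)
      then show "(-1) ^ (k * mdeg dg n) * bet k (of_int (msign dg m (n - m)) * (f m * bet (mdeg dg m) (g (n - m))))
        = of_int (msign dg m (n - m)) * ((-1) ^ (k * mdeg dg m) * bet k (f m) *
           bet (mdeg dg m) ((-1) ^ (k * mdeg dg (n - m)) * bet k (g (n - m))))"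
        by (cases "even (k * mdeg dg m)"; cases "even (k * mdeg dg (n - m))")
           (auto simp: bet_mult bet_bet bet_minus distrib_left power_add add.commute)
    qed
  qed (simp add: par_def tm_apply)
qed

definition hg :: "nat \<Rightarrow> ('i, 'b) elt \<Rightarrow> bool" where "hg p f \<longleftrightarrow> comp dg bc p f = f"

lemma hg_iff: "hg p f \<longleftrightarrow> (\<forall>m. f m = (if mdeg dg m \<le> p then bc (p - mdeg dg m) (f m) else 0))"
  unfolding hg_def comp_def fun_eq_iff by metis

lemma hgD: "hg p f \<Longrightarrow> f m \<noteq> 0 \<Longrightarrow> mdeg dg m \<le> p \<and> bc (p - mdeg dg m) (f m) = f m"
  unfolding hg_iff by (metis (full_types))

lemma hgI: "(\<And>m. f m \<noteq> 0 \<Longrightarrow> mdeg dg m \<le> p \<and> bc (p - mdeg dg m) (f m) = f m) \<Longrightarrow> hg p f"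
proof -
  assume a: "\<And>m. f m \<noteq> 0 \<Longrightarrow> mdeg dg m \<le> p \<and> bc (p - mdeg dg m) (f m) = f m"
  show ?thesis unfolding hg_def comp_def
  proof
    fix m show "(if mdeg dg m \<le> p then bc (p - mdeg dg m) (f m) else 0) = f m"
      using a[of m] by (cases "f m = 0") auto
  qed
qed

lemma hg_zero [simp]: "hg p 0" by (rule hgI) simp

lemma hg_add: "hg p f \<Longrightarrow> hg p g \<Longrightarrow> hg p (f + g)"
  unfolding hg_iff by (simp add: bc_add) (metis add.right_neutral)

lemma hg_minus: "hg p f \<Longrightarrow> hg p (- f)"
  unfolding hg_iff by (simp add: bc_minus) (metis neg_0_equal_iff_equal)

lemma hg_diff: "hg p f \<Longrightarrow> hg p g \<Longrightarrow> hg p (f - g)"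
  using hg_add[of p f "- g"] hg_minus[of p g] by simp

lemma hg_sum: "(\<And>a. a \<in> A \<Longrightarrow> hg p (f a)) \<Longrightarrow> hg p (sum f A)"
  by (induction A rule: infinite_finite_induct) (auto intro: hg_add)

lemma hg_mono: "bc q b = b \<Longrightarrow> hg (q + mdeg dg m) (mono b m)"
  by (rule hgI) (auto simp: mono_def split: if_splits)

lemma hg_incl: "bc q b = b \<Longrightarrow> hg q (incl b)"
  using hg_mono[of q b "{#}"] by (simp add: incl_eq_mono)

lemma hg_gel: "hg (gdeg dg x) (gel x)"
  using hg_mono[of 0 1 "{#x#}"] by (simp add: gel_eq_mono bc_one)

lemma hg_mult: assumes "hg p f" "hg q g" shows "hg (p + q) (f \<odot> g)"
proof -
  have "mdeg dg n \<le> p + q \<and> bc (p + q - mdeg dg n) ((f \<odot> g) n) = (f \<odot> g) n"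
    if nz: "(f \<odot> g) n \<noteq> 0" for n
  proof -
    have v: "vld n" using nz unfolding tm_apply by meson
    have t: "mdeg dg n \<le> p + q \<and> bc (p + q - mdeg dg n) T = T"
      if m: "m \<subseteq># n" and T: "T = of_int (msign dg m (n - m)) * (f m * bet (mdeg dg m) (g (n - m)))"
        and T0: "T \<noteq> 0" for m T
    proof -
      have f: "mdeg dg m \<le> p" "bc (p - mdeg dg m) (f m) = f m"
        using hgD[OF assms(1), of m] T0 T by (metis mult_zero_left mult_zero_right)+
      have g: "mdeg dg (n - m) \<le> q" "bc (q - mdeg dg (n - m)) (g (n - m)) = g (n - m)"
        using hgD[OF assms(2), of "n - m"] T0 T by (metis bet_zero mult_zero_right)+
      have d: "mdeg dg n = mdeg dg m + mdeg dg (n - m)" using m by (rule mdeg_diff)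
      have "bc (q - mdeg dg (n - m)) (bet (mdeg dg m) (g (n - m))) = bet (mdeg dg m) (g (n - m))"
        unfolding bet_homogeneous[OF g(2)] bc_pm g(2) ..
      from bc_mult[OF f(2) this]
      have "bc (p + q - mdeg dg n) (f m * bet (mdeg dg m) (g (n - m))) = f m * bet (mdeg dg m) (g (n - m))"
        using f g d by (metis diff_add_assoc diff_add_assoc2 diff_diff_left)
      then show ?thesis using f g d T by (simp add: bc_of_int)
    qed
    obtain m where "m \<subseteq># n" "of_int (msign dg m (n - m)) * (f m * bet (mdeg dg m) (g (n - m))) \<noteq> 0"
      using nz unfolding tm_apply if_P[OF v] by (metis (mono_tags, lifting) mem_Collect_eq sum.neutral)
    then have le: "mdeg dg n \<le> p + q" using t by blast
    have "bc (p + q - mdeg dg n) T = T"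
      if "m \<subseteq># n" "T = of_int (msign dg m (n - m)) * (f m * bet (mdeg dg m) (g (n - m)))" for m T
      using t[OF that] by (cases "T = 0") auto
    then have "bc (p + q - mdeg dg n) ((f \<odot> g) n) = (f \<odot> g) n"
      unfolding tm_apply if_P[OF v] bc_sum by (intro sum.cong) auto
    with le show ?thesis by blast
  qed
  then show ?thesis by (rule hgI)
qed

theorem tm_commute: assumes "hg p f" shows "f \<odot> g = par p g \<odot> f"
proof
  fix n
  show "(f \<odot> g) n = (par p g \<odot> f) n"
  proof (cases "vld n")
    case True
    have "(f \<odot> g) n = (\<Sum>k\<in>{k. k \<subseteq># n}. of_int (msign dg (n - k) k) * (f (n - k) * bet (mdeg dg (n - k)) (g k)))"
      unfolding tm_apply if_P[OF True]
      by (rule sum.reindex_bij_witness[where i = "\<lambda>k. n - k" and j = "\<lambda>k. n - k"])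
         (auto simp: subset_mset.diff_diff_right double_diff)
    also have "\<dots> = (par p g \<odot> f) n"
      unfolding tm_apply if_P[OF True]
    proof (rule sum.cong[OF refl])
      fix k assume "k \<in> {k. k \<subseteq># n}"
      then have k: "k \<subseteq># n" by simp
      define l where "l = n - k"
      have v: "vld (k + l)" using True k by (simp add: l_def)
      show "of_int (msign dg (n - k) k) * (f (n - k) * bet (mdeg dg (n - k)) (g k)) =
        of_int (msign dg k (n - k)) * (par p g k * bet (mdeg dg k) (f (n - k)))"
        unfolding l_def[symmetric]
      proof (cases "f l = 0")
        case False
        then have le: "mdeg dg l \<le> p" and h: "bc (p - mdeg dg l) (f l) = f l"
          using hgD[OF assms] by auto
        have c: "f l * bet (mdeg dg l) (g k) = bet p (g k) * f l"
          using commute_homogeneous[OF h, of "bet (mdeg dg l) (g k)"] le by (simp add: bet_bet)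
        have s: "of_int (msign dg l k) = (of_int (msign dg k l) :: 'b) * (-1) ^ (mdeg dg k * mdeg dg l)"
          by (simp add: msign_swap[OF v])
        \<comment> \<open>The exponents come from \<open>par\<close> and from the coefficient of
          \<open>f\<close> passing the monomial \<open>k\<close>; their sum has the parity of the
          sign produced by \<open>msign_swap\<close>.\<close>
        have e: "even (p * mdeg dg k + (p - mdeg dg l) * mdeg dg k) = even (mdeg dg k * mdeg dg l)"
          using le by (auto simp: even_diff_nat not_less)
        then have "(-1 :: 'b) ^ (mdeg dg k * mdeg dg l) = (-1) ^ (p * mdeg dg k) * (-1) ^ ((p - mdeg dg l) * mdeg dg k)"
          unfolding power_add[symmetric] minus_one_power_iff[of "_ + _"] minus_one_power_iff[of "mdeg dg k * mdeg dg l"]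
          by (simp only: e)
        then show "of_int (msign dg l k) * (f l * bet (mdeg dg l) (g k)) =
            of_int (msign dg k l) * (par p g k * bet (mdeg dg k) (f l))"
          unfolding c s par_def bet_homogeneous[OF h]
          by (cases "even (p * mdeg dg k)"; cases "even ((p - mdeg dg l) * mdeg dg k)") (simp_all add: mult.assoc)
      qed simp
    qed
    finally show ?thesis .
  qed (simp add: tm_apply)
qed

end

text \<open>Elements are functions; with pointwise evaluation as a simp rule, the eta-expanded terms
  produced by case splits and inductions would be unfolded into lambda abstractions.\<close>
lemmas fun_pointwise = plus_fun_apply zero_fun_apply minus_apply uminus_apply
declare fun_pointwise [simp del]

context cdga_ext begin

subsection \<open>Finitely supported elements\<close>

abbreviation el :: "'i gen set \<Rightarrow> ('i, 'b) elt set" where "el G \<equiv> elems dg G"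

lemma el_zero [simp]: "0 \<in> el G"
  by (simp add: elems_def fun_pointwise)

lemma el_add: "f \<in> el G \<Longrightarrow> g \<in> el G \<Longrightarrow> f + g \<in> el G"
proof -
  assume a: "f \<in> el G" "g \<in> el G"
  have "{m. (f + g) m \<noteq> 0} \<subseteq> {m. f m \<noteq> 0} \<union> {m. g m \<noteq> 0}" by (auto simp: fun_pointwise)
  then have "finite {m. (f + g) m \<noteq> 0}"
    by (rule finite_subset) (use a in \<open>auto simp: elems_def\<close>)
  moreover have "vld m \<and> set_mset m \<subseteq> G" if "(f + g) m \<noteq> 0" for m
  proof -
    have "f m \<noteq> 0 \<or> g m \<noteq> 0" using that by (auto simp: fun_pointwise)
    then show ?thesis using a by (auto simp: elems_def)
  qed
  ultimately show ?thesis by (simp add: elems_def)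
qed

lemma el_minus: "f \<in> el G \<Longrightarrow> - f \<in> el G"
  by (simp add: elems_def fun_pointwise)

lemma el_diff: "f \<in> el G \<Longrightarrow> g \<in> el G \<Longrightarrow> f - g \<in> el G"
  using el_add[of f G "- g"] el_minus by simp

lemma el_sum: "(\<And>a. a \<in> A \<Longrightarrow> f a \<in> el G) \<Longrightarrow> sum f A \<in> el G"
  by (induction A rule: infinite_finite_induct) (auto intro: el_add)

lemma el_mono: "G \<subseteq> G' \<Longrightarrow> f \<in> el G \<Longrightarrow> f \<in> el G'"
  by (auto simp: elems_def)

lemma el_UNIV: "f \<in> el G \<Longrightarrow> f \<in> el UNIV"
  by (rule el_mono) auto

lemma el_mono_in: "vld m \<Longrightarrow> set_mset m \<subseteq> G \<Longrightarrow> mono b m \<in> el G"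
  by (auto simp: elems_def mono_def)

lemma el_incl [simp]: "inc b \<in> el G"
  by (simp add: incl_eq_mono el_mono_in)

lemma el_gel [simp]: "x \<in> G \<Longrightarrow> gel x \<in> el G"
  by (simp add: gel_eq_mono el_mono_in)

lemma el_finite: "f \<in> el G \<Longrightarrow> finite {m. f m \<noteq> 0}"
  by (simp add: elems_def)

lemma el_supp: "f \<in> el G \<Longrightarrow> f m \<noteq> 0 \<Longrightarrow> vld m \<and> set_mset m \<subseteq> G"
  by (simp add: elems_def)

lemma el_invalid: "f \<in> el G \<Longrightarrow> \<not> vld m \<Longrightarrow> f m = 0"
  using el_supp by blast

lemma expand_mono: "f \<in> el G \<Longrightarrow> f = (\<Sum>m\<in>{m. f m \<noteq> 0}. mono (f m) m)"
  by (rule ext) (simp add: sum_fun_apply mono_def el_finite)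

lemma el_induct [consumes 1, case_names add mono]:
  assumes "f \<in> el G"
    and "\<And>f g. f \<in> el G \<Longrightarrow> g \<in> el G \<Longrightarrow> P f \<Longrightarrow> P g \<Longrightarrow> P (f + g)"
    and "\<And>b m. vld m \<Longrightarrow> set_mset m \<subseteq> G \<Longrightarrow> P (mono b m)"
  shows "P f"
proof -
  have z: "P 0" using assms(3)[of "{#}" 0] by simp
  have s: "P (sum g A) \<and> sum g A \<in> el G"
    if "finite A" "\<And>a. a \<in> A \<Longrightarrow> P (g a) \<and> g a \<in> el G" for g and A :: "'i gen multiset set"
    using that by (induction A) (simp_all add: z assms(2) el_add)
  have "P (\<Sum>m\<in>{m. f m \<noteq> 0}. mono (f m) m)"
    using s[of "{m. f m \<noteq> 0}" "\<lambda>m. mono (f m) m"] el_finite[OF assms(1)] el_supp[OF assms(1)]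
    by (simp add: assms(3) el_mono_in)
  then show ?thesis using expand_mono[OF assms(1)] by simp
qed

lemma el_tm: "f \<in> el G \<Longrightarrow> g \<in> el G \<Longrightarrow> f \<odot> g \<in> el G"
proof (induction f rule: el_induct)
  case (add f f')
  then show ?case by (simp add: tm_add_left el_add)
next
  case m: (mono b m)
  from \<open>g \<in> el G\<close> show ?case
  proof (induction g rule: el_induct)
    case (add g g')
    then show ?case by (simp add: tm_add_right el_add)
  next
    case (mono c n)
    with m show ?case by (auto simp: mono_mult intro!: el_mono_in)
  qed
qed

lemma inc_1_tm: "f \<in> el G \<Longrightarrow> inc 1 \<odot> f = f"
  by (rule ext) (simp add: incl_tm el_invalid)

lemma tm_inc_1: "f \<in> el G \<Longrightarrow> f \<odot> inc 1 = f"
  by (rule ext) (simp add: tm_incl el_invalid)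

lemma inc_tm_apply: "f \<in> el G \<Longrightarrow> (inc b \<odot> f) m = b * f m"
  by (cases "vld m") (simp_all add: incl_tm el_invalid)

lemma mono_eq_inc: "vld m \<Longrightarrow> mono b m = inc b \<odot> mono 1 m"
  by (simp add: incl_eq_mono mono_mult)

lemma par_el: "f \<in> el G \<Longrightarrow> par k f \<in> el G"
proof (induction f rule: el_induct)
  case (add f f')
  then show ?case by (simp add: par_add el_add)
next
  case (mono b m)
  then show ?case by (simp add: par_mono el_mono_in)
qed

lemma par_hg: "hg p f \<Longrightarrow> par k f = (if even (k * p) then f else - f)"
proof
  fix m assume h: "hg p f"
  show "par k f m = (if even (k * p) then f else - f) m"
  proof (cases "f m = 0")
    case False
    then have le: "mdeg dg m \<le> p" and e: "bc (p - mdeg dg m) (f m) = f m" using hgD[OF h] by auto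
    have "p * k = mdeg dg m * k + (p - mdeg dg m) * k" using le by (simp flip: distrib_right)
    then have "even (p * k) \<longleftrightarrow> (even (mdeg dg m * k) \<longleftrightarrow> even ((p - mdeg dg m) * k))" by (metis even_add)
    then show ?thesis
      unfolding par_def bet_homogeneous[OF e] minus_one_power_iff mult.commute[of k] by (auto simp: fun_pointwise)
  qed (auto simp: par_def fun_pointwise)
qed

lemma tm_swap: "hg p f \<Longrightarrow> hg q g \<Longrightarrow> f \<odot> g = (if odd p \<and> odd q then - (g \<odot> f) else g \<odot> f)"
  by (simp add: tm_commute[of p f g] par_hg tm_minus_left)

lemma of_nat_tm_cancel:
  assumes "n > 0" "inc (of_nat n) \<odot> f = 0" "f \<in> el G" shows "f = 0"
proof
  fix m
  have "of_nat n * f m = of_nat n * 0"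
    using inc_tm_apply[OF assms(3), of "of_nat n" m] assms(2) by (simp add: fun_pointwise)
  then show "f m = 0 m" using of_nat_cancel[OF assms(1)] by (simp add: fun_pointwise)
qed

text \<open>Graded commutativity gives \<open>f \<odot> f = - (f \<odot> f)\<close>, and 2 is
  invertible in the base.\<close>

lemma odd_square: "hg p f \<Longrightarrow> odd p \<Longrightarrow> f \<in> el G \<Longrightarrow> f \<odot> f = 0"
proof -
  assume a: "hg p f" "odd p" "f \<in> el G"
  then have "f \<odot> f = - (f \<odot> f)" using tm_swap[OF a(1) a(1)] by simp
  then have "f \<odot> f + f \<odot> f = 0" by (metis add.right_inverse)
  moreover have "inc (of_nat 2) \<odot> (f \<odot> f) = f \<odot> f + f \<odot> f"
    by (rule ext) (simp add: inc_tm_apply[OF el_tm[OF a(3) a(3)]] mult_2 fun_pointwise)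
  ultimately show ?thesis using of_nat_tm_cancel[of 2 "f \<odot> f" G] el_tm a(3) by simp
qed

lemma tm_inc_of_int: "f \<odot> inc (of_int k) = inc (of_int k) \<odot> f"
  by (rule ext) (simp add: tm_incl incl_tm of_int_commute)

lemma tm_inc_of_int_left: "f \<odot> (inc (of_int k) \<odot> g) = inc (of_int k) \<odot> (f \<odot> g)"
  by (metis tm_assoc tm_inc_of_int)

subsection \<open>Weight filtrations\<close>

definition wt :: "('i gen \<Rightarrow> nat) \<Rightarrow> 'i gen multiset \<Rightarrow> nat" where
  "wt w m = sum_mset (image_mset w m)"

text \<open>A decreasing multiplicative filtration. It is used with the word length
  \<open>wl\<close> and with the number of letters \<open>wf k\<close> in one tensor factor.\<close>

definition filt :: "('i gen \<Rightarrow> nat) \<Rightarrow> nat \<Rightarrow> ('i, 'b) elt set" where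
  "filt w n = {f. \<forall>m. f m \<noteq> 0 \<longrightarrow> n \<le> wt w m}"

lemma wt_empty [simp]: "wt w {#} = 0" and wt_add_mset [simp]: "wt w (add_mset x m) = w x + wt w m"
  and wt_add [simp]: "wt w (m + n) = wt w m + wt w n"
  by (simp_all add: wt_def)

lemma filtD: "f \<in> filt w n \<Longrightarrow> wt w m < n \<Longrightarrow> f m = 0"
  unfolding filt_def by force

lemma filtI: "(\<And>m. f m \<noteq> 0 \<Longrightarrow> n \<le> wt w m) \<Longrightarrow> f \<in> filt w n"
  unfolding filt_def by blast

lemma filt_0 [simp]: "f \<in> filt w 0" and filt_zero [simp]: "0 \<in> filt w n"
  by (auto simp: filt_def fun_pointwise)

lemma filt_le: "f \<in> filt w n \<Longrightarrow> k \<le> n \<Longrightarrow> f \<in> filt w k"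
  by (force simp: filt_def)

lemma filt_add: "f \<in> filt w n \<Longrightarrow> g \<in> filt w n \<Longrightarrow> f + g \<in> filt w n"
  unfolding filt_def by (simp add: fun_pointwise) (metis add.right_neutral)

lemma filt_minus: "f \<in> filt w n \<Longrightarrow> - f \<in> filt w n"
  by (simp add: filt_def fun_pointwise)

lemma filt_diff: "f \<in> filt w n \<Longrightarrow> g \<in> filt w n \<Longrightarrow> f - g \<in> filt w n"
  using filt_add[of f w n "- g"] filt_minus by simp

lemma filt_sum: "(\<And>a. a \<in> A \<Longrightarrow> f a \<in> filt w n) \<Longrightarrow> sum f A \<in> filt w n"
  by (induction A rule: infinite_finite_induct) (auto intro: filt_add)

lemma filt_tm: assumes "f \<in> filt w a" "g \<in> filt w b" shows "f \<odot> g \<in> filt w (a + b)"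
proof (rule filtI)
  fix n assume nz: "(f \<odot> g) n \<noteq> 0"
  then have v: "vld n" unfolding tm_apply by meson
  obtain m where m: "m \<subseteq># n" "of_int (msign dg m (n - m)) * (f m * bet (mdeg dg m) (g (n - m))) \<noteq> 0"
    using nz unfolding tm_apply if_P[OF v] by (metis (mono_tags, lifting) mem_Collect_eq sum.neutral)
  then have "f m \<noteq> 0" "g (n - m) \<noteq> 0" by auto
  then have "a \<le> wt w m" "b \<le> wt w (n - m)" using assms by (auto simp: filt_def)
  moreover have "wt w n = wt w m + wt w (n - m)"
    by (metis m(1) subset_mset.add_diff_inverse wt_add)
  ultimately show "a + b \<le> wt w n" by linarith
qed

lemma filt_tm_left: "g \<in> filt w b \<Longrightarrow> f \<odot> g \<in> filt w b"
  using filt_tm[of f w 0 g b] by simp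

lemma filt_tm_right: "f \<in> filt w b \<Longrightarrow> f \<odot> g \<in> filt w b"
  using filt_tm[of f w b g 0] by simp

lemma filt_par: "f \<in> filt w n \<Longrightarrow> par k f \<in> filt w n"
  unfolding filt_def par_def by clarsimp (metis bet_zero mult_zero_right)

lemma filt_mono: "n \<le> wt w m \<Longrightarrow> mono b m \<in> filt w n"
  by (rule filtI) (auto simp: mono_def split: if_splits)

subsection \<open>Algebra maps\<close>

text \<open>Exactly the data that extend to an algebra map: preserving degrees makes the images
  satisfy the sign rules, so odd generators have images of square zero.\<close>

definition good :: "('i gen \<Rightarrow> ('i, 'b) elt) \<Rightarrow> bool" where
  "good img \<longleftrightarrow> (\<forall>x. img x \<in> el UNIV \<and> hg (gdeg dg x) (img x))"

definition mimg :: "('i gen \<Rightarrow> ('i, 'b) elt) \<Rightarrow> 'i gen multiset \<Rightarrow> ('i, 'b) elt" where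
  "mimg img m = lprod dg bc (map img (sorted_list_of_multiset m))"

lemma lprod_Nil [simp]: "lprod dg bc [] = inc 1"
  and lprod_Cons [simp]: "lprod dg bc (f # fs) = f \<odot> lprod dg bc fs"
  by (simp_all add: lprod_def tm_def)

lemma mimg_empty [simp]: "mimg img {#} = inc 1"
  by (simp add: mimg_def)

lemma mimg_min: "\<forall>y\<in>#m. x \<le> y \<Longrightarrow> mimg img (add_mset x m) = img x \<odot> mimg img m"
  by (simp add: mimg_def insort_is_Cons)

lemma mimg_single: "img x \<in> el G \<Longrightarrow> mimg img {#x#} = img x"
  by (simp add: mimg_min tm_inc_1)

lemma mimg_cong: "(\<And>x. x \<in># m \<Longrightarrow> f x = g x) \<Longrightarrow> mimg f m = mimg g m"
  unfolding mimg_def by (rule arg_cong[where f = "lprod dg bc"]) simp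

lemma mimg_el: "(\<And>x. x \<in># m \<Longrightarrow> img x \<in> el G) \<Longrightarrow> mimg img m \<in> el G"
  by (induction m rule: multiset_induct_min) (auto simp: mimg_min intro: el_tm)

lemma mimg_filt: "(\<And>x. x \<in># m \<Longrightarrow> img x \<in> filt w' (w x)) \<Longrightarrow> mimg img m \<in> filt w' (wt w m)"
  by (induction m rule: multiset_induct_min) (auto simp: mimg_min intro: filt_tm)

lemma mimg_hg: "(\<And>x. x \<in># m \<Longrightarrow> hg (gdeg dg x) (img x)) \<Longrightarrow> hg (mdeg dg m) (mimg img m)"
  by (induction m rule: multiset_induct_min) (auto simp: mimg_min bc_one intro: hg_mult hg_incl)

lemma mimg_good: "good img \<Longrightarrow> mimg img m \<in> el UNIV" "good img \<Longrightarrow> hg (mdeg dg m) (mimg img m)"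
  by (auto simp: good_def intro: mimg_el mimg_hg)

text \<open>A new factor is sorted into a monomial by moving it past the smaller generators one at a
  time. The signs add up to the inversion count, and a repeated odd generator gives zero by
  \<open>odd_square\<close>.\<close>

lemma tm_mimg:
  assumes g: "good img"
  shows "vld n \<Longrightarrow> img x \<odot> mimg img n =
    (if odg x \<and> x \<in># n then 0 else inc (of_int (msign dg {#x#} n)) \<odot> mimg img (add_mset x n))"
proof (induction n rule: multiset_induct_min)
  case empty
  show ?case using g by (simp add: mimg_single[of img x UNIV] good_def inc_1_tm[of _ UNIV] tm_inc_1[of _ UNIV])
next
  case (add y n)
  have i: "img z \<in> el UNIV" "hg (gdeg dg z) (img z)" for z using g by (auto simp: good_def)
  have v: "vld n" using add.prems by (simp add: valid_add_mset_iff)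
  show ?case
  proof (cases "x \<le> y")
    case True
    then have min: "\<forall>z\<in>#add_mset y n. x \<le> z" using add.hyps by auto
    show ?thesis
    proof (cases "odg x \<and> x \<in># add_mset y n")
      case c: True
      then have "x = y" using add.hyps True by auto
      then show ?thesis using c add.hyps
        by (simp add: mimg_min odd_square[OF i(2) _ i(1)] flip: tm_assoc)
    next
      case False
      have "msign dg {#x#} (add_mset y n) = 1" using min by (intro msign_eq_1) auto
      then show ?thesis using False mimg_min[OF min, of img] el_tm[OF i(1) mimg_good(1)[OF g]]
        by (auto simp: inc_1_tm[of _ UNIV])
    qed
  next
    case False
    then have yx: "y < x" by simp
    have sw: "img x \<odot> img y = inc (of_int (msign dg {#x#} {#y#})) \<odot> (img y \<odot> img x)"
      using tm_swap[OF i(2) i(2), of x y] yx el_tm[OF i(1) i(1)]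
      by (auto simp: msign_single inc_1_tm[of _ UNIV] incl_minus tm_minus_left)
    have "img x \<odot> mimg img (add_mset y n) = inc (of_int (msign dg {#x#} {#y#})) \<odot> (img y \<odot> (img x \<odot> mimg img n))"
      using add.hyps by (simp add: mimg_min sw flip: tm_assoc)
    also have "\<dots> = (if odg x \<and> x \<in># add_mset y n then 0
       else inc (of_int (msign dg {#x#} (add_mset y n))) \<odot> mimg img (add_mset x (add_mset y n)))"
    proof (cases "odg x \<and> x \<in># n")
      case True
      then show ?thesis using add.IH[OF v] by simp
    next
      case False
      have "\<forall>z\<in>#add_mset x n. y \<le> z" using yx add.hyps by auto
      from mimg_min[OF this, of img]
      have 1: "mimg img (add_mset x (add_mset y n)) = img y \<odot> mimg img (add_mset x n)"
        by (simp add: add_mset_commute)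
      have 2: "msign dg {#x#} (add_mset y n) = msign dg {#x#} {#y#} * msign dg {#x#} n"
        using msign_add_right[of "{#y#}" n "{#x#}"] add.prems by simp
      have "inc (of_int (msign dg {#x#} {#y#})) \<odot> (img y \<odot> (img x \<odot> mimg img n))
        = inc (of_int (msign dg {#x#} {#y#})) \<odot> (inc (of_int (msign dg {#x#} n)) \<odot> (img y \<odot> mimg img (add_mset x n)))"
        using add.IH[OF v] False by (auto simp: tm_inc_of_int_left[of "img y"])
      also have "\<dots> = inc (of_int (msign dg {#x#} (add_mset y n))) \<odot> mimg img (add_mset x (add_mset y n))"
        unfolding 1 2 by (simp add: incl_mult flip: tm_assoc)
      finally show ?thesis using False yx by auto
    qed
    finally show ?thesis .
  qed
qed

lemma mimg_mult:
  assumes g: "good img" and "vld m" "vld n"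
  shows "mimg img m \<odot> mimg img n =
    (if vld (m + n) then inc (of_int (msign dg m n)) \<odot> mimg img (m + n) else 0)"
  using \<open>vld m\<close>
proof (induction m rule: multiset_induct_min)
  case empty
  then show ?case using assms by (simp add: inc_1_tm[of _ UNIV] mimg_good)
next
  case (add x m)
  then have v: "vld m" "odg x \<longrightarrow> x \<notin># m" by (auto simp: valid_add_mset_iff)
  have "mimg img (add_mset x m) \<odot> mimg img n = img x \<odot> (mimg img m \<odot> mimg img n)"
    using add.hyps by (simp add: mimg_min tm_assoc)
  also have "\<dots> = (if vld (m + n) then inc (of_int (msign dg m n)) \<odot> (img x \<odot> mimg img (m + n)) else 0)"
    using add.IH[OF v(1)] by (simp add: tm_inc_of_int_left[of "img x"])
  also have "\<dots> = (if vld (add_mset x m + n) then inc (of_int (msign dg (add_mset x m) n)) \<odot> mimg img (add_mset x m + n) else 0)"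
  proof (cases "vld (m + n)")
    case True
    show ?thesis
    proof (cases "odg x \<and> x \<in># m + n")
      case c: True
      then show ?thesis using True tm_mimg[OF g True, of x] by (simp add: valid_add_mset_iff)
    next
      case False
      have "msign dg {#x#} m = 1" using add.hyps by (intro msign_eq_1) auto
      moreover have "msign dg {#x#} (m + n) = msign dg {#x#} m * msign dg {#x#} n"
        using True by (rule msign_add_right)
      moreover have "msign dg (add_mset x m) n = msign dg {#x#} n * msign dg m n"
        using msign_add_left[of "{#x#}" m n] add.prems by simp
      ultimately show ?thesis using False True tm_mimg[OF g True, of x]
        by (auto simp: valid_add_mset_iff incl_mult mult.commute simp flip: tm_assoc)
    qed
  next
    case False
    then show ?thesis by (simp add: valid_add_mset_iff)
  qed
  finally show ?case .
qed

definition hom :: "('i gen \<Rightarrow> ('i, 'b) elt) \<Rightarrow> ('i, 'b) elt \<Rightarrow> ('i, 'b) elt" where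
  "hom img = ext_hom dg bc img"

lemma hom_apply: "hom img f = (\<Sum>m\<in>{m. f m \<noteq> 0}. inc (f m) \<odot> mimg img m)"
  by (simp add: hom_def ext_hom_def tm_def mimg_def)

lemma hom_superset:
  assumes "finite A" "{m. f m \<noteq> 0} \<subseteq> A"
  shows "hom img f = (\<Sum>m\<in>A. inc (f m) \<odot> mimg img m)"
  unfolding hom_apply by (rule sum.mono_neutral_left) (use assms in auto)

lemma hom_mono: "hom img (mono b m) = inc b \<odot> mimg img m"
  by (subst hom_superset[of "{m}"]) (auto simp: mono_def)

lemma hom_add: "f \<in> el G \<Longrightarrow> g \<in> el G \<Longrightarrow> hom img (f + g) = hom img f + hom img g"
proof -
  assume a: "f \<in> el G" "g \<in> el G"
  let ?A = "{m. f m \<noteq> 0} \<union> {m. g m \<noteq> 0}"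
  have "finite ?A" using a by (simp add: el_finite)
  moreover have "{m. (f + g) m \<noteq> 0} \<subseteq> ?A" by (auto simp: fun_pointwise)
  ultimately show ?thesis
    by (simp add: hom_superset[of ?A] incl_add tm_add_left sum.distrib fun_pointwise)
qed

lemma hom_zero [simp]: "hom img 0 = 0"
  by (simp add: hom_apply fun_pointwise)

lemma hom_minus: "f \<in> el G \<Longrightarrow> hom img (- f) = - hom img f"
  using hom_add[of f G "- f" img] el_minus[of f G] by (simp add: eq_neg_iff_add_eq_0 add.commute)

lemma hom_diff: "f \<in> el G \<Longrightarrow> g \<in> el G \<Longrightarrow> hom img (f - g) = hom img f - hom img g"
  using hom_add[of f G "- g" img] el_minus[of g G] hom_minus[of g G img] by simp

lemma hom_incl [simp]: "hom img (inc b) = inc b"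
  by (simp add: incl_eq_mono hom_mono) (simp add: incl_mult flip: incl_eq_mono)

lemma hom_gel: "img x \<in> el G \<Longrightarrow> hom img (gel x) = img x"
  by (simp add: gel_eq_mono hom_mono mimg_single inc_1_tm)

lemma hom_gel_good: "good img \<Longrightarrow> hom img (gel x) = img x"
  by (rule hom_gel[of _ _ UNIV]) (simp add: good_def)

lemma hom_el: "f \<in> el G \<Longrightarrow> (\<And>x. x \<in> G \<Longrightarrow> img x \<in> el G') \<Longrightarrow> hom img f \<in> el G'"
  unfolding hom_apply by (intro el_sum el_tm mimg_el el_incl) (use el_supp in blast)

lemma hom_filt:
  "f \<in> el G \<Longrightarrow> f \<in> filt w n \<Longrightarrow> (\<And>x. x \<in> G \<Longrightarrow> img x \<in> filt w' (w x)) \<Longrightarrow> hom img f \<in> filt w' n"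
  unfolding hom_apply
proof (intro filt_sum filt_tm_left)
  fix m assume a: "f \<in> el G" "f \<in> filt w n" "\<And>x. x \<in> G \<Longrightarrow> img x \<in> filt w' (w x)" "m \<in> {m. f m \<noteq> 0}"
  then have "mimg img m \<in> filt w' (wt w m)" by (intro mimg_filt) (auto dest!: el_supp)
  moreover have "n \<le> wt w m" using a(2,4) unfolding filt_def by simp
  ultimately show "mimg img m \<in> filt w' n" by (rule filt_le)
qed

lemma hom_cong: "f \<in> el G \<Longrightarrow> (\<And>x. x \<in> G \<Longrightarrow> img x = img' x) \<Longrightarrow> hom img f = hom img' f"
proof -
  assume a: "f \<in> el G" "\<And>x. x \<in> G \<Longrightarrow> img x = img' x"
  have "mimg img m = mimg img' m" if "f m \<noteq> 0" for m
    by (rule mimg_cong) (use el_supp[OF a(1) that] a(2) in auto)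
  then show ?thesis unfolding hom_apply by auto
qed

lemma hom_hg:
  assumes "f \<in> el G" "hg p f" "\<And>x. x \<in> G \<Longrightarrow> hg (gdeg dg x) (img x)"
  shows "hg p (hom img f)"
  unfolding hom_apply
proof (intro hg_sum)
  fix m assume "m \<in> {m. f m \<noteq> 0}"
  then have f: "f m \<noteq> 0" by simp
  then have "mdeg dg m \<le> p" "bc (p - mdeg dg m) (f m) = f m" using hgD[OF assms(2)] by auto
  moreover have "hg (mdeg dg m) (mimg img m)"
    by (rule mimg_hg) (use el_supp[OF assms(1) f] assms(3) in auto)
  ultimately show "hg p (inc (f m) \<odot> mimg img m)"
    using hg_mult[OF hg_incl, of "p - mdeg dg m" "f m" "mdeg dg m" "mimg img m"] by simp
qed

text \<open>On monomials the sign of moving the coefficient \<open>c\<close> past the image of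
  \<open>m\<close> equals that of moving it past \<open>m\<close>, as images keep degrees; the rest
  is \<open>mimg_mult\<close>.\<close>

theorem hom_mult:
  assumes g: "good img" and "f \<in> el UNIV" "h \<in> el UNIV"
  shows "hom img (f \<odot> h) = hom img f \<odot> hom img h"
  using \<open>f \<in> el UNIV\<close>
proof (induction f rule: el_induct)
  case (add f f')
  then show ?case
    by (simp add: tm_add_left hom_add[of _ UNIV] el_tm[of _ UNIV] \<open>h \<in> el UNIV\<close>)
next
  case m: (mono b m)
  from \<open>h \<in> el UNIV\<close> show ?case
  proof (induction h rule: el_induct)
    case (add h h')
    then show ?case using m
      by (simp add: tm_add_right hom_add[of _ UNIV] el_tm[of _ UNIV] el_mono_in)
  next
    case n: (mono c n)
    have c: "mimg img m \<odot> inc c = inc (bet (mdeg dg m) c) \<odot> mimg img m"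
      using tm_commute[OF mimg_good(2)[OF g], of m "inc c"] by (simp add: par_incl)
    have "hom img (mono b m) \<odot> hom img (mono c n)
      = inc b \<odot> (mimg img m \<odot> inc c) \<odot> mimg img n" by (simp add: hom_mono tm_assoc)
    also have "\<dots> = inc (b * bet (mdeg dg m) c) \<odot> (mimg img m \<odot> mimg img n)"
      unfolding c by (simp add: tm_assoc flip: incl_mult)
    also have "\<dots> = hom img (mono b m \<odot> mono c n)"
      using mimg_mult[OF g m(1) n(1)] of_int_commute[of "msign dg m n" "b * bet (mdeg dg m) c"]
      by (simp add: mono_mult hom_mono incl_mult flip: tm_assoc)
    finally show ?case by (rule sym)
  qed
qed

lemma mimg_hom_gel: "vld m \<Longrightarrow> mimg gel m = mono 1 m"
proof (induction m rule: multiset_induct_min)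
  case empty
  then show ?case by (simp add: incl_eq_mono)
next
  case (add x m)
  then have "msign dg {#x#} m = 1" by (intro msign_eq_1) auto
  then show ?case using add by (simp add: mimg_min valid_add_mset_iff gel_eq_mono mono_mult)
qed

lemma mono_eq_gels: "vld m \<Longrightarrow> mono b m = inc b \<odot> mimg gel m"
  by (simp add: mono_eq_inc[of m b] mimg_hom_gel)

text \<open>Monomials arise by repeated left multiplication with generators, so multiplicativity is
  asked only for left factors that are coefficients or generators, and only on the subalgebra
  \<open>el G\<close>.\<close>

lemma hom_unique:
  assumes "f \<in> el G"
    and add: "\<And>f g. f \<in> el G \<Longrightarrow> g \<in> el G \<Longrightarrow> \<phi> (f + g) = \<phi> f + \<phi> g"
    and one: "\<phi> (inc 1) = inc 1"
    and base: "\<And>b f. f \<in> el G \<Longrightarrow> \<phi> (inc b \<odot> f) = inc b \<odot> \<phi> f"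
    and gen: "\<And>x f. x \<in> G \<Longrightarrow> f \<in> el G \<Longrightarrow> \<phi> (gel x \<odot> f) = img x \<odot> \<phi> f"
  shows "\<phi> f = hom img f"
  using assms(1)
proof (induction f rule: el_induct)
  case (add f g)
  then show ?case by (simp add: assms(2) hom_add)
next
  case (mono b m)
  have e: "mimg gel m \<in> el G" if "set_mset m \<subseteq> G" for m
    using that by (intro mimg_el el_gel) auto
  have "\<phi> (mimg gel m) = mimg img m" if "set_mset m \<subseteq> G" for m
    using that
    by (induction m rule: multiset_induct_min) (simp_all add: one mimg_min gen e)
  then have "\<phi> (mono b m) = inc b \<odot> mimg img m"
    unfolding mono_eq_gels[OF mono(1)] using mono(2) by (simp add: base e)
  then show ?case by (simp add: hom_mono)
qed

lemma hom_gel_id: "f \<in> el UNIV \<Longrightarrow> hom gel f = f"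
  by (rule sym, rule hom_unique[of f UNIV "\<lambda>f. f"]) auto

lemma hom_hom:
  assumes "good a" "good b" "f \<in> el UNIV"
  shows "hom a (hom b f) = hom (\<lambda>x. hom a (b x)) f"
proof (rule hom_unique[of f UNIV "\<lambda>f. hom a (hom b f)"])
  have e: "hom b f \<in> el UNIV" if "f \<in> el UNIV" for f
    by (rule hom_el[OF that]) (use assms in \<open>auto simp: good_def\<close>)
  show "hom a (hom b (f + g)) = hom a (hom b f) + hom a (hom b g)"
    if "f \<in> el UNIV" "g \<in> el UNIV" for f g
    using that by (simp add: hom_add[of _ UNIV] e)
  show "hom a (hom b (inc c \<odot> f)) = inc c \<odot> hom a (hom b f)" if "f \<in> el UNIV" for c f
    using that by (simp add: hom_mult assms e)
  show "hom a (hom b (gel x \<odot> f)) = hom a (b x) \<odot> hom a (hom b f)" if "f \<in> el UNIV" for x f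
    using that by (simp add: hom_mult assms e hom_gel_good good_def[THEN iffD1, rule_format, OF assms(2)])
qed (use assms in auto)

lemma good_gel: "good gel"
  by (simp add: good_def hg_gel)

lemma good_comp: "good a \<Longrightarrow> good b \<Longrightarrow> good (\<lambda>x. hom a (b x))"
  unfolding good_def by (simp add: hom_el[of _ UNIV] hom_hg[of _ UNIV])

text \<open>The two products are compared by exchanging one factor at a time; the exchanged factor
  gains weight \<open>e\<close> while the others keep theirs. All replacements of a map by its
  leading term rest on this.\<close>

lemma mimg_diff_filt:
  assumes "\<And>x. x \<in># m \<Longrightarrow> a x \<in> filt w' (w x)" "\<And>x. x \<in># m \<Longrightarrow> b x \<in> filt w' (w x)"
    and "\<And>x. x \<in># m \<Longrightarrow> a x - b x \<in> filt w' (w x + e)"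
  shows "mimg a m - mimg b m \<in> filt w' (wt w m + e)"
  using assms
proof (induction m rule: multiset_induct_min)
  case empty
  then show ?case by simp
next
  case (add x m)
  have "mimg a (add_mset x m) - mimg b (add_mset x m) =
      (a x - b x) \<odot> mimg a m + b x \<odot> (mimg a m - mimg b m)"
    using add.hyps by (simp add: mimg_min tm_diff_left tm_diff_right)
  moreover have "(a x - b x) \<odot> mimg a m \<in> filt w' (w x + e + wt w m)"
    using add.prems by (intro filt_tm mimg_filt) auto
  moreover have "b x \<odot> (mimg a m - mimg b m) \<in> filt w' (w x + (wt w m + e))"
    using add.prems by (intro filt_tm add.IH) auto
  ultimately show ?case by (simp add: filt_add add.commute add.left_commute)
qed

lemma hom_diff_filt:
  assumes "f \<in> el G" "f \<in> filt w n"
    and "\<And>x. x \<in> G \<Longrightarrow> a x \<in> filt w' (w x)" "\<And>x. x \<in> G \<Longrightarrow> b x \<in> filt w' (w x)"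
    and "\<And>x. x \<in> G \<Longrightarrow> a x - b x \<in> filt w' (w x + e)"
  shows "hom a f - hom b f \<in> filt w' (n + e)"
proof -
  have "hom a f - hom b f = (\<Sum>m\<in>{m. f m \<noteq> 0}. inc (f m) \<odot> (mimg a m - mimg b m))"
    by (simp add: hom_apply tm_diff_right sum_subtractf)
  also have "\<dots> \<in> filt w' (n + e)"
  proof (intro filt_sum filt_tm_left)
    fix m assume "m \<in> {m. f m \<noteq> 0}"
    then have m: "f m \<noteq> 0" by simp
    then have s: "x \<in> G" if "x \<in># m" for x using el_supp[OF assms(1) m] that by auto
    have "mimg a m - mimg b m \<in> filt w' (wt w m + e)"
      by (rule mimg_diff_filt) (use assms s in auto)
    moreover have "n + e \<le> wt w m + e" using assms(2) m by (simp add: filt_def)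
    ultimately show "mimg a m - mimg b m \<in> filt w' (n + e)" by (rule filt_le)
  qed
  finally show ?thesis .
qed


subsection \<open>Derivations\<close>

lemma isc_pm: "isc ((-1) ^ k) f = (if even k then f else - f)"
  by (auto simp: isc_def fun_pointwise)

lemma isc_tm_left: "isc k f \<odot> g = isc k (f \<odot> g)"
  by (rule ext) (simp add: tm_apply isc_def sum_distrib_left mult.assoc of_int_left_commute[of _ k]
      cong: if_cong)

lemma isc_tm_right: "f \<odot> isc k g = isc k (f \<odot> g)"
  by (rule ext) (simp add: tm_apply isc_def sum_distrib_left bet_mult of_int_left_commute[of _ k])

lemma isc_add: "isc k (f + g) = isc k f + isc k g"
  by (rule ext) (simp add: isc_def fun_pointwise distrib_left)

lemma isc_zero [simp]: "isc k 0 = 0"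
  by (rule ext) (simp add: isc_def fun_pointwise)

lemma isc_isc: "isc k (isc l f) = isc (k * l) f"
  by (rule ext) (simp add: isc_def mult.assoc)

lemma par_1_gel: "par (Suc 0) (gel x) = isc ((-1) ^ gdeg dg x) (gel x)"
  unfolding gel_eq_mono par_mono by (rule ext) (simp add: isc_def mono_def)

definition gooddiff :: "('i gen \<Rightarrow> ('i, 'b) elt) \<Rightarrow> bool" where
  "gooddiff img \<longleftrightarrow> (\<forall>x. img x \<in> el UNIV \<and> hg (Suc (gdeg dg x)) (img x))"

text \<open>The Leibniz sum inside \<open>ext_der\<close>, isolated so that it can be unfolded one
  letter at a time.\<close>

definition dlist :: "('i gen \<Rightarrow> ('i, 'b) elt) \<Rightarrow> 'i gen list \<Rightarrow> ('i, 'b) elt" where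
  "dlist img xs = (\<Sum>s<length xs. isc ((-1) ^ mdeg dg (mset (take s xs)))
     (lprod dg bc (map gel (take s xs)) \<odot> (img (xs ! s) \<odot> lprod dg bc (map gel (drop (Suc s) xs)))))"

lemma dlist_Nil: "dlist img [] = 0"
  by (simp add: dlist_def)

lemma lprod_gel_el: "lprod dg bc (map gel xs) \<in> el UNIV"
  by (induction xs) (auto intro: el_tm)

lemma dlist_Cons:
  assumes "gooddiff img"
  shows "dlist img (x # xs) = img x \<odot> lprod dg bc (map gel xs) + par (Suc 0) (gel x) \<odot> dlist img xs"
proof -
  have i: "img x \<in> el UNIV" using assms by (simp add: gooddiff_def)
  have "dlist img (x # xs) = inc 1 \<odot> (img x \<odot> lprod dg bc (map gel xs)) +
    (\<Sum>s<length xs. isc ((-1) ^ gdeg dg x) (gel x \<odot> isc ((-1) ^ mdeg dg (mset (take s xs)))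
     (lprod dg bc (map gel (take s xs)) \<odot> (img (xs ! s) \<odot> lprod dg bc (map gel (drop (Suc s) xs))))))"
    unfolding dlist_def length_Cons sum.lessThan_Suc_shift
    by (simp add: isc_pm[of 0, simplified] isc_tm_right isc_isc power_add tm_assoc)
  also have "inc 1 \<odot> (img x \<odot> lprod dg bc (map gel xs)) = img x \<odot> lprod dg bc (map gel xs)"
    by (rule inc_1_tm[OF el_tm[OF i lprod_gel_el]])
  finally show ?thesis
    unfolding dlist_def[of img xs] tm_sum_right par_1_gel isc_tm_left .
qed

definition dimg :: "('i gen \<Rightarrow> ('i, 'b) elt) \<Rightarrow> 'i gen multiset \<Rightarrow> ('i, 'b) elt" where
  "dimg img m = dlist img (sorted_list_of_multiset m)"

lemma dimg_empty [simp]: "dimg img {#} = 0"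
  by (simp add: dimg_def dlist_Nil)

lemma dimg_min:
  "gooddiff img \<Longrightarrow> \<forall>y\<in>#m. x \<le> y \<Longrightarrow>
    dimg img (add_mset x m) = img x \<odot> mimg gel m + par (Suc 0) (gel x) \<odot> dimg img m"
  by (simp add: dimg_def insort_is_Cons dlist_Cons mimg_def)

lemma dimg_el:
  assumes "gooddiff img" "\<And>x. x \<in> G \<Longrightarrow> img x \<in> el G" "set_mset m \<subseteq> G"
  shows "dimg img m \<in> el G"
  using assms(3)
proof (induction m rule: multiset_induct_min)
  case (add x m)
  then show ?case
    using assms by (auto simp: dimg_min intro!: el_add el_tm mimg_el par_el)
qed simp

lemma dimg_hg: "gooddiff img \<Longrightarrow> hg (Suc (mdeg dg m)) (dimg img m)"
proof (induction m rule: multiset_induct_min)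
  case (add x m)
  have "hg (Suc (gdeg dg x) + mdeg dg m) (img x \<odot> mimg gel m)"
    using add.prems by (intro hg_mult mimg_hg hg_gel) (auto simp: gooddiff_def)
  moreover have "hg (gdeg dg x + Suc (mdeg dg m)) (par (Suc 0) (gel x) \<odot> dimg img m)"
    using add by (intro hg_mult) (auto simp: par_hg[OF hg_gel] hg_gel hg_minus)
  ultimately show ?case using add by (simp add: dimg_min hg_add)
qed simp

lemma dimg_filt:
  assumes "gooddiff img" "\<And>x. x \<in># m \<Longrightarrow> img x \<in> filt w (w x)"
  shows "dimg img m \<in> filt w (wt w m)"
  using assms(2)
proof (induction m rule: multiset_induct_min)
  case (add x m)
  have g: "gel y \<in> filt w (w y)" for y by (simp add: gel_eq_mono filt_mono)
  from add show ?case
    by (auto simp: dimg_min[OF assms(1)] intro!: filt_add filt_tm mimg_filt g filt_par)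
qed simp

text \<open>The left side is the Leibniz expansion of \<open>x\<close> times the word
  \<open>n\<close> before sorting. Sorting costs the same sign as for the product itself. For a
  repeated odd \<open>x\<close> the terms with \<open>img x \<odot> gel x\<close> and
  \<open>gel x \<odot> img x\<close> cancel, because \<open>img x\<close> then has even
  degree.\<close>

lemma tm_dimg:
  assumes g: "gooddiff img"
  shows "vld n \<Longrightarrow> img x \<odot> mimg gel n + par (Suc 0) (gel x) \<odot> dimg img n =
    (if odg x \<and> x \<in># n then 0 else inc (of_int (msign dg {#x#} n)) \<odot> dimg img (add_mset x n))"
proof (induction n rule: multiset_induct_min)
  case empty
  have "img x \<odot> inc 1 \<in> el UNIV" using g by (auto simp: gooddiff_def intro: el_tm)
  then show ?case using g by (simp add: dimg_min inc_1_tm[of _ UNIV])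
next
  case (add y n)
  have i: "img z \<in> el UNIV" "hg (Suc (gdeg dg z)) (img z)" for z using g by (auto simp: gooddiff_def)
  have v: "vld n" using add.prems by (simp add: valid_add_mset_iff)
  have d: "dimg img m \<in> el UNIV" for m by (rule dimg_el[OF g]) (auto intro: i)
  show ?case
  proof (cases "x \<le> y")
    case True
    then have min: "\<forall>z\<in>#add_mset y n. x \<le> z" using add.hyps by auto
    show ?thesis
    proof (cases "odg x \<and> x \<in># add_mset y n")
      case c: True
      then have xy: "x = y" using add.hyps True by auto
      have p: "par (Suc 0) (gel x) = - gel x" using c by (simp add: par_hg[OF hg_gel])
      have s: "img x \<odot> gel x = gel x \<odot> img x" using tm_swap[OF i(2) hg_gel, of x x] c by simp
      have q: "gel x \<odot> gel x = 0" using odd_square[OF hg_gel, of x UNIV] c by simp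
      have "img x \<odot> mimg gel (add_mset y n) + par (Suc 0) (gel x) \<odot> dimg img (add_mset y n)
        = (img x \<odot> gel x) \<odot> mimg gel n - (gel x \<odot> img x) \<odot> mimg gel n + (gel x \<odot> gel x) \<odot> dimg img n"
        using add.hyps unfolding xy[symmetric]
        by (simp add: mimg_min dimg_min g p tm_minus_left tm_minus_right tm_add_right tm_diff_right tm_assoc)
      then show ?thesis using c by (simp add: s q)
    next
      case False
      have "msign dg {#x#} (add_mset y n) = 1" using min by (intro msign_eq_1) auto
      then have "(if odg x \<and> x \<in># add_mset y n then 0 else inc (of_int (msign dg {#x#} (add_mset y n)))
          \<odot> dimg img (add_mset x (add_mset y n))) = dimg img (add_mset x (add_mset y n))"
        using False by (auto simp: inc_1_tm[OF d])
      then show ?thesis using dimg_min[OF g min] by simp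
    qed
  next
    case False
    then have yx: "y < x" by simp
    define e where "e = msign dg {#x#} {#y#}"
    have e: "e = (if odg x \<and> odg y then -1 else 1)" using yx by (simp add: e_def msign_single)
    have ise: "isc e f = (if odg x \<and> odg y then - f else f)" for f
      by (rule ext) (simp add: e isc_def fun_pointwise)
    have s1: "img x \<odot> gel y = isc e (par (Suc 0) (gel y) \<odot> img x)"
      using tm_swap[OF i(2) hg_gel, of x y] by (auto simp: ise par_hg[OF hg_gel] tm_minus_left)
    have s2: "par (Suc 0) (gel x) \<odot> img y = isc e (img y \<odot> gel x)"
      using tm_swap[OF hg_gel i(2), of x y] by (auto simp: ise par_hg[OF hg_gel] tm_minus_left)
    have s3: "par (Suc 0) (gel x) \<odot> par (Suc 0) (gel y) = isc e (par (Suc 0) (gel y) \<odot> par (Suc 0) (gel x))"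
      using tm_swap[OF hg_gel hg_gel, of x y]
      by (auto simp: ise par_hg[OF hg_gel] tm_minus_left tm_minus_right)
    have "img x \<odot> mimg gel (add_mset y n) + par (Suc 0) (gel x) \<odot> dimg img (add_mset y n)
      = (img x \<odot> gel y) \<odot> mimg gel n + ((par (Suc 0) (gel x) \<odot> img y) \<odot> mimg gel n + (par (Suc 0) (gel x) \<odot> par (Suc 0) (gel y)) \<odot> dimg img n)"
      using add.hyps by (simp add: mimg_min dimg_min g tm_add_right tm_assoc)
    also have "\<dots> = isc e (img y \<odot> (gel x \<odot> mimg gel n) + par (Suc 0) (gel y) \<odot> (img x \<odot> mimg gel n + par (Suc 0) (gel x) \<odot> dimg img n))"
      unfolding s1 s2 s3 by (simp add: isc_tm_left tm_assoc tm_add_right isc_add)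
    also have "\<dots> = (if odg x \<and> x \<in># add_mset y n then 0
       else inc (of_int (msign dg {#x#} (add_mset y n))) \<odot> dimg img (add_mset x (add_mset y n)))"
    proof (cases "odg x \<and> x \<in># n")
      case True
      have "gel x \<odot> mimg gel n = 0" using tm_mimg[OF good_gel v, of x] True by simp
      moreover have "img x \<odot> mimg gel n + par (Suc 0) (gel x) \<odot> dimg img n = 0" using add.IH[OF v] True by simp
      ultimately show ?thesis using True by simp
    next
      case False
      have min: "\<forall>z\<in>#add_mset x n. y \<le> z" using yx add.hyps by auto
      define s where "s = msign dg {#x#} n"
      have 1: "gel x \<odot> mimg gel n = inc (of_int s) \<odot> mimg gel (add_mset x n)"
        using tm_mimg[OF good_gel v, of x] False by (auto simp: s_def)
      have 2: "img x \<odot> mimg gel n + par (Suc 0) (gel x) \<odot> dimg img n = inc (of_int s) \<odot> dimg img (add_mset x n)"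
        using add.IH[OF v] False by (auto simp: s_def)
      have 3: "msign dg {#x#} (add_mset y n) = e * s"
        using msign_add_right[of "{#y#}" n "{#x#}"] add.prems by (simp add: e_def s_def)
      have "isc e (img y \<odot> (gel x \<odot> mimg gel n) + par (Suc 0) (gel y) \<odot> (img x \<odot> mimg gel n + par (Suc 0) (gel x) \<odot> dimg img n))
        = isc e (inc (of_int s) \<odot> dimg img (add_mset y (add_mset x n)))"
        unfolding 1 2 dimg_min[OF g min]
        by (simp add: tm_inc_of_int_left[of "img y"] tm_inc_of_int_left[of "par (Suc 0) (gel y)"] tm_add_right)
      also have "\<dots> = inc (of_int (e * s)) \<odot> dimg img (add_mset x (add_mset y n))"
        by (rule ext) (simp add: isc_def inc_tm_apply[OF d] add_mset_commute mult.assoc)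
      finally show ?thesis using False yx unfolding 3 by auto
    qed
    finally show ?thesis .
  qed
qed

lemma dimg_mult:
  assumes g: "gooddiff img" and "vld m" "vld n"
  shows "dimg img m \<odot> mimg gel n + par (Suc 0) (mimg gel m) \<odot> dimg img n =
    (if vld (m + n) then inc (of_int (msign dg m n)) \<odot> dimg img (m + n) else 0)"
  using \<open>vld m\<close>
proof (induction m rule: multiset_induct_min)
  case empty
  have d: "dimg img n \<in> el UNIV" by (rule dimg_el[OF g]) (use g in \<open>auto simp: gooddiff_def\<close>)
  show ?case using \<open>vld n\<close> by (simp add: par_incl inc_1_tm[OF d])
next
  case (add x m)
  then have v: "vld m" "odg x \<longrightarrow> x \<notin># m" by (auto simp: valid_add_mset_iff)
  have "dimg img (add_mset x m) \<odot> mimg gel n + par (Suc 0) (mimg gel (add_mset x m)) \<odot> dimg img n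
    = img x \<odot> (mimg gel m \<odot> mimg gel n) + par (Suc 0) (gel x) \<odot> (dimg img m \<odot> mimg gel n + par (Suc 0) (mimg gel m) \<odot> dimg img n)"
    using add.hyps by (simp add: mimg_min dimg_min g tm_assoc tm_add_left tm_add_right par_mult)
  also have "\<dots> = (if vld (m + n) then inc (of_int (msign dg m n)) \<odot>
      (img x \<odot> mimg gel (m + n) + par (Suc 0) (gel x) \<odot> dimg img (m + n)) else 0)"
    unfolding add.IH[OF v(1)] mimg_mult[OF good_gel v(1) \<open>vld n\<close>]
    by (simp add: tm_inc_of_int_left[of "img x"] tm_inc_of_int_left[of "par (Suc 0) (gel x)"] tm_add_right)
  also have "\<dots> = (if vld (add_mset x m + n) then inc (of_int (msign dg (add_mset x m) n)) \<odot> dimg img (add_mset x m + n) else 0)"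
  proof (cases "vld (m + n)")
    case True
    show ?thesis
    proof (cases "odg x \<and> x \<in># m + n")
      case c: True
      then show ?thesis using True tm_dimg[OF g True, of x] by (simp add: valid_add_mset_iff)
    next
      case False
      have "msign dg {#x#} m = 1" using add.hyps by (intro msign_eq_1) auto
      moreover have "msign dg {#x#} (m + n) = msign dg {#x#} m * msign dg {#x#} n"
        using True by (rule msign_add_right)
      moreover have "msign dg (add_mset x m) n = msign dg {#x#} n * msign dg m n"
        using msign_add_left[of "{#x#}" m n] add.prems by simp
      ultimately show ?thesis using False True tm_dimg[OF g True, of x]
        by (auto simp: valid_add_mset_iff incl_mult mult.commute simp flip: tm_assoc)
    qed
  next
    case False
    then show ?thesis by (simp add: valid_add_mset_iff)
  qed
  finally show ?case .
qed

definition der :: "('i gen \<Rightarrow> ('i, 'b) elt) \<Rightarrow> ('i, 'b) elt \<Rightarrow> ('i, 'b) elt" where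
  "der img = ext_der dg bc dB img"

lemma der_apply:
  "der img f = (\<Sum>m\<in>{m. f m \<noteq> 0}. inc (dB (f m)) \<odot> mimg gel m + inc (binv bc (f m)) \<odot> dimg img m)"
  by (simp add: der_def ext_der_def tm_def mimg_def dimg_def dlist_def Let_def)

lemma der_superset:
  assumes "finite A" "{m. f m \<noteq> 0} \<subseteq> A"
  shows "der img f = (\<Sum>m\<in>A. inc (dB (f m)) \<odot> mimg gel m + inc (binv bc (f m)) \<odot> dimg img m)"
  unfolding der_apply by (rule sum.mono_neutral_left) (use assms in auto)

lemma der_mono: "der img (mono b m) = inc (dB b) \<odot> mimg gel m + inc (binv bc b) \<odot> dimg img m"
  by (subst der_superset[of "{m}"]) (auto simp: mono_def)

lemma der_add: "f \<in> el G \<Longrightarrow> g \<in> el G \<Longrightarrow> der img (f + g) = der img f + der img g"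
proof -
  assume a: "f \<in> el G" "g \<in> el G"
  let ?A = "{m. f m \<noteq> 0} \<union> {m. g m \<noteq> 0}"
  have "finite ?A" using a by (simp add: el_finite)
  moreover have "{m. (f + g) m \<noteq> 0} \<subseteq> ?A" by (auto simp: fun_pointwise)
  ultimately show ?thesis
    by (simp add: der_superset[of ?A] incl_add tm_add_left sum.distrib fun_pointwise dB_add binv_add)
qed

lemma der_el:
  assumes "gooddiff img" "\<And>x. x \<in> G \<Longrightarrow> img x \<in> el G" "f \<in> el G"
  shows "der img f \<in> el G"
  unfolding der_apply
proof (intro el_sum)
  fix m assume "m \<in> {m. f m \<noteq> 0}"
  then have m: "set_mset m \<subseteq> G" using el_supp[OF assms(3)] by blast
  then have "mimg gel m \<in> el G" by (intro mimg_el el_gel) auto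
  moreover have "dimg img m \<in> el G" by (rule dimg_el[OF assms(1,2) m])
  ultimately show "inc (dB (f m)) \<odot> mimg gel m + inc (binv bc (f m)) \<odot> dimg img m \<in> el G"
    by (intro el_add el_tm el_incl)
qed

lemma der_filt:
  assumes "gooddiff img" "\<And>x. x \<in> G \<Longrightarrow> img x \<in> filt w (w x)" "f \<in> el G" "f \<in> filt w n"
  shows "der img f \<in> filt w n"
  unfolding der_apply
proof (intro filt_sum filt_add filt_tm_left)
  fix m assume "m \<in> {m. f m \<noteq> 0}"
  then have m: "set_mset m \<subseteq> G" "n \<le> wt w m" using el_supp[OF assms(3)] assms(4) by (auto simp: filt_def)
  have "mimg gel m \<in> filt w (wt w m)"
    by (rule mimg_filt) (simp add: gel_eq_mono filt_mono)
  then show "mimg gel m \<in> filt w n" using m(2) by (rule filt_le)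
  have "dimg img m \<in> filt w (wt w m)"
    by (rule dimg_filt[OF assms(1,2)]) (use m in auto)
  then show "dimg img m \<in> filt w n" using m(2) by (rule filt_le)
qed

lemma der_hg:
  assumes "gooddiff img" "hg p f"
  shows "hg (Suc p) (der img f)"
  unfolding der_apply
proof (intro hg_sum hg_add)
  fix m assume "m \<in> {m. f m \<noteq> 0}"
  then have "f m \<noteq> 0" by simp
  from hgD[OF assms(2) this] have f: "mdeg dg m \<le> p" "bc (p - mdeg dg m) (f m) = f m" by auto
  have "hg (Suc (p - mdeg dg m) + mdeg dg m) (inc (dB (f m)) \<odot> mimg gel m)"
    using dB_degree[OF f(2)] by (intro hg_mult hg_incl mimg_hg hg_gel) simp
  then show "hg (Suc p) (inc (dB (f m)) \<odot> mimg gel m)" using f(1) by simp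
  have "bc (p - mdeg dg m) (binv bc (f m)) = binv bc (f m)"
    by (simp add: binv_homogeneous[OF f(2)] bc_pm f(2))
  then have "hg ((p - mdeg dg m) + Suc (mdeg dg m)) (inc (binv bc (f m)) \<odot> dimg img m)"
    by (intro hg_mult hg_incl dimg_hg[OF assms(1)])
  then show "hg (Suc p) (inc (binv bc (f m)) \<odot> dimg img m)" using f(1) by simp
qed

lemma der_incl: "der img (inc b) = inc (dB b)"
  by (simp add: incl_eq_mono der_mono) (simp add: incl_mult flip: incl_eq_mono)

lemma der_gel: "gooddiff img \<Longrightarrow> der img (gel x) = img x"
proof -
  assume g: "gooddiff img"
  then have "img x \<in> el UNIV" by (simp add: gooddiff_def)
  then show ?thesis
    using dimg_min[OF g, of "{#}" x] by (simp add: gel_eq_mono der_mono inc_1_tm[of _ UNIV] tm_inc_1[of _ UNIV])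
qed

text \<open>The sign of the graded Leibniz rule is carried by \<open>par (Suc 0)\<close>, so the
  rule can be stated for inhomogeneous \<open>f\<close>.\<close>

definition deriv :: "(('i, 'b) elt \<Rightarrow> ('i, 'b) elt) \<Rightarrow> bool" where
  "deriv \<theta> \<longleftrightarrow> (\<forall>f\<in>el UNIV. \<theta> f \<in> el UNIV) \<and>
     (\<forall>f\<in>el UNIV. \<forall>g\<in>el UNIV. \<theta> (f + g) = \<theta> f + \<theta> g) \<and>
     (\<forall>f\<in>el UNIV. \<forall>g\<in>el UNIV. \<theta> (f \<odot> g) = \<theta> f \<odot> g + par (Suc 0) f \<odot> \<theta> g) \<and>
     (\<forall>b. \<theta> (inc b) = inc (dB b))"

lemma derivD:
  assumes "deriv \<theta>"
  shows deriv_el: "f \<in> el UNIV \<Longrightarrow> \<theta> f \<in> el UNIV"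
    and deriv_add: "f \<in> el UNIV \<Longrightarrow> g \<in> el UNIV \<Longrightarrow> \<theta> (f + g) = \<theta> f + \<theta> g"
    and deriv_mult: "f \<in> el UNIV \<Longrightarrow> g \<in> el UNIV \<Longrightarrow> \<theta> (f \<odot> g) = \<theta> f \<odot> g + par (Suc 0) f \<odot> \<theta> g"
    and deriv_incl: "\<theta> (inc b) = inc (dB b)"
  using assms by (auto simp: deriv_def)

lemma deriv_zero: "deriv \<theta> \<Longrightarrow> \<theta> 0 = 0"
  using deriv_incl[of \<theta> 0] by simp

lemma deriv_minus: "deriv \<theta> \<Longrightarrow> f \<in> el UNIV \<Longrightarrow> \<theta> (- f) = - \<theta> f"
  using deriv_add[of \<theta> f "- f"] deriv_zero[of \<theta>] el_minus[of f UNIV]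
  by (simp add: eq_neg_iff_add_eq_0 add.commute)

lemma deriv_diff: "deriv \<theta> \<Longrightarrow> f \<in> el UNIV \<Longrightarrow> g \<in> el UNIV \<Longrightarrow> \<theta> (f - g) = \<theta> f - \<theta> g"
  using deriv_add[of \<theta> f "- g"] deriv_minus[of \<theta> g] el_minus[of g UNIV] by simp

theorem deriv_der:
  assumes g: "gooddiff img"
  shows "deriv (der img)"
proof -
  have e: "der img f \<in> el UNIV" if "f \<in> el UNIV" for f
    by (rule der_el[OF g _ that]) (use g in \<open>auto simp: gooddiff_def\<close>)
  have "der img (f \<odot> h) = der img f \<odot> h + par (Suc 0) f \<odot> der img h"
    if "f \<in> el UNIV" "h \<in> el UNIV" for f h
    using that(1)
  proof (induction f rule: el_induct)
    case (add f f')
    then show ?case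
      by (simp add: tm_add_left der_add[of _ UNIV] el_tm[of _ UNIV] par_add \<open>h \<in> el UNIV\<close>)
  next
    case m: (mono b m)
    from \<open>h \<in> el UNIV\<close> show ?case
    proof (induction h rule: el_induct)
      case (add h h')
      then show ?case using m
        by (simp add: tm_add_right der_add[of _ UNIV] el_tm[of _ UNIV] el_mono_in)
    next
      case n: (mono c n)
      define c' where "c' = bet (mdeg dg m) c"
      have hm: "hg (mdeg dg m) (mimg gel m)" and hd: "hg (Suc (mdeg dg m)) (dimg img m)"
        by (auto intro: mimg_hg hg_gel dimg_hg g)
      have pm: "par (Suc 0) (mono b m) = inc (binv bc b) \<odot> par (Suc 0) (mimg gel m)"
        using m(1) by (simp add: mono_eq_gels par_mult par_incl bet_def)
      have c1: "mimg gel m \<odot> inc a = inc (bet (mdeg dg m) a) \<odot> mimg gel m" for a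
        using tm_commute[OF hm, of "inc a"] by (simp add: par_incl)
      have c2: "dimg img m \<odot> inc a = inc (binv bc (bet (mdeg dg m) a)) \<odot> dimg img m" for a
        using tm_commute[OF hd, of "inc a"] by (simp add: par_incl bet_def)
      have c3: "par (Suc 0) (mimg gel m) \<odot> inc (dB c) = inc (dB c') \<odot> mimg gel m"
        using c1[of "dB c"] by (auto simp: par_hg[OF hm] c'_def dB_bet incl_minus tm_minus_left)
      have c4: "par (Suc 0) (mimg gel m) \<odot> inc a = inc (bet (mdeg dg m) a) \<odot> par (Suc 0) (mimg gel m)" for a
        using c1[of a] by (auto simp: par_hg[OF hm] tm_minus_left tm_minus_right)
      \<comment> \<open>The four terms are those where the derivation acts on \<open>b\<close>, on
        the word \<open>m\<close>, on \<open>c\<close> and on the word \<open>n\<close>.\<close>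
      have "der img (mono b m) \<odot> mono c n + par (Suc 0) (mono b m) \<odot> der img (mono c n)
        = inc (dB b) \<odot> (mimg gel m \<odot> inc c) \<odot> mimg gel n
        + inc (binv bc b) \<odot> (dimg img m \<odot> inc c) \<odot> mimg gel n
        + (inc (binv bc b) \<odot> (par (Suc 0) (mimg gel m) \<odot> inc (dB c)) \<odot> mimg gel n
        + inc (binv bc b) \<odot> (par (Suc 0) (mimg gel m) \<odot> inc (binv bc c)) \<odot> dimg img n)"
        unfolding der_mono pm unfolding mono_eq_gels[OF n(1)]
        by (simp add: tm_add_left tm_add_right tm_assoc)
      also have "\<dots> = inc (dB b * c') \<odot> (mimg gel m \<odot> mimg gel n)
        + inc (binv bc b * binv bc c') \<odot> (dimg img m \<odot> mimg gel n)
        + (inc (binv bc b * dB c') \<odot> (mimg gel m \<odot> mimg gel n)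
        + inc (binv bc b * binv bc c') \<odot> (par (Suc 0) (mimg gel m) \<odot> dimg img n))"
        unfolding c1 c2 c3 c4[of "binv bc c"] c'_def[symmetric] bet_binv
        by (simp add: tm_assoc flip: incl_mult)
      also have "\<dots> = inc (dB (b * c')) \<odot> (mimg gel m \<odot> mimg gel n)
        + inc (binv bc (b * c')) \<odot> (dimg img m \<odot> mimg gel n + par (Suc 0) (mimg gel m) \<odot> dimg img n)"
        by (simp add: dB_mult binv_mult incl_add tm_add_left tm_add_right algebra_simps)
      also have "\<dots> = der img (mono b m \<odot> mono c n)"
      proof (cases "vld (m + n)")
        case True
        have "binv bc (of_int k) = of_int k" for k using bet_of_int[of 1 k] by (simp add: bet_def)
        then show ?thesis
          unfolding dimg_mult[OF g m(1) n(1)] mimg_mult[OF good_gel m(1) n(1)] mono_mult c'_def[symmetric]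
          using True
          by (simp add: der_mono dB_of_int binv_mult[of "of_int _"] incl_mult
              of_int_commute[of _ "dB (b * c')"] of_int_commute[of _ "binv bc (b * c')"] flip: tm_assoc)
      next
        case False
        then show ?thesis
          unfolding dimg_mult[OF g m(1) n(1)] mimg_mult[OF good_gel m(1) n(1)] mono_mult
          by (simp add: der_superset[of "{}"] fun_pointwise)
      qed
      finally show ?case by (rule sym)
    qed
  qed
  then show ?thesis
    unfolding deriv_def by (simp add: e der_add[of _ UNIV] der_incl)
qed

lemma deriv_D0: "deriv (D0 dB)"
proof -
  have "D0 dB f \<in> el UNIV" if "f \<in> el UNIV" for f
  proof -
    have "{m. D0 dB f m \<noteq> 0} \<subseteq> {m. f m \<noteq> 0}" by (auto simp: D0_def)
    then have "finite {m. D0 dB f m \<noteq> 0}" by (rule finite_subset) (rule el_finite[OF that])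
    moreover have "vld m" if "D0 dB f m \<noteq> 0" for m
      using that el_supp[OF \<open>f \<in> el UNIV\<close>, of m] by (cases "f m = 0") (simp_all add: D0_def)
    ultimately show ?thesis by (simp add: elems_def)
  qed
  moreover have "D0 dB (f \<odot> h) = D0 dB f \<odot> h + par (Suc 0) f \<odot> D0 dB h" for f h
  proof
    fix n
    show "D0 dB (f \<odot> h) n = (D0 dB f \<odot> h + par (Suc 0) f \<odot> D0 dB h) n"
    proof (cases "vld n")
      case True
      show ?thesis
        unfolding D0_def tm_apply plus_fun_apply if_P[OF True] dB_sum sum.distrib[symmetric]
      proof (rule sum.cong[OF refl])
        fix m
        show "dB (of_int (msign dg m (n - m)) * (f m * bet (mdeg dg m) (h (n - m)))) =
          of_int (msign dg m (n - m)) * (dB (f m) * bet (mdeg dg m) (h (n - m))) +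
          of_int (msign dg m (n - m)) * (par (Suc 0) f m * bet (mdeg dg m) (dB (h (n - m))))"
          unfolding dB_of_int
          by (cases "even (mdeg dg m)")
             (simp_all add: dB_mult[of "f m"] dB_bet par_def bet_def[of "Suc 0"] distrib_left right_diff_distrib)
      qed
    qed (simp add: D0_def tm_apply plus_fun_apply)
  qed
  moreover have "D0 dB (inc b) = inc (dB b)" for b
    by (auto simp: D0_def incl_def)
  moreover have "D0 dB (f + g) = D0 dB f + D0 dB g" for f g
    by (auto simp: D0_def fun_pointwise dB_add)
  ultimately show ?thesis unfolding deriv_def by blast
qed

text \<open>The Leibniz rule of \<theta> is required only for left multiplication by coefficients
  and generators and only on \<open>el G\<close>. This matches the differential of a model, about
  which nothing is known outside one tensor factor.\<close>

lemma deriv_unique: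
  assumes d: "deriv \<theta>'" and "f \<in> el G"
    and add: "\<And>f g. f \<in> el G \<Longrightarrow> g \<in> el G \<Longrightarrow> \<theta> (f + g) = \<theta> f + \<theta> g"
    and one: "\<theta> (inc 1) = 0"
    and base: "\<And>b f. f \<in> el G \<Longrightarrow> \<theta> (inc b \<odot> f) = inc (dB b) \<odot> f + inc (binv bc b) \<odot> \<theta> f"
    and gen: "\<And>x f. x \<in> G \<Longrightarrow> f \<in> el G \<Longrightarrow> \<theta> (gel x \<odot> f) = \<theta>' (gel x) \<odot> f + par (Suc 0) (gel x) \<odot> \<theta> f"
  shows "\<theta> f = \<theta>' f"
  using assms(2)
proof (induction f rule: el_induct)
  case (add f g)
  then show ?case by (simp add: assms(3) deriv_add[OF d] el_UNIV)
next
  case (mono b m)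
  have e: "mimg gel m \<in> el G" if "set_mset m \<subseteq> G" for m
    using that by (intro mimg_el el_gel) auto
  have "\<theta> (mimg gel m) = \<theta>' (mimg gel m)" if "set_mset m \<subseteq> G" for m
    using that
    by (induction m rule: multiset_induct_min)
       (simp_all add: one deriv_incl[OF d] mimg_min gen e deriv_mult[OF d] el_UNIV[OF e])
  then have "\<theta> (inc b \<odot> mimg gel m) = \<theta>' (inc b \<odot> mimg gel m)" using mono(2)
    by (simp add: base e deriv_mult[OF d] el_UNIV[OF e] deriv_incl[OF d] par_incl bet_def)
  then show ?case unfolding mono_eq_gels[OF mono(1)] .
qed

lemma hom_par: "f \<in> el UNIV \<Longrightarrow> good img \<Longrightarrow> hom img (par k f) = par k (hom img f)"
proof (induction f rule: el_induct)
  case (add f g)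
  then show ?case by (simp add: par_add hom_add[of _ UNIV] par_el)
next
  case (mono b m)
  have h: "hg (mdeg dg m) (mimg img m)" using mono by (simp add: mimg_good)
  show ?case
    unfolding par_mono hom_mono par_mult par_incl par_hg[OF h]
    by (auto simp: minus_one_power_iff incl_minus tm_minus_left tm_minus_right)
qed

text \<open>Both composites are derivations along the algebra map, so they agree once they agree on
  generators. Most of the compatibilities with differentials below are obtained this way.\<close>

lemma deriv_hom_commute:
  assumes d: "deriv \<theta>" "deriv \<theta>'" and g: "good img" and "f \<in> el G"
    and gen: "\<And>x. x \<in> G \<Longrightarrow> \<theta> (img x) = hom img (\<theta>' (gel x))"
  shows "\<theta> (hom img f) = hom img (\<theta>' f)"
  using assms(4)
proof (induction f rule: el_induct)
  case (add f h)
  have "hom img k \<in> el UNIV" if "k \<in> el G" for k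
    by (rule hom_el[OF that]) (use g in \<open>auto simp: good_def\<close>)
  with add show ?case
    by (simp add: hom_add[of _ UNIV] deriv_add[OF d(1)] deriv_add[OF d(2)] el_UNIV deriv_el[OF d(2)])
next
  case (mono b m)
  have u: "hom img k \<in> el UNIV" if "k \<in> el UNIV" for k
    by (rule hom_el[OF that]) (use g in \<open>auto simp: good_def\<close>)
  have i: "img x \<in> el UNIV" for x using g by (simp add: good_def)
  have e: "mimg gel m \<in> el UNIV" for m by (intro mimg_el el_gel) auto
  have "\<theta> (hom img (mimg gel m)) = hom img (\<theta>' (mimg gel m))" if "set_mset m \<subseteq> G" for m
    using that
  proof (induction m rule: multiset_induct_min)
    case empty
    then show ?case by (simp add: deriv_incl[OF d(1)] deriv_incl[OF d(2)])
  next
    case (add x m)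
    then show ?case
      by (simp add: mimg_min hom_mult[OF g] e hom_gel_good[OF g] deriv_mult[OF d(1)] u i gen
          deriv_mult[OF d(2)] hom_add[of _ UNIV] el_tm[of _ UNIV] deriv_el[OF d(2)] par_el hom_par[OF _ g])
  qed
  then have "\<theta> (hom img (inc b \<odot> mimg gel m)) = hom img (\<theta>' (inc b \<odot> mimg gel m))" using mono(2)
    by (simp add: hom_mult[OF g] e deriv_mult[OF d(1)] u deriv_mult[OF d(2)] hom_add[of _ UNIV]
        el_tm[of _ UNIV] deriv_el[OF d(2)] par_incl deriv_incl[OF d(1)] deriv_incl[OF d(2)])
  then show ?case unfolding mono_eq_gels[OF mono(1)] .
qed


subsection \<open>Generators of the tensor factors and polynomial forms\<close>

lemma el_induct_homogeneous [consumes 1, case_names add mono]: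
  assumes "f \<in> el G"
    and "\<And>f g. f \<in> el G \<Longrightarrow> g \<in> el G \<Longrightarrow> P f \<Longrightarrow> P g \<Longrightarrow> P (f + g)"
    and "\<And>b m q. bc q b = b \<Longrightarrow> vld m \<Longrightarrow> set_mset m \<subseteq> G \<Longrightarrow> P (mono b m)"
  shows "P f"
  using assms(1)
proof (induction f rule: el_induct)
  case (add f g)
  then show ?case using assms(2) by blast
next
  case (mono b m)
  show ?case
  proof (induction b rule: homogeneous_induct)
    case (add x y)
    then show ?case unfolding mono_add by (intro assms(2) el_mono_in mono)
  next
    case (homogeneous p x)
    then show ?case using assms(3) mono by blast
  qed
qed

lemma gensk_iff: "x \<in> gensk k \<longleftrightarrow> (\<exists>j i. x = Gn j i \<and> j < k)"
  by (auto simp: gensk_def)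

lemma gensT_iff: "x \<in> gensT k \<longleftrightarrow> x \<in> gensk k \<or> x = Tg \<or> x = DTg"
  by (auto simp: gensT_def)

lemma gensk_subset_gensT: "gensk k \<subseteq> gensT k"
  by (auto simp: gensT_def)

lemma gdeg_simps [simp]: "gdeg dg (Gn j i) = dg i" "gdeg dg Tg = 0" "gdeg dg DTg = 1"
  by (simp_all add: gdeg_def)

lemma hg_gens: "hg (dg i) (gel (Gn j i))" "hg 0 (gel Tg)" "hg (Suc 0) (gel DTg)"
  using hg_gel[of "Gn j i"] hg_gel[of Tg] hg_gel[of DTg] by simp_all

lemma Gn_less [simp]: "Gn j i < Tg" "Gn j i < DTg" "Tg < DTg"
  and Gn_le_iff: "Gn j i \<le> Gn j' i' \<longleftrightarrow> j < j' \<or> (j = j' \<and> i \<le> i')"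
  by (auto simp: less_gen_def less_eq_gen_def)

lemma Gn_less_iff: "Gn j i < Gn j' i' \<longleftrightarrow> j < j' \<or> (j = j' \<and> i < i')"
  by (auto simp: less_gen_def)

text \<open>The factor index of the argument is forgotten. On one factor this is the inclusion as
  factor \<open>j\<close>; on two factors \<open>cpy 0\<close> is their multiplication.\<close>

definition cpy :: "nat \<Rightarrow> 'i gen \<Rightarrow> ('i, 'b) elt" where
  "cpy j x = (case x of Gn _ i \<Rightarrow> gel (Gn j i) | Tg \<Rightarrow> gel Tg | DTg \<Rightarrow> gel DTg)"

lemma copy_to_eq: "copy_to dg bc j = hom (cpy j)"
  by (simp add: copy_to_def hom_def cpy_def[abs_def])

lemma good_cpy: "good (cpy j)"
  by (auto simp: good_def cpy_def hg_gens split: gen.split)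

definition evi :: "'b \<Rightarrow> 'i gen \<Rightarrow> ('i, 'b) elt" where
  "evi c x = (case x of Gn j i \<Rightarrow> gel (Gn j i) | Tg \<Rightarrow> inc c | DTg \<Rightarrow> 0)"

lemma ev_eq: "ev dg bc c = hom (evi c)"
  by (simp add: ev_def hom_def evi_def[abs_def])

lemma good_evi: "bc 0 c = c \<Longrightarrow> good (evi c)"
  by (auto simp: good_def evi_def hg_gens hg_incl split: gen.split)

lemma evi_simps [simp]: "evi c (Gn j i) = gel (Gn j i)" "evi c Tg = inc c" "evi c DTg = 0"
  by (simp_all add: evi_def)

lemma hom_evi: "f \<in> el (gensk k) \<Longrightarrow> hom (evi c) f = f"
proof -
  assume f: "f \<in> el (gensk k)"
  then have "hom (evi c) f = hom gel f"
    by (rule hom_cong) (auto simp: gensk_iff evi_def)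
  then show ?thesis using hom_gel_id el_UNIV[OF f] by simp
qed

definition dgen :: "(('i, 'b) elt \<Rightarrow> ('i, 'b) elt) \<Rightarrow> 'i gen \<Rightarrow> ('i, 'b) elt" where
  "dgen D x = (case x of Gn j i \<Rightarrow> hom (cpy j) (D (gel (Gn 0 i))) | Tg \<Rightarrow> gel DTg | DTg \<Rightarrow> 0)"

lemma Dx_eq: "Dx dg bc dB D = der (dgen D)"
  unfolding Dx_def der_def dgen_def[abs_def] copy_to_eq by (rule refl)

definition good_diff :: "(('i, 'b) elt \<Rightarrow> ('i, 'b) elt) \<Rightarrow> bool" where
  "good_diff D \<longleftrightarrow> (\<forall>i. D (gel (Gn 0 i)) \<in> el (gensk 1) \<and> hg (Suc (dg i)) (D (gel (Gn 0 i))))"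

lemma gooddiff_dgen: "good_diff D \<Longrightarrow> gooddiff (dgen D)"
proof -
  assume d: "good_diff D"
  have "hom (cpy j) (D (gel (Gn 0 i))) \<in> el UNIV" for i j
    using d good_cpy unfolding good_diff_def good_def by (blast intro: hom_el)
  moreover have "hg (Suc (dg i)) (hom (cpy j) (D (gel (Gn 0 i))))" for i j
    using d good_cpy unfolding good_diff_def good_def by (blast intro: hom_hg)
  ultimately show ?thesis
    using hg_gel[of DTg] by (auto simp: gooddiff_def dgen_def split: gen.split)
qed

lemma hom_cpy_el: "f \<in> el (gensk 1) \<Longrightarrow> hom (cpy j) f \<in> el (gensk (Suc j))"
  by (rule hom_el, assumption) (auto simp: gensk_iff cpy_def)

lemma gensk_mono: "k \<le> l \<Longrightarrow> gensk k \<subseteq> gensk l"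
  by (auto simp: gensk_iff)

lemma deriv_Dx: "good_diff D \<Longrightarrow> deriv (Dx dg bc dB D)"
  unfolding Dx_eq by (rule deriv_der[OF gooddiff_dgen])

lemma Dx_gen:
  assumes "good_diff D"
  shows "Dx dg bc dB D (gel (Gn j i)) = hom (cpy j) (D (gel (Gn 0 i)))"
    "Dx dg bc dB D (gel Tg) = gel DTg" "Dx dg bc dB D (gel DTg) = 0"
  unfolding Dx_eq der_gel[OF gooddiff_dgen[OF assms]] by (simp_all add: dgen_def)

lemma dgen_el: "good_diff D \<Longrightarrow> x \<in> gensk k \<Longrightarrow> dgen D x \<in> el (gensk k)"
  unfolding gensk_iff dgen_def good_diff_def
  by (auto intro!: el_mono[OF gensk_mono hom_cpy_el])

lemma Dx_el: "good_diff D \<Longrightarrow> f \<in> el (gensk k) \<Longrightarrow> Dx dg bc dB D f \<in> el (gensk k)"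
  unfolding Dx_eq by (rule der_el[OF gooddiff_dgen dgen_el])

lemma Dx_hg: "good_diff D \<Longrightarrow> hg p f \<Longrightarrow> hg (Suc p) (Dx dg bc dB D f)"
  unfolding Dx_eq by (rule der_hg[OF gooddiff_dgen])

subsection \<open>Integration along the interval\<close>

definition tpow :: "nat \<Rightarrow> ('i, 'b) elt" where "tpow k = mono 1 (replicate_mset k Tg)"

lemma vld_replicate_Tg: "vld (replicate_mset k Tg)"
  by (auto simp: valid_def)

lemma tpow_el: "tpow k \<in> el UNIV"
  unfolding tpow_def by (rule el_mono_in) (simp_all add: vld_replicate_Tg)

lemma tpow_0: "tpow 0 = inc 1" and tpow_Suc: "tpow (Suc k) = gel Tg \<odot> tpow k"
proof -
  show "tpow 0 = inc 1" by (simp add: tpow_def incl_eq_mono)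
  have "msign dg {#Tg#} (replicate_mset k Tg) = 1" by (rule msign_eq_1) auto
  then show "tpow (Suc k) = gel Tg \<odot> tpow k"
    using vld_replicate_Tg[of "Suc k"] by (simp add: tpow_def gel_eq_mono mono_mult)
qed

lemma ninv_homogeneous: "n > 0 \<Longrightarrow> bc 0 (ninv n) = ninv n" "n > 0 \<Longrightarrow> dB (ninv n) = 0"
  using bc_ninv[of n 0 1] dB_ninv[of n 1] by (simp_all add: bc_one)

lemma binv_ninv: "n > 0 \<Longrightarrow> binv bc (ninv n) = ninv n"
  using binv_homogeneous[OF ninv_homogeneous(1)] by simp

lemma Dx_tpow:
  assumes d: "good_diff D"
  shows "Dx dg bc dB D (tpow k) = inc (of_nat k) \<odot> (tpow (k - 1) \<odot> gel DTg)"
proof (induction k)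
  case 0
  then show ?case by (simp add: tpow_0 deriv_incl[OF deriv_Dx[OF d]])
next
  case (Suc k)
  let ?d = "Dx dg bc dB D"
  have e: "gel Tg \<in> el UNIV" "gel DTg \<in> el UNIV" "tpow k \<odot> gel DTg \<in> el UNIV"
    by (simp_all add: el_tm tpow_el)
  have p: "par (Suc 0) (gel Tg) = gel Tg" by (simp add: par_hg[OF hg_gel])
  have hk: "hg 0 (tpow k)" using hg_mono[of 0 1 "replicate_mset k Tg"]
    by (simp add: tpow_def bc_one mdeg_def)
  have c: "gel DTg \<odot> tpow k = tpow k \<odot> gel DTg" using tm_commute[OF hk, of "gel DTg"] by simp
  have "?d (tpow (Suc k)) = tpow k \<odot> gel DTg + gel Tg \<odot> (inc (of_nat k) \<odot> (tpow (k - 1) \<odot> gel DTg))"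
    unfolding tpow_Suc deriv_mult[OF deriv_Dx[OF d] e(1) tpow_el] Suc.IH Dx_gen(2)[OF d] p c ..
  also have "gel Tg \<odot> (inc (of_nat k) \<odot> (tpow (k - 1) \<odot> gel DTg)) = inc (of_nat k) \<odot> (tpow k \<odot> gel DTg)"
  proof (cases k)
    case (Suc l)
    have "gel Tg \<odot> (inc (of_nat k) \<odot> (tpow l \<odot> gel DTg)) = (gel Tg \<odot> inc (of_int (int k))) \<odot> (tpow l \<odot> gel DTg)"
      by (simp add: tm_assoc)
    also have "\<dots> = inc (of_nat k) \<odot> (gel Tg \<odot> (tpow l \<odot> gel DTg))"
      unfolding tm_inc_of_int by (simp add: tm_assoc)
    finally show ?thesis using Suc by (simp add: tpow_Suc tm_assoc)
  qed simp
  also have "tpow k \<odot> gel DTg + inc (of_nat k) \<odot> (tpow k \<odot> gel DTg) = inc (of_nat (Suc k)) \<odot> (tpow k \<odot> gel DTg)"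
    by (simp add: incl_add tm_add_left inc_1_tm[OF e(3)])
  finally show ?case by simp
qed

text \<open>The form t^l dt integrates to 1/(l + 1); the sign is that of a degree -1 operator moved
  past the coefficient.\<close>
definition jmono :: "'b \<Rightarrow> 'i gen multiset \<Rightarrow> ('i, 'b) elt" where
  "jmono b n = (if DTg \<in># n then inc (ninv (Suc (count n Tg))) \<odot>
      par (Suc 0) (mono b (filter_mset (\<lambda>x. x \<noteq> Tg \<and> x \<noteq> DTg) n)) else 0)"

definition integ :: "('i, 'b) elt \<Rightarrow> ('i, 'b) elt" where
  "integ f = (\<Sum>n\<in>{n. f n \<noteq> 0}. jmono (f n) n)"

lemma jmono_zero [simp]: "jmono 0 n = 0" and jmono_add: "jmono (b + c) n = jmono b n + jmono c n"
  by (simp_all add: jmono_def mono_add par_add tm_add_right)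

lemma integ_superset:
  assumes "finite A" "{m. f m \<noteq> 0} \<subseteq> A"
  shows "integ f = (\<Sum>m\<in>A. jmono (f m) m)"
  unfolding integ_def by (rule sum.mono_neutral_left) (use assms in auto)

lemma integ_mono: "integ (mono b m) = jmono b m"
  by (subst integ_superset[of "{m}"]) (auto simp: mono_def)

lemma integ_add: "f \<in> el G \<Longrightarrow> g \<in> el G \<Longrightarrow> integ (f + g) = integ f + integ g"
proof -
  assume a: "f \<in> el G" "g \<in> el G"
  let ?A = "{m. f m \<noteq> 0} \<union> {m. g m \<noteq> 0}"
  have "finite ?A" using a by (simp add: el_finite)
  moreover have "{m. (f + g) m \<noteq> 0} \<subseteq> ?A" by (auto simp: fun_pointwise)
  ultimately show ?thesis
    by (simp add: integ_superset[of ?A] jmono_add sum.distrib fun_pointwise)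
qed

lemma integ_el: "f \<in> el (gensT k) \<Longrightarrow> integ f \<in> el (gensk k)"
  unfolding integ_def
proof (rule el_sum)
  fix n assume f: "f \<in> el (gensT k)" "n \<in> {n. f n \<noteq> 0}"
  then have n: "vld n" "set_mset n \<subseteq> gensT k" using el_supp by auto
  have "vld (filter_mset (\<lambda>x. x \<noteq> Tg \<and> x \<noteq> DTg) n)" using n(1) valid_subset[OF multiset_filter_subset] by blast
  moreover have "set_mset (filter_mset (\<lambda>x. x \<noteq> Tg \<and> x \<noteq> DTg) n) \<subseteq> gensk k"
    using n(2) by (auto simp: gensT_iff)
  ultimately show "jmono (f n) n \<in> el (gensk k)"
    unfolding jmono_def by (auto intro!: el_tm par_el el_mono_in)
qed

text \<open>\<open>Tg\<close> and \<open>DTg\<close> come last in the order of generators, so no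
  signs arise.\<close>

lemma Gn_tpow:
  assumes "vld m" "set_mset m \<subseteq> gensk k"
  shows "mono b m \<odot> tpow l = mono b (m + replicate_mset l Tg)"
    and "mono b m \<odot> (tpow l \<odot> gel DTg) = mono b (m + replicate_mset l Tg + {#DTg#})"
proof -
  have ne: "x \<noteq> Tg" "x \<noteq> DTg" if "x \<in># m" for x using assms(2) that by (auto simp: gensk_iff)
  have v1: "vld (m + replicate_mset l Tg)"
    using assms(1) vld_replicate_Tg[of l] by (auto simp: valid_add_iff)
  have s1: "msign dg m (replicate_mset l Tg) = 1"
    by (rule msign_eq_1) (auto split: if_splits)
  show 1: "mono b m \<odot> tpow l = mono b (m + replicate_mset l Tg)"
    using v1 s1 by (simp add: tpow_def mono_mult)
  have v2: "vld (m + replicate_mset l Tg + {#DTg#})"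
    using v1 ne by (auto simp: valid_add_mset_iff split: if_splits)
  have "x \<le> DTg" for x :: "'i gen" by (cases x) (auto simp: less_eq_gen_def)
  then have "msign dg (m + replicate_mset l Tg) {#DTg#} = 1"
    by (intro msign_eq_1) auto
  then show "mono b m \<odot> (tpow l \<odot> gel DTg) = mono b (m + replicate_mset l Tg + {#DTg#})"
    using v2 by (simp add: 1 gel_eq_mono mono_mult flip: tm_assoc)
qed

lemma integ_tpow:
  assumes "g \<in> el (gensk k)"
  shows "integ (g \<odot> tpow l) = 0"
    and "integ (g \<odot> (tpow l \<odot> gel DTg)) = inc (ninv (Suc l)) \<odot> par (Suc 0) g"
proof -
  have u: "g \<odot> tpow l \<in> el UNIV" "g \<odot> (tpow l \<odot> gel DTg) \<in> el UNIV" if "g \<in> el (gensk k)" for g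
    using that by (auto intro!: el_tm tpow_el intro: el_UNIV)
  have c: "DTg \<notin># m" "count m Tg = 0" "filter_mset (\<lambda>x. x \<noteq> Tg \<and> x \<noteq> DTg) m = m"
    if "set_mset m \<subseteq> gensk k" for m
  proof -
    show "DTg \<notin># m" "count m Tg = 0" using that by (auto simp: gensk_iff not_in_iff[symmetric])
    show "filter_mset (\<lambda>x. x \<noteq> Tg \<and> x \<noteq> DTg) m = m"
      unfolding filter_mset_eq_conv using that by (auto simp: gensk_iff)
  qed
  show "integ (g \<odot> tpow l) = 0"
    using assms
  proof (induction g rule: el_induct)
    case (add f g)
    then show ?case by (simp add: tm_add_left integ_add[of _ UNIV] u)
  next
    case (mono b m)
    then show ?case by (simp add: Gn_tpow(1) integ_mono jmono_def c split: if_splits)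
  qed
  show "integ (g \<odot> (tpow l \<odot> gel DTg)) = inc (ninv (Suc l)) \<odot> par (Suc 0) g"
    using assms
  proof (induction g rule: el_induct)
    case (add f g)
    then show ?case by (simp add: tm_add_left tm_add_right par_add integ_add[of _ UNIV] u)
  next
    case (mono b m)
    have "filter_mset (\<lambda>x. x \<noteq> Tg \<and> x \<noteq> DTg) (replicate_mset l Tg) = {#}"
      by (intro multiset_eqI) auto
    then have "filter_mset (\<lambda>x. x \<noteq> Tg \<and> x \<noteq> DTg) (m + replicate_mset l Tg + {#DTg#}) = m"
      using c(3)[OF mono(2)] by simp
    with mono show ?case by (simp only: Gn_tpow(2) integ_mono jmono_def) (simp add: c)
  qed
qed

lemma hom_evi_tpow:
  shows "hom (evi 1) (tpow l) = inc 1" and "hom (evi 0) (tpow l) = (if l = 0 then inc 1 else 0)"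
proof -
  have g: "good (evi 0)" "good (evi 1)" by (auto intro: good_evi simp: bc_one)
  show "hom (evi 1) (tpow l) = inc 1"
    by (induction l) (simp_all add: tpow_0 tpow_Suc hom_mult[OF g(2)] tpow_el hom_gel_good[OF g(2)] incl_mult)
  show "hom (evi 0) (tpow l) = (if l = 0 then inc 1 else 0)"
    by (cases l) (simp_all add: tpow_0 tpow_Suc hom_mult[OF g(1)] tpow_el hom_gel_good[OF g(1)])
qed

text \<open>Stokes' formula on the interval: integration is a chain homotopy between the evaluations
  at 0 and 1. On \<open>a \<odot> tpow l\<close> it is the fundamental theorem of calculus for
  \<open>t^l\<close>; on \<open>a \<odot> (tpow l \<odot> gel DTg)\<close> the left side vanishes
  and the two terms on the right cancel.\<close>

lemma integ_homotopy:
  assumes d: "good_diff D" and "f \<in> el (gensT k)"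
  shows "hom (evi 1) f - hom (evi 0) f = integ (Dx dg bc dB D f) + Dx dg bc dB D (integ f)"
  using assms(2)
proof (induction f rule: el_induct_homogeneous)
  case (add f g)
  have e: "Dx dg bc dB D h \<in> el UNIV" "integ h \<in> el UNIV" if "h \<in> el (gensT k)" for h
    using that by (simp_all add: deriv_el[OF deriv_Dx[OF d]] el_UNIV[OF integ_el] el_UNIV)
  have "hom (evi 1) (f + g) - hom (evi 0) (f + g)
     = (hom (evi 1) f - hom (evi 0) f) + (hom (evi 1) g - hom (evi 0) g)"
    using add.hyps by (simp add: hom_add[of _ "gensT k"])
  also have "\<dots> = integ (Dx dg bc dB D (f + g)) + Dx dg bc dB D (integ (f + g))"
    using add.hyps unfolding add.IH
    by (simp add: deriv_add[OF deriv_Dx[OF d]] el_UNIV e integ_add[of _ "gensT k"] integ_add[of _ UNIV])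
  finally show ?case .
next
  case (mono b n q)
  let ?d = "Dx dg bc dB D"
  note dd = deriv_Dx[OF d]
  define m where "m = filter_mset (\<lambda>x. x \<noteq> Tg \<and> x \<noteq> DTg) n"
  define l where "l = count n Tg"
  have mk: "set_mset m \<subseteq> gensk k" using mono(3) by (auto simp: m_def gensT_iff)
  have vm: "vld m" using mono(2) valid_subset[OF multiset_filter_subset] by (auto simp: m_def)
  define a where "a = mono b m"
  have ak: "a \<in> el (gensk k)" unfolding a_def by (rule el_mono_in[OF vm mk])
  have au: "a \<in> el UNIV" by (rule el_UNIV[OF ak])
  have dak: "?d a \<in> el (gensk k)" by (rule Dx_el[OF d ak])
  have pak: "par (Suc 0) a \<in> el (gensk k)" by (rule par_el[OF ak])
  have pp: "par (Suc 0) (par (Suc 0) a) = a" by (simp add: par_par par_even)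
  have ha: "hg (q + mdeg dg m) a" unfolding a_def by (rule hg_mono[OF mono(1)])
  have hda: "hg (Suc (q + mdeg dg m)) (?d a)" by (rule Dx_hg[OF d ha])
  have dpar: "?d (par (Suc 0) a) = - par (Suc 0) (?d a)"
    unfolding par_hg[OF ha] par_hg[OF hda] by (auto simp: deriv_minus[OF dd au])
  have g: "good (evi 0)" "good (evi 1)" by (auto intro: good_evi simp: bc_one)
  have c1: "count n DTg \<le> 1" using mono(2) by (simp add: valid_def)
  show ?case
  proof (cases "DTg \<in># n")
    case False
    then have "n = m + replicate_mset l Tg"
      by (intro multiset_eqI) (auto simp: m_def l_def not_in_iff)
    then have f: "mono b n = a \<odot> tpow l" using Gn_tpow(1)[OF vm mk] by (simp add: a_def)
    have "integ (?d (a \<odot> tpow l)) = (if l = 0 then 0 else a)"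
    proof -
      have e1: "par (Suc 0) a \<odot> ?d (tpow l) = (par (Suc 0) a \<odot> inc (of_nat l)) \<odot> (tpow (l - 1) \<odot> gel DTg)"
        unfolding Dx_tpow[OF d] by (simp add: tm_assoc)
      have e2: "par (Suc 0) a \<odot> inc (of_nat l) \<in> el (gensk k)" by (intro el_tm pak el_incl)
      have "?d (a \<odot> tpow l) = ?d a \<odot> tpow l + (par (Suc 0) a \<odot> inc (of_nat l)) \<odot> (tpow (l - 1) \<odot> gel DTg)"
        by (simp add: deriv_mult[OF dd au tpow_el] e1)
      \<comment> \<open>For \<open>l = 0\<close> the truncated exponent \<open>l - 1\<close> does no
        harm, since the factor \<open>of_nat l\<close> is zero; otherwise \<open>Suc (l - 1)\<close>
        is \<open>l\<close> and cancels it.\<close>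
      then have "integ (?d (a \<odot> tpow l)) = inc (ninv (Suc (l - 1))) \<odot> par (Suc 0) (par (Suc 0) a \<odot> inc (of_nat l))"
        using integ_tpow(1)[OF dak, of l] integ_tpow(2)[OF e2, of "l - 1"]
        by (simp add: integ_add[of _ UNIV] el_tm[of _ UNIV] el_UNIV[OF dak] el_UNIV[OF e2] tpow_el)
      also have "par (Suc 0) (par (Suc 0) a \<odot> inc (of_nat l)) = inc (of_nat l) \<odot> a"
        using tm_inc_of_int[of a "int l"] bet_of_int[of "Suc 0" "int l"] by (simp add: par_mult pp par_incl)
      also have "inc (ninv (Suc (l - 1))) \<odot> (inc (of_nat l) \<odot> a) = (if l = 0 then 0 else a)"
        using ninv(2)[of l] inc_1_tm[OF au] by (auto simp: incl_mult simp flip: tm_assoc)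
      finally show ?thesis .
    qed
    then show ?thesis
      unfolding f integ_tpow(1)[OF ak] deriv_zero[OF dd]
      by (simp add: hom_mult[OF g(1) au tpow_el] hom_mult[OF g(2) au tpow_el] hom_evi[OF ak]
          hom_evi_tpow tm_inc_1[OF au])
  next
    case True
    then have "count n DTg = 1" using c1 by (simp add: Suc_le_eq le_antisym)
    then have "n = m + replicate_mset l Tg + {#DTg#}"
      by (intro multiset_eqI) (auto simp: m_def l_def)
    then have f: "mono b n = a \<odot> (tpow l \<odot> gel DTg)" using Gn_tpow(2)[OF vm mk] by (simp add: a_def)
    have w: "tpow l \<odot> gel DTg \<in> el UNIV" "gel DTg \<in> el UNIV" by (simp_all add: el_tm tpow_el)
    have "?d (tpow l \<odot> gel DTg) = 0"
      using odd_square[OF hg_gel, of DTg UNIV]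
      by (simp add: deriv_mult[OF dd tpow_el w(2)] Dx_tpow[OF d] Dx_gen[OF d] tm_assoc)
    then have "?d (a \<odot> (tpow l \<odot> gel DTg)) = ?d a \<odot> (tpow l \<odot> gel DTg)"
      by (simp add: deriv_mult[OF dd au w(1)])
    then have 1: "integ (?d (a \<odot> (tpow l \<odot> gel DTg))) = inc (ninv (Suc l)) \<odot> par (Suc 0) (?d a)"
      by (simp add: integ_tpow(2)[OF dak])
    have 2: "?d (inc (ninv (Suc l)) \<odot> par (Suc 0) a) = - (inc (ninv (Suc l)) \<odot> par (Suc 0) (?d a))"
      by (simp add: deriv_mult[OF dd el_incl el_UNIV[OF pak]] deriv_incl[OF dd] ninv_homogeneous
          par_incl bet_def binv_ninv dpar tm_minus_right)
    show ?thesis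
      unfolding f 1 integ_tpow(2)[OF ak] 2
      by (simp add: hom_mult[OF g(1) au w(1)] hom_mult[OF g(2) au w(1)] hom_mult[OF g(1) tpow_el w(2)]
          hom_mult[OF g(2) tpow_el w(2)] hom_gel_good[OF g(1)] hom_gel_good[OF g(2)])
  qed
qed

end

declare One_nat_def [simp del]

fun wl :: "'i gen \<Rightarrow> nat" where
  "wl (Gn _ _) = 1" | "wl Tg = 0" | "wl DTg = 0"

locale odd_ext = cdga_ext bc dB dg
  for bc :: "nat \<Rightarrow> 'b::ring_1 \<Rightarrow> 'b" and dB and dg :: "'i::wellorder \<Rightarrow> nat" +
  assumes odd_dg: "odd (dg i)"
begin

subsection \<open>Word length\<close>

lemma dg_pos: "0 < dg i"
  using odd_dg[of i] by (cases "dg i") auto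

lemma wt_le_mdeg: "wt wl m \<le> mdeg dg m"
proof (induction m)
  case (add x m)
  have "wl x \<le> gdeg dg x" using dg_pos by (cases x) (auto simp: Suc_le_eq One_nat_def)
  with add show ?case by simp
qed simp

text \<open>This ends every correction by word length: each letter has degree at least 1, so nothing
  of total degree \<open>p\<close> has more than \<open>p\<close> letters.\<close>

lemma filt_degree_zero: "hg p f \<Longrightarrow> f \<in> filt wl n \<Longrightarrow> p < n \<Longrightarrow> f = 0"
proof
  fix m assume a: "hg p f" "f \<in> filt wl n" "p < n"
  show "f m = 0 m"
  proof (rule ccontr)
    assume "f m \<noteq> 0 m"
    then have "f m \<noteq> 0" by (simp add: fun_pointwise)
    then have "mdeg dg m \<le> p" "n \<le> wt wl m" using hgD[OF a(1)] a(2) by (auto simp: filt_def)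
    with wt_le_mdeg[of m] a(3) show False by linarith
  qed
qed

lemma gel_filt: "gel x \<in> filt w (w x)"
  by (simp add: gel_eq_mono filt_mono)

abbreviation wg :: "'i \<Rightarrow> ('i, 'b) elt" where "wg i \<equiv> gel (Gn 0 i)"

definition ximg :: "('i \<Rightarrow> ('i, 'b) elt) \<Rightarrow> 'i gen \<Rightarrow> ('i, 'b) elt" where
  "ximg x g = (case g of Gn _ i \<Rightarrow> x i | _ \<Rightarrow> 0)"

lemma ximg_simps [simp]: "ximg x (Gn j i) = x i" "ximg x Tg = 0" "ximg x DTg = 0"
  by (simp_all add: ximg_def)

definition fam :: "('i \<Rightarrow> ('i, 'b) elt) \<Rightarrow> bool" where
  "fam x \<longleftrightarrow> (\<forall>i. x i \<in> el (gensk 1) \<and> hg (dg i) (x i))"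

lemma fam_el: "fam x \<Longrightarrow> x i \<in> el (gensk 1)" and fam_hg: "fam x \<Longrightarrow> hg (dg i) (x i)"
  by (simp_all add: fam_def)

lemma wg_el: "wg i \<in> el (gensk 1)"
  by (simp add: gensk_iff)

lemma good_ximg: "fam x \<Longrightarrow> good (ximg x)"
  by (auto simp: good_def ximg_def fam_def intro: el_UNIV split: gen.split)

lemma hom_ximg_el: "fam x \<Longrightarrow> f \<in> el (gensk 1) \<Longrightarrow> hom (ximg x) f \<in> el (gensk 1)"
  by (rule hom_el, assumption) (auto simp: gensk_iff fam_def)

lemma hom_ximg_hg: "fam x \<Longrightarrow> f \<in> el (gensk 1) \<Longrightarrow> hg p f \<Longrightarrow> hg p (hom (ximg x) f)"
  by (rule hom_hg, assumption, assumption) (auto simp: gensk_iff fam_def)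

lemma hom_ximg_wg: "fam x \<Longrightarrow> hom (ximg x) (wg i) = x i"
  using hom_gel_good[OF good_ximg, of x "Gn 0 i"] by simp

lemma hom_ximg_comp:
  assumes "fam x" "fam y" "f \<in> el (gensk 1)"
  shows "hom (ximg x) (hom (ximg y) f) = hom (ximg (\<lambda>i. hom (ximg x) (y i))) f"
proof -
  have "hom (ximg x) (hom (ximg y) f) = hom (\<lambda>g. hom (ximg x) (ximg y g)) f"
    by (rule hom_hom) (use assms good_ximg el_UNIV in auto)
  also have "\<dots> = hom (ximg (\<lambda>i. hom (ximg x) (y i))) f"
    by (rule hom_cong[OF assms(3)]) (auto simp: gensk_iff)
  finally show ?thesis .
qed

lemma hom_ximg_id:
  assumes "f \<in> el (gensk 1)" "\<And>i. x i = wg i"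
  shows "hom (ximg x) f = f"
proof -
  have "hom (ximg x) f = hom gel f"
    by (rule hom_cong[OF assms(1)]) (auto simp: gensk_iff assms(2))
  then show ?thesis using hom_gel_id el_UNIV[OF assms(1)] by simp
qed

lemma hom_ximg_filt:
  assumes "f \<in> el (gensk 1)" "f \<in> filt wl n" "\<And>i. x i \<in> filt wl 1"
  shows "hom (ximg x) f \<in> filt wl n"
  by (rule hom_filt[OF assms(1,2)]) (auto simp: gensk_iff assms(3))

subsection \<open>Triangular changes of generators\<close>

text \<open>Coefficients are arbitrary, but only strictly earlier generators occur, so arguments
  about linear parts can use well-founded induction on the index.\<close>

definition lin :: "'i \<Rightarrow> ('i, 'b) elt set" where
  "lin i = {f \<in> el (gensk 1). \<forall>m. f m \<noteq> 0 \<longrightarrow> (\<exists>j<i. m = {#Gn 0 j#})}"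

lemma lin_el: "f \<in> lin i \<Longrightarrow> f \<in> el (gensk 1)"
  by (simp add: lin_def)

lemma lin_zero [simp]: "0 \<in> lin i"
  by (simp add: lin_def fun_pointwise)

lemma lin_add: "f \<in> lin i \<Longrightarrow> g \<in> lin i \<Longrightarrow> f + g \<in> lin i"
  unfolding lin_def by (simp add: el_add fun_pointwise) (metis add.right_neutral)

lemma lin_minus: "f \<in> lin i \<Longrightarrow> - f \<in> lin i"
  unfolding lin_def by (simp add: el_minus fun_pointwise)

lemma lin_diff: "f \<in> lin i \<Longrightarrow> g \<in> lin i \<Longrightarrow> f - g \<in> lin i"
  using lin_add[of f i "- g"] lin_minus by simp

lemma lin_mono: "j \<le> i \<Longrightarrow> f \<in> lin j \<Longrightarrow> f \<in> lin i"
  unfolding lin_def by (auto dest: order.strict_trans2)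

lemma lin_scale: "f \<in> lin i \<Longrightarrow> inc b \<odot> f \<in> lin i"
proof -
  assume f: "f \<in> lin i"
  then have e: "f \<in> el (gensk 1)" by (rule lin_el)
  show ?thesis
    unfolding lin_def
  proof (intro CollectI conjI allI impI)
    show "inc b \<odot> f \<in> el (gensk 1)" by (rule el_tm[OF el_incl e])
    fix m assume "(inc b \<odot> f) m \<noteq> 0"
    then have "f m \<noteq> 0" by (auto simp: inc_tm_apply[OF e])
    then show "\<exists>j<i. m = {#Gn 0 j#}" using f by (simp add: lin_def)
  qed
qed

lemma lin_filt: "f \<in> lin i \<Longrightarrow> f \<in> filt wl 1"
  by (rule filtI) (auto simp: lin_def)

lemma lin_gel: "j < i \<Longrightarrow> mono c {#Gn 0 j#} \<in> lin i"
  by (auto simp: lin_def gensk_iff mono_def intro!: el_mono_in[unfolded mono_def])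

lemma mono_gel: "mono c {#x#} = inc c \<odot> gel x"
  by (simp add: gel_eq_mono incl_eq_mono mono_mult)

text \<open>Finite support gives a last generator occurring in \<open>f\<close>. Without its term
  the rest lies in \<open>lin j\<close> with smaller index \<open>j\<close>, where an induction
  hypothesis applies.\<close>

lemma lin_cases:
  assumes "f \<in> lin i" "f \<noteq> 0"
  obtains j c f' where "j < i" "f' \<in> lin j" "f = inc c \<odot> wg j + f'"
    "\<And>p. hg p f \<Longrightarrow> hg p f'" "\<And>p. hg p f \<Longrightarrow> hg p (inc c \<odot> wg j)"
    "\<And>p. hg p f \<Longrightarrow> dg j \<le> p \<and> bc (p - dg j) c = c" "f {#Gn 0 j#} = c"
proof -
  let ?J = "{j. f {#Gn 0 j#} \<noteq> 0}"
  have "finite ((\<lambda>j. {#Gn 0 j#}) ` ?J)"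
    by (rule finite_subset[OF _ el_finite[OF lin_el[OF assms(1)]]]) auto
  then have fin: "finite ?J" by (rule finite_imageD) (auto simp: inj_on_def)
  obtain m where "f m \<noteq> 0" using assms(2) by (auto simp: fun_eq_iff fun_pointwise)
  then have ne: "?J \<noteq> {}" using assms(1) by (auto simp: lin_def)
  define j where "j = Max ?J"
  have j: "f {#Gn 0 j#} \<noteq> 0" and mx: "\<And>k. f {#Gn 0 k#} \<noteq> 0 \<Longrightarrow> k \<le> j"
    using Max_in[OF fin ne] Max_ge[OF fin] by (auto simp: j_def)
  define c where "c = f {#Gn 0 j#}"
  define f' where "f' = f - mono c {#Gn 0 j#}"
  have ji: "j < i" using assms(1) j by (auto simp: lin_def)
  have f'm: "f' m = (if m = {#Gn 0 j#} then 0 else f m)" for m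
    by (simp add: f'_def mono_def c_def fun_pointwise)
  have "f' \<in> lin i" unfolding f'_def by (rule lin_diff[OF assms(1) lin_gel[OF ji]])
  then have f'j: "f' \<in> lin j"
    unfolding lin_def using f'm mx by (auto simp: le_less split: if_splits) (metis le_less)
  have fc: "f = inc c \<odot> wg j + f'" by (simp add: f'_def mono_gel)
  have hc: "dg j \<le> p \<and> bc (p - dg j) c = c" if "hg p f" for p
    using hgD[OF that j] by (simp add: c_def)
  have hm: "hg p (inc c \<odot> wg j)" if "hg p f" for p
    using hg_mono[of "p - dg j" c "{#Gn 0 j#}"] hc[OF that] by (simp add: mono_gel)
  have hf': "hg p f'" if "hg p f" for p
    unfolding f'_def using hg_diff[OF that hm[OF that]] by (simp add: mono_gel)
  show thesis by (rule that[OF ji f'j fc hf' hm hc]) (simp_all add: c_def)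
qed

definition gens_below :: "'i \<Rightarrow> 'i gen set" where "gens_below i = {Gn 0 j | j. j < i}"

lemma gens_below_subset: "gens_below i \<subseteq> gensk 1"
  by (auto simp: gens_below_def gensk_iff)

lemma lin_below: "f \<in> lin i \<Longrightarrow> f \<in> el (gens_below i)"
  unfolding lin_def elems_def gens_below_def by auto

lemma linear_part:
  assumes "f \<in> el (gens_below i)" "f \<in> filt wl 1" "hg p f"
  obtains l where "l \<in> lin i" "hg p l" "f - l \<in> filt wl 2"
proof -
  define l where "l = (\<lambda>m. if size m = 1 then f m else 0)"
  have wt: "wt wl m = size m" if "set_mset m \<subseteq> gens_below i" for m
    using that by (induction m) (auto simp: gens_below_def)
  have "{m. l m \<noteq> 0} \<subseteq> {m. f m \<noteq> 0}" by (auto simp: l_def)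
  then have "finite {m. l m \<noteq> 0}" by (rule finite_subset) (rule el_finite[OF assms(1)])
  then have le: "l \<in> el (gens_below i)"
    using el_supp[OF assms(1)] by (auto simp: elems_def l_def split: if_splits)
  then have "l \<in> el (gensk 1)" by (rule el_mono[OF gens_below_subset])
  moreover have "\<exists>j<i. m = {#Gn 0 j#}" if "l m \<noteq> 0" for m
  proof -
    have "size m = 1" using that by (auto simp: l_def split: if_splits)
    then obtain x where x: "m = {#x#}" by (metis size_1_singleton_mset)
    then show ?thesis using el_supp[OF le that] by (auto simp: gens_below_def)
  qed
  ultimately have "l \<in> lin i" by (simp add: lin_def)
  moreover have "hg p l"
    by (rule hgI) (use hgD[OF assms(3)] in \<open>auto simp: l_def split: if_splits\<close>)
  moreover have "f - l \<in> filt wl 2"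
  proof (rule filtI)
    fix m assume "(f - l) m \<noteq> 0"
    then have f: "f m \<noteq> 0" "size m \<noteq> 1" by (auto simp: l_def fun_pointwise split: if_splits)
    then have "wt wl m = size m" using el_supp[OF assms(1)] wt by blast
    moreover have "1 \<le> wt wl m" using assms(2) f(1) by (simp add: filt_def)
    ultimately show "2 \<le> wt wl m" using f(2) by simp
  qed
  ultimately show thesis by (rule that)
qed

text \<open>A unipotent change of generators in two senses at once: the linear part is the identity
  plus strictly earlier generators, and everything else consists of words of length at least
  two.\<close>

definition tri :: "('i \<Rightarrow> ('i, 'b) elt) \<Rightarrow> bool" where
  "tri x \<longleftrightarrow> fam x \<and> (\<forall>i. \<exists>l\<in>lin i. hg (dg i) l \<and> x i - wg i - l \<in> filt wl 2)"

lemma tri_fam: "tri x \<Longrightarrow> fam x"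
  by (simp add: tri_def)

lemma wg_filt: "wg i \<in> filt wl 1"
  using gel_filt[of "Gn 0 i" wl] by simp

lemma tri_filt: "tri x \<Longrightarrow> x i \<in> filt wl 1"
proof -
  assume "tri x"
  then obtain l where l: "l \<in> lin i" "x i - wg i - l \<in> filt wl 2" unfolding tri_def by blast
  have "x i = (x i - wg i - l) + l + wg i" by simp
  also have "\<dots> \<in> filt wl 1"
    by (intro filt_add lin_filt[OF l(1)] wg_filt filt_le[OF l(2)]) simp
  finally show ?thesis .
qed

text \<open>Back substitution: using \<open>inc c \<odot> wg j\<close> for the last term of
  \<open>f\<close> produces the additional linear terms \<open>inc c \<odot> l\<close>, which
  involve only generators before \<open>j\<close> and are left to the induction.\<close>

lemma tri_solve_linear:
  assumes x: "tri x"
  shows "f \<in> lin i \<Longrightarrow> hg p f \<Longrightarrow> \<exists>g\<in>lin i. hg p g \<and> hom (ximg x) g - f \<in> filt wl 2"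
proof (induction i arbitrary: f rule: less_induct)
  case (less i)
  show ?case
  proof (cases "f = 0")
    case True
    then show ?thesis by (intro bexI[of _ 0]) auto
  next
    case False
    obtain j c f' where j: "j < i" "f' \<in> lin j" "f = inc c \<odot> wg j + f'" "hg p f'"
      "hg p (inc c \<odot> wg j)" "dg j \<le> p" "bc (p - dg j) c = c"
      by (rule lin_cases[OF less.prems(1) False]) (use less.prems(2) in blast)
    obtain l where l: "l \<in> lin j" "hg (dg j) l" "x j - wg j - l \<in> filt wl 2"
      using x unfolding tri_def by blast
    have "hg p (inc c \<odot> l)" using hg_mult[OF hg_incl[OF j(7)] l(2)] j(6) by simp
    then obtain g where g: "g \<in> lin j" "hg p g" "hom (ximg x) g - (f' - inc c \<odot> l) \<in> filt wl 2"
      using less.IH[OF j(1) lin_diff[OF j(2) lin_scale[OF l(1), of c]] hg_diff[OF j(4)]] by blast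
    have wj: "inc c \<odot> wg j \<in> lin i" using lin_gel[OF j(1), of c] by (simp add: mono_gel)
    have "hom (ximg x) (inc c \<odot> wg j + g) - f
      = inc c \<odot> (x j - wg j - l) + (hom (ximg x) g - (f' - inc c \<odot> l))"
      unfolding hom_add[OF lin_el[OF wj] lin_el[OF g(1)]] j(3)
      by (simp add: hom_mult[OF good_ximg[OF tri_fam[OF x]]] hom_ximg_wg[OF tri_fam[OF x]] tm_diff_right)
    also have "\<dots> \<in> filt wl 2" by (intro filt_add filt_tm_left l(3) g(3))
    finally show ?thesis
      using lin_add[OF wj lin_mono[OF _ g(1)]] j(1) hg_add[OF j(5) g(2)] by (metis less_imp_le)
  qed
qed

text \<open>The substitution by \<open>v\<close> fixes leading parts, so subtracting the present
  error \<open>e\<close> from \<open>z\<close> replaces it by \<open>e\<close> minus its image,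
  which has longer words.\<close>

lemma unipotent_solve:
  assumes v: "fam v" "\<And>i. v i - wg i \<in> filt wl 2"
  shows "\<exists>z\<in>el (gensk 1). hg (dg i) z \<and> z - wg i \<in> filt wl 2 \<and> hom (ximg v) z = wg i"
proof -
  have v1: "v i \<in> filt wl 1" for i
    using filt_add[OF filt_le[OF v(2)[of i], of 1] wg_filt[of i]] by simp
  have "\<exists>z\<in>el (gensk 1). hg (dg i) z \<and> z - wg i \<in> filt wl 2 \<and> hom (ximg v) z - wg i \<in> filt wl (n + 2)" for n
  proof (induction n)
    case 0
    show ?case
      by (rule bexI[of _ "wg i"]) (use v(2)[of i] in \<open>simp_all add: hom_ximg_wg[OF v(1)] hg_gens wg_el numeral_2_eq_2\<close>)
  next
    case (Suc n)
    then obtain z where z: "z \<in> el (gensk 1)" "hg (dg i) z" "z - wg i \<in> filt wl 2"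
      "hom (ximg v) z - wg i \<in> filt wl (n + 2)" by blast
    define e where "e = hom (ximg v) z - wg i"
    have e: "e \<in> el (gensk 1)" "hg (dg i) e" "e \<in> filt wl (n + 2)"
      unfolding e_def using z
      by (auto intro!: el_diff hg_diff hom_ximg_el hom_ximg_hg v(1) wg_el hg_gens)
    have "hom (ximg v) e - hom gel e \<in> filt wl ((n + 2) + 1)"
      by (rule hom_diff_filt[OF e(1,3)]) (use v v1 wg_filt in \<open>auto simp: gensk_iff\<close>)
    then have "hom (ximg v) e - e \<in> filt wl (Suc n + 2)"
      using hom_gel_id[OF el_UNIV[OF e(1)]] by (simp add: One_nat_def)
    moreover have "hom (ximg v) (z - e) - wg i = - (hom (ximg v) e - e)"
      using hom_diff[OF z(1) e(1), of "ximg v"] by (simp add: e_def)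
    ultimately have "hom (ximg v) (z - e) - wg i \<in> filt wl (Suc n + 2)" by (simp only: filt_minus)
    moreover have "z - e - wg i \<in> filt wl 2"
      using filt_diff[OF z(3) filt_le[OF e(3), of 2]] by (simp add: algebra_simps)
    ultimately show ?case using el_diff[OF z(1) e(1)] hg_diff[OF z(2) e(2)] by blast
  qed
  \<comment> \<open>The error has degree \<open>dg i\<close>, so its lying in filtration level
    \<open>dg i + 2\<close> makes it zero.\<close>
  from this[of "dg i"] obtain z where z: "z \<in> el (gensk 1)" "hg (dg i) z" "z - wg i \<in> filt wl 2"
      "hom (ximg v) z - wg i \<in> filt wl (dg i + 2)" by blast
  have "hom (ximg v) z - wg i = 0"
    by (rule filt_degree_zero[OF _ z(4)]) (use z in \<open>auto intro!: hg_diff hom_ximg_hg v(1) hg_gens\<close>)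
  with z show ?thesis by auto
qed

text \<open>Two stages: \<open>y\<close> inverts the linear part, so that its image \<open>v\<close>
  under the substitution differs from the generators only by longer words; \<open>v\<close> is then
  inverted by \<open>unipotent_solve\<close>.\<close>

lemma tri_right_inverse:
  assumes x: "tri x"
  obtains x' where "tri x'" "\<And>i. hom (ximg x) (x' i) = wg i"
proof -
  note fx = tri_fam[OF x]
  have "\<exists>g\<in>lin i. hg (dg i) g \<and> x i - wg i - hom (ximg x) g \<in> filt wl 2" for i
  proof -
    obtain l where l: "l \<in> lin i" "hg (dg i) l" "x i - wg i - l \<in> filt wl 2"
      using x unfolding tri_def by blast
    obtain g where g: "g \<in> lin i" "hg (dg i) g" "hom (ximg x) g - l \<in> filt wl 2"
      using tri_solve_linear[OF x l(1,2)] by blast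
    have "x i - wg i - hom (ximg x) g = (x i - wg i - l) - (hom (ximg x) g - l)" by simp
    also have "\<dots> \<in> filt wl 2" by (rule filt_diff[OF l(3) g(3)])
    finally show ?thesis using g by blast
  qed
  then obtain g where g: "\<And>i. g i \<in> lin i" "\<And>i. hg (dg i) (g i)"
    "\<And>i. x i - wg i - hom (ximg x) (g i) \<in> filt wl 2" by metis
  define y where "y i = wg i - g i" for i
  have fy: "fam y"
    unfolding fam_def y_def using el_diff[OF wg_el lin_el[OF g(1)]] hg_diff[OF hg_gens(1) g(2)] by blast
  have y1: "y i \<in> filt wl 1" for i
    unfolding y_def by (intro filt_diff wg_filt lin_filt[OF g(1)])
  define v where "v i = hom (ximg x) (y i)" for i
  have fv: "fam v"
    unfolding fam_def v_def by (simp add: hom_ximg_el[OF fx] hom_ximg_hg[OF fx] fam_el[OF fy] fam_hg[OF fy])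
  have v2: "v i - wg i \<in> filt wl 2" for i
  proof -
    have "v i - wg i = x i - wg i - hom (ximg x) (g i)"
      using hom_diff[OF wg_el lin_el[OF g(1)], of "ximg x" i i] by (simp add: v_def y_def hom_ximg_wg[OF fx])
    then show ?thesis using g(3)[of i] by (simp only:)
  qed
  obtain z where z: "\<And>i. z i \<in> el (gensk 1)" "\<And>i. hg (dg i) (z i)" "\<And>i. z i - wg i \<in> filt wl 2"
    "\<And>i. hom (ximg v) (z i) = wg i"
    using unipotent_solve[OF fv v2] by metis
  define x' where "x' i = hom (ximg y) (z i)" for i
  have "x' i - wg i - (- g i) \<in> filt wl 2" for i
  proof -
    have "hom (ximg y) (z i - wg i) \<in> filt wl 2"
      by (rule hom_ximg_filt[OF el_diff[OF z(1) wg_el] z(3) y1])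
    then show ?thesis
      using hom_diff[OF z(1) wg_el, of "ximg y" i i]
      by (simp add: x'_def hom_ximg_wg[OF fy] y_def diff_diff_eq2 diff_add_eq)
  qed
  then have "\<exists>l\<in>lin i. hg (dg i) l \<and> x' i - wg i - l \<in> filt wl 2" for i
    using lin_minus[OF g(1)] hg_minus[OF g(2)] by (intro bexI[of _ "- g i"] conjI)
  then have "tri x'"
    unfolding tri_def fam_def
    using hom_ximg_el[OF fy z(1)] hom_ximg_hg[OF fy z(1,2)] by (simp add: x'_def)
  moreover have "hom (ximg x) (x' i) = wg i" for i
    unfolding x'_def hom_ximg_comp[OF fx fy z(1)] v_def[symmetric] by (rule z(4))
  ultimately show thesis using that by blast
qed

text \<open>The one-sided inverse is triangular again and so has a one-sided inverse itself; as in
  any monoid this one must be \<open>x\<close>.\<close>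

theorem tri_inverse:
  assumes x: "tri x"
  obtains x' where "tri x'" "\<And>i. hom (ximg x) (x' i) = wg i" "\<And>i. hom (ximg x') (x i) = wg i"
proof -
  obtain x' where x': "tri x'" "\<And>i. hom (ximg x) (x' i) = wg i" by (rule tri_right_inverse[OF x]) blast
  obtain x'' where x'': "tri x''" "\<And>i. hom (ximg x') (x'' i) = wg i" by (rule tri_right_inverse[OF x'(1)]) blast
  have "x i = x'' i" for i
  proof -
    have e: "x'' i \<in> el (gensk 1)" using fam_el[OF tri_fam[OF x''(1)]] .
    have "x i = hom (ximg x) (hom (ximg x') (x'' i))"
      by (simp add: x''(2) hom_ximg_wg[OF tri_fam[OF x]])
    also have "\<dots> = x'' i"
      unfolding hom_ximg_comp[OF tri_fam[OF x] tri_fam[OF x'(1)] e]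
      by (rule hom_ximg_id[OF e]) (simp add: x'(2))
    finally show ?thesis .
  qed
  then have "hom (ximg x') (x i) = wg i" for i using x''(2) by simp
  with x' show thesis using that by blast
qed

subsection \<open>Trivialising the differential\<close>

lemma mimg_scaled_gel: "mimg (\<lambda>x. inc (of_int k) \<odot> gel x) m = inc (of_int (k ^ size m)) \<odot> mimg gel m"
proof (induction m rule: multiset_induct_min)
  case (add x m)
  have "mimg (\<lambda>x. inc (of_int k) \<odot> gel x) (add_mset x m)
     = (inc (of_int k) \<odot> gel x) \<odot> (inc (of_int (k ^ size m)) \<odot> mimg gel m)"
    using add by (simp add: mimg_min)
  also have "\<dots> = inc (of_int k) \<odot> (inc (of_int (k ^ size m)) \<odot> (gel x \<odot> mimg gel m))"
    by (simp add: tm_assoc tm_inc_of_int_left[of "gel x"] del: of_int_power)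
  also have "\<dots> = inc (of_int (k ^ size (add_mset x m))) \<odot> (gel x \<odot> mimg gel m)"
    by (simp add: incl_mult flip: tm_assoc)
  finally show ?case using add by (simp add: mimg_min)
qed (simp add: incl_mult)

lemma size_eq_wt: "set_mset m \<subseteq> gensk k \<Longrightarrow> wt wl m = size m"
  by (induction m) (auto simp: gensk_iff)

lemma hom_scaled_gel_filt:
  assumes "f \<in> el (gensk 1)" "f \<in> filt wl n"
  shows "hom (\<lambda>x. inc (of_int k) \<odot> gel x) f - inc (of_int (k ^ n)) \<odot> f \<in> filt wl (Suc n)"
proof -
  let ?h = "hom (\<lambda>x. inc (of_int k) \<odot> gel x)"
  have hm: "?h g m = of_int (k ^ size m) * g m" if "g \<in> el (gensk 1)" for g m
    using that
  proof (induction g rule: el_induct)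
    case (add f g)
    have "?h (f + g) m = (?h f + ?h g) m" by (simp only: hom_add[OF add.hyps])
    also have "\<dots> = of_int (k ^ size m) * (f + g) m" by (simp only: plus_fun_apply add.IH distrib_left)
    finally show ?case .
  next
    case (mono b m')
    have "?h (mono b m') = inc b \<odot> (inc (of_int (k ^ size m')) \<odot> mono 1 m')"
      using mono by (simp add: hom_mono mimg_scaled_gel mimg_hom_gel)
    also have "\<dots> = mono (b * of_int (k ^ size m')) m'"
      using mono by (simp add: incl_mult flip: tm_assoc) (metis mono_eq_inc)
    finally show ?case by (auto simp: mono_def of_int_commute simp del: of_int_power)
  qed
  show ?thesis
  proof (rule filtI)
    fix m assume nz: "(?h f - inc (of_int (k ^ n)) \<odot> f) m \<noteq> 0"
    then have nz: "of_int (k ^ size m) * f m - of_int (k ^ n) * f m \<noteq> 0"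
      by (simp add: hm[OF assms(1)] inc_tm_apply[OF assms(1)] fun_pointwise del: of_int_power)
    then have f: "f m \<noteq> 0" by auto
    then have "wt wl m = size m" "n \<le> wt wl m"
      using size_eq_wt[of m 1] el_supp[OF assms(1) f] assms(2) by (auto simp: filt_def)
    moreover have "size m \<noteq> n" using nz by auto
    ultimately show "Suc n \<le> wt wl m" by simp
  qed
qed

text \<open>Two comparisons: \<open>p\<close> differs from exact doubling of the generators only by
  longer words, and exact doubling has eigenvalue \<open>2 ^ n\<close> on words of length
  \<open>n\<close>.\<close>

lemma doubling_filt:
  assumes p: "fam p" "\<And>i. p i - inc (of_int 2) \<odot> wg i \<in> filt wl 2"
    and f: "f \<in> el (gensk 1)" "f \<in> filt wl n"
  shows "hom (ximg p) f - inc (of_int (2 ^ n)) \<odot> f \<in> filt wl (Suc n)"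
proof -
  have p1: "p i \<in> filt wl 1" for i
    using filt_add[OF filt_le[OF p(2)[of i], of 1] filt_tm_left[OF wg_filt[of i], of "inc (of_int 2)"]] by simp
  have "hom (ximg p) f - hom (\<lambda>x. inc (of_int 2) \<odot> gel x) f \<in> filt wl (Suc n)"
    unfolding Suc_eq_plus1
    by (rule hom_diff_filt[OF f])
       (use p(2) p1 in \<open>auto simp: gensk_iff intro!: filt_tm_left gel_filt[of "Gn _ _" wl, simplified] intro: order_refl\<close>)
  from filt_add[OF this hom_scaled_gel_filt[OF f, of 2]] show ?thesis by simp
qed

text \<open>Linear cycles of even degree are linear boundaries, up to longer words. With
  \<open>c\<close> the coefficient of the last generator \<open>wg j\<close> in \<open>f\<close>,
  the coefficient of \<open>wg j\<close> in \<open>\<theta> f\<close> is \<open>dB c\<close>,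
  because \<open>\<theta> (wg j)\<close> and the remaining terms involve only earlier generators. So
  \<open>c\<close> is closed, has odd degree and equals some \<open>dB e\<close>, and subtracting
  \<open>\<theta> (inc e \<odot> wg j)\<close> leaves only earlier generators.\<close>

lemma kill_linear_part:
  assumes H: "odd_cohomology_vanishes bc dB"
    and d: "deriv \<theta>" and dhg: "\<And>p f. hg p f \<Longrightarrow> hg (Suc p) (\<theta> f)"
    and dfilt: "\<And>f n. f \<in> el (gensk 1) \<Longrightarrow> f \<in> filt wl n \<Longrightarrow> \<theta> f \<in> filt wl n"
    and dbelow: "\<And>i f. f \<in> el (gens_below i) \<Longrightarrow> \<theta> f \<in> el (gens_below i)"
    and dgen: "\<And>i. \<theta> (wg i) \<in> el (gens_below i)"
    and dd: "\<And>f. f \<in> el (gensk 1) \<Longrightarrow> \<theta> (\<theta> f) = 0"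
  shows "f \<in> lin i \<Longrightarrow> hg p f \<Longrightarrow> even p \<Longrightarrow> \<theta> f \<in> filt wl 2 \<Longrightarrow>
     \<exists>g\<in>lin i. hg (p - 1) g \<and> \<theta> g - f \<in> filt wl 2"
proof (induction i arbitrary: f rule: less_induct)
  case (less i)
  have u: "g \<in> el UNIV" if "g \<in> lin k" for g k using el_UNIV[OF lin_el[OF that]] .
  show ?case
  proof (cases "f = 0")
    case True
    then show ?thesis using deriv_zero[OF d] by (intro bexI[of _ 0]) auto
  next
    case False
    obtain j c f' where j: "j < i" "f' \<in> lin j" "f = inc c \<odot> wg j + f'" "hg p f'"
      "hg p (inc c \<odot> wg j)" "dg j \<le> p" "bc (p - dg j) c = c"
      by (rule lin_cases[OF less.prems(1) False]) (use less.prems(2) in blast)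
    have wu: "wg j \<in> el UNIV" by simp
    have below0: "h {#Gn 0 j#} = 0" if "h \<in> el (gens_below j)" for h
      using el_supp[OF that, of "{#Gn 0 j#}"] by (auto simp: gens_below_def)
    have dcw: "\<theta> (inc b \<odot> wg j) = inc (dB b) \<odot> wg j + inc (binv bc b) \<odot> \<theta> (wg j)" for b
      by (simp add: deriv_mult[OF d el_incl wu] deriv_incl[OF d] par_incl bet_def)
    have tw: "inc b \<odot> \<theta> (wg j) \<in> el (gens_below j)" for b by (intro el_tm el_incl dgen)
    have "\<theta> f = inc (dB c) \<odot> wg j + (inc (binv bc c) \<odot> \<theta> (wg j) + \<theta> f')"
      unfolding j(3) by (simp add: deriv_add[OF d el_tm[OF el_incl wu] u[OF j(2)]] dcw)
    moreover have "(inc (binv bc c) \<odot> \<theta> (wg j) + \<theta> f') {#Gn 0 j#} = 0"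
      by (rule below0[OF el_add[OF tw dbelow[OF lin_below[OF j(2)]]]])
    moreover have "\<theta> f {#Gn 0 j#} = 0" by (rule filtD[OF less.prems(4)]) simp
    moreover have "(inc (dB c) \<odot> wg j) {#Gn 0 j#} = dB c"
      unfolding inc_tm_apply[OF wu] by (simp add: gel_def)
    ultimately have "dB c = 0" by (simp add: plus_fun_apply)
    moreover have "odd (p - dg j)" using less.prems(3) odd_dg[of j] j(6) by simp
    ultimately obtain e where e: "bc (p - dg j - 1) e = e" "c = dB e"
      using H j(7) unfolding odd_cohomology_vanishes_def by blast
    define f2 where "f2 = f' - inc (binv bc e) \<odot> \<theta> (wg j)"
    have few: "hg (p - 1) (inc e \<odot> wg j)"
    proof -
      have "p - dg j - 1 + dg j = p - 1" using \<open>odd (p - dg j)\<close> j(6) by presburger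
      then show ?thesis using hg_mult[OF hg_incl[OF e(1)] hg_gens(1)[of j 0]] by simp
    qed
    have p1: "Suc (p - 1) = p" using j(6) dg_pos[of j] by simp
    have ff2: "f - \<theta> (inc e \<odot> wg j) = f2" unfolding dcw f2_def j(3) e(2) by simp
    have f2: "f2 \<in> el (gens_below j)" unfolding f2_def by (intro el_diff lin_below[OF j(2)] tw)
    have f2f: "f2 \<in> filt wl 1"
      unfolding f2_def by (intro filt_diff filt_tm_left lin_filt[OF j(2)] dfilt wg_el wg_filt)
    have f2h: "hg p f2"
      unfolding ff2[symmetric] by (rule hg_diff[OF less.prems(2) dhg[OF few, unfolded p1]])
    \<comment> \<open>\<open>\<theta> (wg j)\<close> may bring longer words into \<open>f2\<close>,
      so the induction is applied to its linear part; the difference lies in the filtration level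
      that the conclusion ignores.\<close>
    obtain l where l: "l \<in> lin j" "hg p l" "f2 - l \<in> filt wl 2"
      by (rule linear_part[OF f2 f2f f2h])
    have f2e: "f2 \<in> el (gensk 1)" by (rule el_mono[OF gens_below_subset f2])
    have ewu: "inc e \<odot> wg j \<in> el UNIV" "inc e \<odot> wg j \<in> el (gensk 1)" by (simp_all add: el_tm wg_el)
    have "\<theta> f2 = \<theta> f"
      unfolding ff2[symmetric] using deriv_diff[OF d u[OF less.prems(1)] deriv_el[OF d ewu(1)]]
      by (simp add: dd[OF ewu(2)])
    moreover have "\<theta> (f2 - l) \<in> filt wl 2" by (rule dfilt[OF el_diff[OF f2e lin_el[OF l(1)]] l(3)])
    ultimately have "\<theta> l \<in> filt wl 2"
      using deriv_diff[OF d el_UNIV[OF f2] u[OF l(1)]] filt_diff[OF less.prems(4), of "\<theta> (f2 - l)"] by simp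
    then obtain g where g: "g \<in> lin j" "hg (p - 1) g" "\<theta> g - l \<in> filt wl 2"
      using less.IH[OF j(1) l(1,2) less.prems(3)] by blast
    have "\<theta> (inc e \<odot> wg j + g) - f = (\<theta> g - l) - (f2 - l)"
      unfolding ff2[symmetric] deriv_add[OF d ewu(1) u[OF g(1)]] by simp
    also have "\<dots> \<in> filt wl 2" by (rule filt_diff[OF g(3) l(3)])
    finally have "\<theta> (inc e \<odot> wg j + g) - f \<in> filt wl 2" .
    moreover have "inc e \<odot> wg j + g \<in> lin i"
      using lin_add[OF lin_gel[OF j(1), of e] lin_mono[OF less_imp_le[OF j(1)] g(1)]] by (simp add: mono_gel)
    moreover have "hg (p - 1) (inc e \<odot> wg j + g)" by (rule hg_add[OF few g(2)])
    ultimately show ?thesis by blast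
  qed
qed

theorem closed_generators:
  assumes H: "odd_cohomology_vanishes bc dB"
    and d: "deriv \<theta>" and dhg: "\<And>p f. hg p f \<Longrightarrow> hg (Suc p) (\<theta> f)"
    and dfilt: "\<And>f n. f \<in> el (gensk 1) \<Longrightarrow> f \<in> filt wl n \<Longrightarrow> \<theta> f \<in> filt wl n"
    and dbelow: "\<And>i f. f \<in> el (gens_below i) \<Longrightarrow> \<theta> f \<in> el (gens_below i)"
    and dgen: "\<And>i. \<theta> (wg i) \<in> el (gens_below i)"
    and dd: "\<And>f. f \<in> el (gensk 1) \<Longrightarrow> \<theta> (\<theta> f) = 0"
    and del: "\<And>f. f \<in> el (gensk 1) \<Longrightarrow> \<theta> f \<in> el (gensk 1)"
    and p: "fam p" "\<And>i. p i - inc (of_int 2) \<odot> wg i \<in> filt wl 2"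
    and dp: "\<And>f. f \<in> el (gensk 1) \<Longrightarrow> \<theta> (hom (ximg p) f) = hom (ximg p) (\<theta> f)"
  obtains x where "tri x" "\<And>i. \<theta> (x i) = 0"
proof -
  have "\<exists>x. x \<in> el (gensk 1) \<and> hg (dg i) x \<and> \<theta> x = 0 \<and> (\<exists>l\<in>lin i. hg (dg i) l \<and> x - wg i - l \<in> filt wl 2)" for i
  proof -
    have wu: "wg i \<in> el UNIV" by simp
    obtain l where l: "l \<in> lin i" "hg (Suc (dg i)) l" "\<theta> (wg i) - l \<in> filt wl 2"
      by (rule linear_part[OF dgen dfilt[OF wg_el wg_filt] dhg[OF hg_gens(1)]])
    have lu: "l \<in> el UNIV" by (rule el_UNIV[OF lin_el[OF l(1)]])
    have "\<theta> (\<theta> (wg i) - l) \<in> filt wl 2"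
      by (rule dfilt[OF el_diff[OF el_mono[OF gens_below_subset dgen] lin_el[OF l(1)]] l(3)])
    then have "\<theta> l \<in> filt wl 2"
      using deriv_diff[OF d deriv_el[OF d wu] lu] dd[OF wg_el] filt_minus by fastforce
    moreover have "even (Suc (dg i))" using odd_dg by simp
    ultimately obtain g where g: "g \<in> lin i" "hg (Suc (dg i) - 1) g" "\<theta> g - l \<in> filt wl 2"
      using kill_linear_part[OF H d dhg dfilt dbelow dgen dd l(1,2)] by blast
    \<comment> \<open>Both \<open>\<theta> (wg i)\<close> and \<open>\<theta> g\<close> have linear
      part \<open>l\<close>, so the differential of \<open>y0\<close> starts in word length two,
      where the operators built from doubling can take over.\<close>
    define y0 where "y0 = wg i - g"
    have y0: "y0 \<in> el (gensk 1)" "hg (dg i) y0" "y0 \<in> filt wl 1"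
      unfolding y0_def
      using el_diff[OF wg_el lin_el[OF g(1)]] hg_diff[OF hg_gens(1), of i "g" 0] g(2)
        filt_diff[OF wg_filt lin_filt[OF g(1)]] by simp_all
    have "\<theta> y0 = (\<theta> (wg i) - l) - (\<theta> g - l)"
      unfolding y0_def using deriv_diff[OF d wu el_UNIV[OF lin_el[OF g(1)]]] by simp
    then have ty0: "\<theta> y0 \<in> filt wl 2" using filt_diff[OF l(3) g(3)] by simp
    have "\<exists>y\<in>el (gensk 1). hg (dg i) y \<and> y - y0 \<in> filt wl 2 \<and> \<theta> y \<in> filt wl (n + 2)" for n
    proof (induction n)
      case 0
      then show ?case using y0 ty0 by (intro bexI[of _ y0]) (auto simp: numeral_2_eq_2)
    next
      case (Suc n)
      then obtain y where y: "y \<in> el (gensk 1)" "hg (dg i) y" "y - y0 \<in> filt wl 2" "\<theta> y \<in> filt wl (n + 2)"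
        by blast
      \<comment> \<open>The differential of \<open>y\<close> starts in word length
        \<open>n + 2\<close>, where doubling has eigenvalue \<open>2 ^ (n + 2)\<close>;
        \<open>N\<close> is its difference from the eigenvalue 2 on linear words, and
        \<open>u\<close> inverts \<open>2 - 2 ^ (n + 2)\<close>.\<close>
      define N :: nat where "N = 2 ^ (n + 2) - 2"
      have "(2::nat) ^ (n + 2) = 4 * 2 ^ n" "(1::nat) \<le> 2 ^ n" by (simp_all add: power_add)
      then have N2: "(2::nat) ^ (n + 2) > 2" by linarith
      then have N: "N > 0" "int N = 2 ^ (n + 2) - 2" by (simp_all add: N_def of_nat_diff)
      define u where "u = - ninv N"
      have uN: "u * of_int (2 - 2 ^ (n + 2)) = 1"
      proof -
        have "of_int (2 - 2 ^ (n + 2)) = - (of_int (int N) :: 'b)" unfolding N(2) by simp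
        then show ?thesis using ninv(2)[OF N(1)] by (simp add: u_def)
      qed
      have u: "bc 0 u = u" "dB u = 0" "binv bc u = u"
        using ninv_homogeneous[OF N(1)] binv_ninv[OF N(1)] by (simp_all add: u_def bc_minus dB_minus binv_minus)
      let ?P = "hom (ximg p)"
      let ?k = "inc (of_int (2 ^ (n + 2)))"
      \<comment> \<open>The normalising factor \<open>u\<close> makes the operator the identity on
        the linear part, so the generator survives, while the leading part of
        \<open>\<theta> y\<close> is cancelled.\<close>
      define y' where "y' = inc u \<odot> (?P y - ?k \<odot> y)"
      have Pel: "?P y \<in> el (gensk 1)" "?k \<odot> y \<in> el (gensk 1)"
        using y(1) by (auto intro: hom_ximg_el p(1) el_tm)
      have y'e: "y' \<in> el (gensk 1)" unfolding y'_def by (intro el_tm el_incl el_diff Pel)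
      have b0: "bc 0 (of_int k) = of_int k" for k using bc_of_int[of 0 k 1] by (simp add: bc_one)
      have "hg (0 + dg i) (?k \<odot> y)" by (intro hg_mult hg_incl b0 y(2))
      then have "hg (0 + dg i) y'"
        unfolding y'_def by (intro hg_mult hg_incl u hg_diff hom_ximg_hg p(1) y) simp
      then have y'h: "hg (dg i) y'" by simp
      have "y \<in> filt wl 1" using filt_add[OF filt_le[OF y(3), of 1] y0(3)] by simp
      then have P2: "?P y - inc (of_int 2) \<odot> y \<in> filt wl 2"
        using doubling_filt[OF p y(1), of 1] by simp
      have "y' - y = inc u \<odot> (?P y - inc (of_int 2) \<odot> y)"
      proof -
        have "inc u \<odot> (inc (of_int (2 - 2 ^ (n + 2))) \<odot> y) = y"
          unfolding tm_assoc[symmetric] incl_mult uN by (rule inc_1_tm[OF y(1)])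
        moreover have "inc (of_int (2 - 2 ^ (n + 2))) \<odot> y = inc (of_int 2) \<odot> y - ?k \<odot> y"
          using tm_diff_left[of "inc (of_int 2)" ?k y] incl_add[of "of_int 2" "- of_int (2 ^ (n + 2))"]
          by (simp add: incl_minus)
        ultimately have "y = inc u \<odot> (inc (of_int 2) \<odot> y) - inc u \<odot> (?k \<odot> y)"
          by (simp add: tm_diff_right)
        then show ?thesis unfolding y'_def tm_diff_right by (simp add: algebra_simps)
      qed
      then have "y' - y \<in> filt wl 2" using filt_tm_left[OF P2] by simp
      then have y'y0: "y' - y0 \<in> filt wl 2" using filt_add[OF _ y(3)] by fastforce
      have dk: "dB (of_int k) = 0" "binv bc (of_int k) = of_int k" for k
        using dB_of_int[of k 1] bet_of_int[of "Suc 0" k] by (simp_all add: bet_def)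
      have tk: "\<theta> (inc (of_int K) \<odot> y) = inc (of_int K) \<odot> \<theta> y" for K
        by (simp add: deriv_mult[OF d el_incl el_UNIV[OF y(1)]] deriv_incl[OF d] dk par_incl bet_def)
      have "\<theta> y' = inc u \<odot> (?P (\<theta> y) - ?k \<odot> \<theta> y)"
        unfolding y'_def deriv_mult[OF d el_incl el_UNIV[OF el_diff[OF Pel]]] deriv_incl[OF d] u(2)
          deriv_diff[OF d el_UNIV[OF Pel(1)] el_UNIV[OF Pel(2)]] tk dp[OF y(1)] par_incl
        by (simp add: bet_def u)
      also have "\<dots> \<in> filt wl (Suc (n + 2))"
        by (intro filt_tm_left doubling_filt[OF p del[OF y(1)] y(4)])
      finally show ?case using y'e y'h y'y0 by auto
    qed
    from this[of "dg i"] obtain x where x: "x \<in> el (gensk 1)" "hg (dg i) x" "x - y0 \<in> filt wl 2" "\<theta> x \<in> filt wl (dg i + 2)"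
      by blast
    \<comment> \<open>The differential has degree \<open>Suc (dg i)\<close>, still below the
      filtration level \<open>dg i + 2\<close>.\<close>
    have "\<theta> x = 0" by (rule filt_degree_zero[OF dhg[OF x(2)] x(4)]) simp
    moreover have "x - wg i - (- g) \<in> filt wl 2" using x(3) by (simp add: y0_def algebra_simps)
    moreover have "hg (dg i) (- g)" using g(2) hg_minus by simp
    ultimately show ?thesis using x lin_minus[OF g(1)] by blast
  qed
  then obtain x where "\<And>i. x i \<in> el (gensk 1) \<and> hg (dg i) (x i) \<and> \<theta> (x i) = 0 \<and> (\<exists>l\<in>lin i. hg (dg i) l \<and> x i - wg i - l \<in> filt wl 2)"
    by metis
  then show thesis using that[of x] by (simp add: tri_def fam_def)
qed

end

section \<open>Words in the individual tensor factors\<close>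

abbreviation emb :: "nat \<Rightarrow> 'i multiset \<Rightarrow> 'i gen multiset" where
  "emb j m \<equiv> image_mset (Gn j) m"

lemma count_emb: "count (emb j m) (Gn j' i) = (if j = j' then count m i else 0)"
  by (induction m) auto

lemma emb_decompose:
  assumes "set_mset M \<subseteq> gensk 2"
  obtains m0 m1 where "M = emb 0 m0 + emb 1 m1"
proof -
  have "\<exists>m0 m1. M = emb 0 m0 + emb 1 m1" using assms
  proof (induction M)
    case empty
    then show ?case by (intro exI[of _ "{#}"]) simp
  next
    case (add x M)
    then obtain m0 m1 where M: "M = emb 0 m0 + emb 1 m1" by auto
    obtain j i where x: "x = Gn j i" "j < 2" using add.prems by (auto simp: gensk_def)
    show ?case
    proof (cases "j = 0")
      case True
      then have "add_mset x M = emb 0 (add_mset i m0) + emb 1 m1" using M x by simp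
      then show ?thesis by blast
    next
      case False
      then have "add_mset x M = emb 0 m0 + emb 1 (add_mset i m1)" using M x by (simp add: less_2_cases_iff)
      then show ?thesis by blast
    qed
  qed
  then show thesis using that by blast
qed

lemma emb_inj3:
  assumes "emb 0 a + emb 1 b + emb 2 c = emb 0 a' + emb 1 b' + emb 2 c'"
  shows "a = a'" "b = b'" "c = c'"
proof -
  have "count (emb 0 a + emb 1 b + emb 2 c) (Gn j i) = count (emb 0 a' + emb 1 b' + emb 2 c') (Gn j i)" for j i
    using assms by simp
  from this[of 0] this[of 1] this[of 2] show "a = a'" "b = b'" "c = c'"
    by (auto simp: count_emb intro!: multiset_eqI)
qed

fun wf :: "nat \<Rightarrow> 'i gen \<Rightarrow> nat" where
  "wf k (Gn j _) = (if j = k then 1 else 0)" | "wf k Tg = 0" | "wf k DTg = 0"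

context odd_ext begin

subsection \<open>Expansion of the standard comultiplication\<close>

text \<open>The shuffle sign for merging the words \<open>k\<close> and \<open>l\<close> inside one
  tensor factor. It is evaluated in factor 0 but is the same in every factor, the order of the
  letters being the same.\<close>

definition sg :: "'i multiset \<Rightarrow> 'i multiset \<Rightarrow> int" where
  "sg k l = msign dg (emb 0 k) (emb 0 l)"

lemma msign_emb_less: "j < j' \<Longrightarrow> msign dg (emb j k) (emb j' l) = 1"
  by (rule msign_eq_1) (auto simp: Gn_le_iff)

lemma valid_emb: "vld (emb j m) \<longleftrightarrow> (\<forall>i. count m i \<le> 1)"
proof
  assume v: "vld (emb j m)"
  show "\<forall>i. count m i \<le> 1"
  proof
    fix i
    have "count (emb j m) (Gn j i) \<le> 1" using v odd_dg unfolding valid_def by simp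
    then show "count m i \<le> 1" by (simp add: count_emb)
  qed
next
  assume c: "\<forall>i. count m i \<le> 1"
  have "count (emb j m) x \<le> 1" for x
  proof (cases "x \<in># emb j m")
    case True
    then obtain i where "x = Gn j i" by auto
    then show ?thesis using c by (simp add: count_emb)
  qed (simp only: not_in_iff le0)
  then show "vld (emb j m)" by (simp add: valid_def)
qed

lemma valid_emb_add: "j \<noteq> j' \<Longrightarrow> vld (emb j a + emb j' b) \<longleftrightarrow> vld (emb j a) \<and> vld (emb j' b)"
  by (auto simp: valid_add_iff)

lemma valid_emb_add3:
  "vld (emb 0 a + emb 1 b + emb 2 c) \<longleftrightarrow> vld (emb 0 a) \<and> vld (emb 1 b) \<and> vld (emb 2 c)"
  by (auto simp: valid_add_iff)

lemma valid_emb_disjoint: "vld (emb 0 (a + b)) \<longleftrightarrow> vld (emb 0 a) \<and> vld (emb 0 b) \<and> set_mset a \<inter> set_mset b = {}"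
  by (auto simp: valid_add_iff disjoint_iff odd_dg) (metis gdeg_simps(1) imageI odd_dg)

lemma mimg_rename:
  assumes "\<And>i. S (Gn s i) = gel (Gn j i)"
  shows "vld (emb s m) \<Longrightarrow> mimg S (emb s m) = mono 1 (emb j m)"
proof (induction m rule: multiset_induct_min)
  case empty
  then show ?case by (simp add: incl_eq_mono)
next
  case (add i m)
  have "vld (add_mset (Gn j i) (emb j m))" using add.prems valid_emb[of s "add_mset i m"] valid_emb[of j "add_mset i m"] by simp
  moreover have "\<forall>y\<in>#emb s m. Gn s i \<le> y" "msign dg {#Gn j i#} (emb j m) = 1"
    using add.hyps by (auto simp: Gn_le_iff intro!: msign_eq_1)
  moreover have "vld (emb s m)" using add.prems by (simp add: valid_add_mset_iff)
  ultimately show ?case using add.IH by (simp add: mimg_min assms gel_eq_mono mono_mult)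
qed

text \<open>The coproduct of a word in the exterior coalgebra: each letter goes to one of two
  adjacent factors, and the splitting carries its shuffle sign. The induction adds the least
  letter.\<close>

lemma mimg_split:
  assumes S: "\<And>i. S (Gn s i) = gel (Gn j i) + gel (Gn (Suc j) i)"
  shows "vld (emb s m) \<Longrightarrow> mimg S (emb s m) =
    (\<Sum>k\<in>{k. k \<subseteq># m}. mono (of_int (sg k (m - k))) (emb j k + emb (Suc j) (m - k)))"
proof (induction m rule: multiset_induct_min)
  case empty
  then show ?case by (simp add: incl_eq_mono sg_def)
next
  case (add i m)
  have vm: "vld (emb s m)" and im: "i \<notin># m" using add.prems by (auto simp: valid_add_mset_iff odd_dg)
  have min: "\<forall>y\<in>#emb s m. Gn s i \<le> y" using add.hyps by (auto simp: Gn_le_iff)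
  have sm: "\<And>x. x \<in># m \<Longrightarrow> i < x" using add.hyps im by (metis le_less)
  let ?t = "\<lambda>k l. mono (of_int (sg k l)) (emb j k + emb (Suc j) l)"
  \<comment> \<open>If the least letter goes to the left factor, it is already in front and no sign
    appears.\<close>
  have 1: "gel (Gn j i) \<odot> ?t k (m - k) = ?t (add_mset i k) (m - k)" if k: "k \<subseteq># m" for k
  proof -
    have ik: "i \<notin># k" "i \<notin># m - k" using im k by (auto dest: mset_subset_eqD in_diffD)
    have sk: "\<And>x. x \<in># k \<Longrightarrow> i < x" "\<And>x. x \<in># m - k \<Longrightarrow> i < x"
      using sm k by (auto dest: mset_subset_eqD in_diffD)
    have vk: "vld (emb 0 k)" "vld (emb 0 (m - k))"
      using vm valid_subset[of "emb s k" "emb s m"] valid_subset[of "emb s (m - k)" "emb s m"] k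
      by (simp_all add: valid_emb image_mset_subseteq_mono)
    have v: "vld (add_mset (Gn j i) (emb j k + emb (Suc j) (m - k)))"
      using vk ik by (simp add: valid_add_mset_iff valid_emb_add) (auto simp: valid_emb)
    have s: "msign dg {#Gn j i#} (emb j k + emb (Suc j) (m - k)) = 1"
      by (intro msign_eq_1) (auto simp: Gn_le_iff less_imp_le[OF sk(1)] less_imp_le[OF sk(2)])
    have "msign dg {#Gn 0 i#} (emb 0 (m - k)) = 1"
      by (intro msign_eq_1) (auto simp: Gn_le_iff less_imp_le[OF sk(1)] less_imp_le[OF sk(2)])
    moreover have "vld ({#Gn 0 i#} + emb 0 k)" using vk ik by (auto simp: valid_add_mset_iff)
    ultimately have "sg (add_mset i k) (m - k) = sg k (m - k)"
      using msign_add_left[of "{#Gn 0 i#}" "emb 0 k" "emb 0 (m - k)"] by (simp add: sg_def)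
    then show ?thesis using v s by (simp add: gel_eq_mono mono_mult)
  qed
  \<comment> \<open>If it goes to the right factor, it passes every letter of \<open>k\<close>; the
    sign \<open>(-1) ^ card (set_mset k)\<close> is also the change of the shuffle sign.\<close>
  have 2: "gel (Gn (Suc j) i) \<odot> ?t k (m - k) = ?t k (add_mset i m - k)" if k: "k \<subseteq># m" for k
  proof -
    have ik: "i \<notin># k" "i \<notin># m - k" using im k by (auto dest: mset_subset_eqD in_diffD)
    have sk: "\<And>x. x \<in># k \<Longrightarrow> i < x" "\<And>x. x \<in># m - k \<Longrightarrow> i < x"
      using sm k by (auto dest: mset_subset_eqD in_diffD)
    have vk: "vld (emb 0 k)" "vld (emb 0 (m - k))"
      using vm valid_subset[of "emb s k" "emb s m"] valid_subset[of "emb s (m - k)" "emb s m"] k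
      by (simp_all add: valid_emb image_mset_subseteq_mono)
    have d: "add_mset i m - k = add_mset i (m - k)"
      using k by (auto simp: multiset_eq_iff subseteq_mset_def Suc_diff_le)
    have v1: "vld (emb j k + emb (Suc j) (m - k))"
      using vk by (simp add: valid_emb_add) (auto simp: valid_emb)
    have v: "vld (add_mset (Gn (Suc j) i) (emb j k + emb (Suc j) (m - k)))"
      using v1 ik by (auto simp: valid_add_mset_iff)
    have "msign_pairs {#Gn (Suc j) i#} (emb j k) = (\<lambda>x. (Gn (Suc j) i, Gn j x)) ` set_mset k"
      by (auto simp: msign_pairs_def odd_dg Gn_less_iff)
    then have c1: "card (msign_pairs {#Gn (Suc j) i#} (emb j k)) = card (set_mset k)"
      by (simp add: card_image inj_on_def)
    have "msign_pairs (emb 0 k) {#Gn 0 i#} = (\<lambda>x. (Gn 0 x, Gn 0 i)) ` set_mset k"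
      using sk by (auto simp: msign_pairs_def odd_dg Gn_less_iff)
    then have c2: "card (msign_pairs (emb 0 k) {#Gn 0 i#}) = card (set_mset k)"
      by (simp add: card_image inj_on_def)
    have "msign dg {#Gn (Suc j) i#} (emb (Suc j) (m - k)) = 1"
      by (intro msign_eq_1) (auto simp: Gn_le_iff less_imp_le[OF sk(1)] less_imp_le[OF sk(2)])
    then have s: "msign dg {#Gn (Suc j) i#} (emb j k + emb (Suc j) (m - k)) = (-1) ^ card (set_mset k)"
      unfolding msign_add_right[OF v1] by (simp add: msign_eq c1)
    have "vld ({#Gn 0 i#} + emb 0 (m - k))" using vk ik by (auto simp: valid_add_mset_iff)
    from msign_add_right[OF this, of "emb 0 k"]
    have "sg k (add_mset i (m - k)) = (-1) ^ card (set_mset k) * sg k (m - k)"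
      by (simp add: sg_def msign_eq[of "emb 0 k" "{#Gn 0 i#}"] c2)
    then show ?thesis unfolding d using v s by (simp add: gel_eq_mono mono_mult)
  qed
  have "mimg S (emb s (add_mset i m)) = (gel (Gn j i) + gel (Gn (Suc j) i)) \<odot> (\<Sum>k\<in>{k. k \<subseteq># m}. ?t k (m - k))"
    using mimg_min[OF min, of S] add.IH[OF vm] by (simp add: S)
  also have "\<dots> = (\<Sum>k\<in>{k. k \<subseteq># m}. ?t (add_mset i k) (m - k)) + (\<Sum>k\<in>{k. k \<subseteq># m}. ?t k (add_mset i m - k))"
    unfolding tm_add_left tm_sum_right sum.distrib[symmetric]
    by (rule sum.cong[OF refl]) (simp only: mem_Collect_eq 1 2)
  also have "(\<Sum>k\<in>{k. k \<subseteq># m}. ?t (add_mset i k) (m - k)) = (\<Sum>k\<in>add_mset i ` {k. k \<subseteq># m}. ?t k (add_mset i m - k))"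
    by (subst sum.reindex) (auto simp: inj_on_def)
  \<comment> \<open>Every splitting of the longer word has \<open>i\<close> on exactly one side,
    since \<open>i\<close> does not occur in \<open>m\<close>.\<close>
  also have "(\<Sum>k\<in>add_mset i ` {k. k \<subseteq># m}. ?t k (add_mset i m - k)) + (\<Sum>k\<in>{k. k \<subseteq># m}. ?t k (add_mset i m - k))
    = (\<Sum>k\<in>{k. k \<subseteq># add_mset i m}. ?t k (add_mset i m - k))"
    unfolding submultisets_add add.commute[of "sum _ (add_mset i ` _)"]
    by (rule sum.union_disjoint[symmetric]) (use im in \<open>auto simp: finite_submultisets dest: mset_subset_eqD\<close>)
  finally show ?case .
qed

text \<open>\<open>split0\<close> and \<open>split1\<close> are the standard multiplication applied
  to the first and to the second of two factors; on one factor \<open>split0\<close> is the standard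
  multiplication itself. They are the leading parts of the actual maps.\<close>

definition split0 :: "'i gen \<Rightarrow> ('i, 'b) elt" where
  "split0 x = (case x of Gn j i \<Rightarrow> if j = 0 then gel (Gn 0 i) + gel (Gn 1 i) else gel (Gn 2 i) | _ \<Rightarrow> 0)"

definition split1 :: "'i gen \<Rightarrow> ('i, 'b) elt" where
  "split1 x = (case x of Gn j i \<Rightarrow> if j = 0 then gel (Gn 0 i) else gel (Gn 1 i) + gel (Gn 2 i) | _ \<Rightarrow> 0)"

lemma good_split: "good split0" "good split1"
  by (auto simp: good_def split0_def split1_def hg_gens intro!: el_add hg_add split: gen.split)

lemma inc_tm_mono: "vld m \<Longrightarrow> inc b \<odot> mono c m = mono (b * c) m"
  by (simp add: incl_eq_mono mono_mult)

lemma hom_split_mono: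
  assumes v: "vld (emb 0 m + emb 1 m')"
  shows "hom split0 (mono b (emb 0 m + emb 1 m')) =
      (\<Sum>k\<in>{k. k \<subseteq># m}. mono (b * of_int (sg k (m - k))) (emb 0 k + emb 1 (m - k) + emb 2 m'))"
    and "hom split1 (mono b (emb 0 m + emb 1 m')) =
      (\<Sum>k\<in>{k. k \<subseteq># m'}. mono (b * of_int (sg k (m' - k))) (emb 0 m + emb 1 k + emb 2 (m' - k)))"
proof -
  have vm: "vld (emb 0 m)" "vld (emb 1 m')" using v by (simp_all add: valid_emb_add)
  have vj: "vld (emb j k)" if "k \<subseteq># m \<or> k \<subseteq># m'" for j k
    using vm that valid_subset[of "emb 0 k" "emb 0 m"] valid_subset[of "emb 1 k" "emb 1 m'"]
    by (auto simp: valid_emb image_mset_subseteq_mono)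
  have s: "msign dg (emb 0 m) (emb 1 m') = 1" by (rule msign_emb_less) simp
  have e: "mimg S (emb 0 m + emb 1 m') = mimg S (emb 0 m) \<odot> mimg S (emb 1 m')" if "good S" for S
  proof -
    have "mimg S (emb 0 m) \<odot> mimg S (emb 1 m') = inc 1 \<odot> mimg S (emb 0 m + emb 1 m')"
      unfolding mimg_mult[OF that vm] using v s by simp
    then show ?thesis using inc_1_tm[OF mimg_good(1)[OF that]] by simp
  qed
  have a0: "mimg split0 (emb 0 m) = (\<Sum>k\<in>{k. k \<subseteq># m}. mono (of_int (sg k (m - k))) (emb 0 k + emb 1 (m - k)))"
    using mimg_split[of split0 0 0, OF _ vm(1)] by (simp add: split0_def One_nat_def)
  have a1: "mimg split0 (emb 1 m') = mono 1 (emb 2 m')"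
    by (rule mimg_rename[OF _ vm(2)]) (simp add: split0_def)
  have b0: "mimg split1 (emb 0 m) = mono 1 (emb 0 m)"
    by (rule mimg_rename[OF _ vm(1)]) (simp add: split1_def)
  have b1: "mimg split1 (emb 1 m') = (\<Sum>k\<in>{k. k \<subseteq># m'}. mono (of_int (sg k (m' - k))) (emb 1 k + emb 2 (m' - k)))"
    using mimg_split[of split1 1 1, OF _ vm(2)] by (simp add: split1_def numeral_2_eq_2 One_nat_def)
  have "hom split0 (mono b (emb 0 m + emb 1 m')) = inc b \<odot> (mimg split0 (emb 0 m) \<odot> mimg split0 (emb 1 m'))"
    by (simp add: hom_mono e[OF good_split(1)])
  also have "\<dots> = (\<Sum>k\<in>{k. k \<subseteq># m}. mono (b * of_int (sg k (m - k))) (emb 0 k + emb 1 (m - k) + emb 2 m'))"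
    unfolding a0 a1 tm_sum_left tm_sum_right
  proof (rule sum.cong[OF refl])
    fix k assume "k \<in> {k. k \<subseteq># m}"
    then have k: "k \<subseteq># m" "m - k \<subseteq># m" by simp_all
    then have v': "vld (emb 0 k + emb 1 (m - k) + emb 2 m')"
      using vj[of k] vj[of "m - k"] vj[of m'] by (simp add: valid_emb_add3)
    have "msign dg (emb 0 k + emb 1 (m - k)) (emb 2 m') = 1" by (rule msign_eq_1) (auto simp: Gn_le_iff)
    with v' show "inc b \<odot> (mono (of_int (sg k (m - k))) (emb 0 k + emb 1 (m - k)) \<odot> mono 1 (emb 2 m')) =
      mono (b * of_int (sg k (m - k))) (emb 0 k + emb 1 (m - k) + emb 2 m')"
      by (simp add: mono_mult inc_tm_mono)
  qed
  finally show "hom split0 (mono b (emb 0 m + emb 1 m')) =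
      (\<Sum>k\<in>{k. k \<subseteq># m}. mono (b * of_int (sg k (m - k))) (emb 0 k + emb 1 (m - k) + emb 2 m'))" .
  have "hom split1 (mono b (emb 0 m + emb 1 m')) = inc b \<odot> (mimg split1 (emb 0 m) \<odot> mimg split1 (emb 1 m'))"
    by (simp add: hom_mono e[OF good_split(2)])
  also have "\<dots> = (\<Sum>k\<in>{k. k \<subseteq># m'}. mono (b * of_int (sg k (m' - k))) (emb 0 m + emb 1 k + emb 2 (m' - k)))"
    unfolding b0 b1 tm_sum_right
  proof (rule sum.cong[OF refl])
    fix k assume "k \<in> {k. k \<subseteq># m'}"
    then have k: "k \<subseteq># m'" "m' - k \<subseteq># m'" by simp_all
    then have v': "vld (emb 0 m + emb 1 k + emb 2 (m' - k))"
      using vj[of k] vj[of "m' - k"] vj[of m] by (simp add: valid_emb_add3)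
    have "msign dg (emb 0 m) (emb 1 k + emb 2 (m' - k)) = 1" by (rule msign_eq_1) (auto simp: Gn_le_iff)
    with v' show "inc b \<odot> (mono 1 (emb 0 m) \<odot> mono (of_int (sg k (m' - k))) (emb 1 k + emb 2 (m' - k))) =
      mono (b * of_int (sg k (m' - k))) (emb 0 m + emb 1 k + emb 2 (m' - k))"
      by (simp add: mono_mult inc_tm_mono add.assoc)
  qed
  finally show "hom split1 (mono b (emb 0 m + emb 1 m')) =
      (\<Sum>k\<in>{k. k \<subseteq># m'}. mono (b * of_int (sg k (m' - k))) (emb 0 m + emb 1 k + emb 2 (m' - k)))" .
qed

lemma emb_add_eq_iff: "emb 0 a + emb 1 b = emb 0 a' + emb 1 b' \<longleftrightarrow> a = a' \<and> b = b'"
  using emb_inj3[of a b "{#}" a' b' "{#}"] by auto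

lemma emb_add3_eq_iff: "emb 0 a + emb 1 b + emb 2 c = emb 0 a' + emb 1 b' + emb 2 c' \<longleftrightarrow> a = a' \<and> b = b' \<and> c = c'"
  using emb_inj3[of a b c a' b' c'] by auto

text \<open>A word in three factors can come only from the word obtained by merging its first two
  parts, and from none if merging repeats a letter.\<close>

lemma split0_coefficient:
  assumes "f \<in> el (gensk 2)"
  shows "hom split0 f (emb 0 a + emb 1 b + emb 2 c) =
    (if vld (emb 0 (a + b)) then of_int (sg a b) * f (emb 0 (a + b) + emb 1 c) else 0)"
  using assms
proof (induction f rule: el_induct)
  case (add f g)
  have "hom split0 (f + g) (emb 0 a + emb 1 b + emb 2 c) = (hom split0 f + hom split0 g) (emb 0 a + emb 1 b + emb 2 c)"
    by (simp only: hom_add[OF add.hyps])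
  also have "\<dots> = (if vld (emb 0 (a + b)) then of_int (sg a b) * (f + g) (emb 0 (a + b) + emb 1 c) else 0)"
    unfolding plus_fun_apply add.IH
    by (cases "vld (emb 0 (a + b))") (simp_all only: if_True if_False distrib_left add_0_left)
  finally show ?case .
next
  case (mono x M)
  obtain m m' where M: "M = emb 0 m + emb 1 m'" by (rule emb_decompose[OF mono(2)])
  have "hom split0 (mono x M) (emb 0 a + emb 1 b + emb 2 c) =
    (\<Sum>k\<in>{k. k \<subseteq># m}. if k = a then if m = a + b \<and> m' = c then x * of_int (sg a b) else 0 else 0)"
    unfolding M hom_split_mono(1)[OF mono(1)[unfolded M]] sum_fun_apply
  proof (rule sum.cong[OF refl])
    fix k assume "k \<in> {k. k \<subseteq># m}"
    then have "m - k = b \<longleftrightarrow> m = k + b" by auto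
    then have "emb 0 a + emb 1 b + emb 2 c = emb 0 k + emb 1 (m - k) + emb 2 m' \<longleftrightarrow> k = a \<and> m = a + b \<and> m' = c"
      unfolding emb_add3_eq_iff by auto
    then show "mono (x * of_int (sg k (m - k))) (emb 0 k + emb 1 (m - k) + emb 2 m') (emb 0 a + emb 1 b + emb 2 c)
      = (if k = a then if m = a + b \<and> m' = c then x * of_int (sg a b) else 0 else 0)"
      unfolding mono_def by auto
  qed
  also have "\<dots> = (if m = a + b \<and> m' = c then x * of_int (sg a b) else 0)"
    by (simp add: finite_submultisets)
  also have "\<dots> = (if vld (emb 0 (a + b)) then of_int (sg a b) * mono x M (emb 0 (a + b) + emb 1 c) else 0)"
  proof -
    have "vld (emb 0 m)" using mono(1) by (simp add: M valid_emb_add)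
    then show ?thesis unfolding M mono_def emb_add_eq_iff by (auto simp: of_int_commute)
  qed
  finally show ?case .
qed

lemma split1_coefficient:
  assumes "f \<in> el (gensk 2)"
  shows "hom split1 f (emb 0 a + emb 1 b + emb 2 c) =
    (if vld (emb 0 (b + c)) then of_int (sg b c) * f (emb 0 a + emb 1 (b + c)) else 0)"
  using assms
proof (induction f rule: el_induct)
  case (add f g)
  have "hom split1 (f + g) (emb 0 a + emb 1 b + emb 2 c) = (hom split1 f + hom split1 g) (emb 0 a + emb 1 b + emb 2 c)"
    by (simp only: hom_add[OF add.hyps])
  also have "\<dots> = (if vld (emb 0 (b + c)) then of_int (sg b c) * (f + g) (emb 0 a + emb 1 (b + c)) else 0)"
    unfolding plus_fun_apply add.IH
    by (cases "vld (emb 0 (b + c))") (simp_all only: if_True if_False distrib_left add_0_left)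
  finally show ?case .
next
  case (mono x M)
  obtain m m' where M: "M = emb 0 m + emb 1 m'" by (rule emb_decompose[OF mono(2)])
  have "hom split1 (mono x M) (emb 0 a + emb 1 b + emb 2 c) =
    (\<Sum>k\<in>{k. k \<subseteq># m'}. if k = b then if m = a \<and> m' = b + c then x * of_int (sg b c) else 0 else 0)"
    unfolding M hom_split_mono(2)[OF mono(1)[unfolded M]] sum_fun_apply
  proof (rule sum.cong[OF refl])
    fix k assume "k \<in> {k. k \<subseteq># m'}"
    then have "m' - k = c \<longleftrightarrow> m' = k + c" by auto
    then have "emb 0 a + emb 1 b + emb 2 c = emb 0 m + emb 1 k + emb 2 (m' - k) \<longleftrightarrow> k = b \<and> m = a \<and> m' = b + c"
      unfolding emb_add3_eq_iff by auto
    then show "mono (x * of_int (sg k (m' - k))) (emb 0 m + emb 1 k + emb 2 (m' - k)) (emb 0 a + emb 1 b + emb 2 c)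
      = (if k = b then if m = a \<and> m' = b + c then x * of_int (sg b c) else 0 else 0)"
      unfolding mono_def by auto
  qed
  also have "\<dots> = (if m = a \<and> m' = b + c then x * of_int (sg b c) else 0)"
    by (simp add: finite_submultisets)
  also have "\<dots> = (if vld (emb 0 (b + c)) then of_int (sg b c) * mono x M (emb 0 a + emb 1 (b + c)) else 0)"
  proof -
    have "vld (emb 0 m')" using mono(1) by (simp add: M valid_emb_add valid_emb)
    then show ?thesis unfolding M mono_def emb_add_eq_iff by (auto simp: of_int_commute)
  qed
  finally show ?case .
qed

subsection \<open>Cobar 2-cocycles of word length at least three\<close>

text \<open>After multiplication by signs a cocycle satisfies r(a + b, c) = r(a, b + c) on disjoint
  multisets, so on words of length at least three all its values agree.\<close>
lemma cobar_cocycle: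
  fixes r :: "'i multiset \<Rightarrow> 'i multiset \<Rightarrow> 'b"
  assumes n: "3 \<le> n"
    and sub: "0 \<in> X" "\<And>x y. x \<in> X \<Longrightarrow> y \<in> X \<Longrightarrow> x - y \<in> X"
    and supp: "\<And>a b. r a b \<noteq> 0 \<Longrightarrow> vld (emb 0 a) \<and> vld (emb 0 b)"
    and coc: "\<And>a b c. a \<noteq> {#} \<Longrightarrow> b \<noteq> {#} \<Longrightarrow> c \<noteq> {#} \<Longrightarrow> size a + size b + size c = n \<Longrightarrow>
      (if vld (emb 0 (a + b)) then of_int (sg a b) * r (a + b) c else 0) -
      (if vld (emb 0 (b + c)) then of_int (sg b c) * r a (b + c) else 0) \<in> X"
    and ab: "a \<noteq> {#}" "b \<noteq> {#}" "size a + size b = n"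
  defines "v \<equiv> \<lambda>m. of_int (sg {#Min (set_mset m)#} (m - {#Min (set_mset m)#})) *
      r {#Min (set_mset m)#} (m - {#Min (set_mset m)#})"
  shows "r a b - (if vld (emb 0 (a + b)) then of_int (sg a b) * v (a + b) else 0) \<in> X"
proof -
  \<comment> \<open>\<open>X\<close> is thus an additive subgroup. In the application it consists of
    the exact coefficients, and working modulo \<open>X\<close> allows the cocycle identity to hold
    only up to such terms.\<close>
  have neg: "- x \<in> X" if "x \<in> X" for x using sub(2)[OF sub(1) that] by simp
  have add: "x + y \<in> X" if "x \<in> X" "y \<in> X" for x y using sub(2)[OF that(1) neg[OF that(2)]] by simp
  have scale: "of_int (sg k l) * x \<in> X" if "x \<in> X" for k l x
    using that neg[OF that] by (simp add: sg_def msign_eq minus_one_power_iff)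
  have sq: "of_int (sg k l) * (of_int (sg k l) * x) = (x :: 'b)" for k l x
    using msign_square[of "emb 0 k" "emb 0 l"] unfolding sg_def mult.assoc[symmetric] of_int_mult[symmetric]
    by simp
  \<comment> \<open>Twisting by the shuffle sign removes all signs from the cocycle identity on
    disjoint words, by \<open>msign_cocycle\<close>.\<close>
  define t where "t k l = of_int (sg k l) * r k l" for k l
  have shift: "t (a + b) c - t a (b + c) \<in> X"
    if "a \<noteq> {#}" "b \<noteq> {#}" "c \<noteq> {#}" "size a + size b + size c = n" "vld (emb 0 (a + b + c))" for a b c
  proof -
    have v: "vld (emb 0 a + emb 0 b + emb 0 c)" using that(5) by (simp add: add.assoc)
    have vv: "vld (emb 0 (a + b))" "vld (emb 0 (b + c))"
      using v by (auto simp: valid_add_iff)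
    have m: "sg (a + b) c * sg a b = sg a (b + c) * sg b c"
      using msign_cocycle[OF v] by (simp add: sg_def mult.commute)
    have "of_int (sg a b) * r (a + b) c - of_int (sg b c) * r a (b + c) \<in> X"
      using coc[OF that(1-4)] vv by simp
    then have "of_int (sg (a + b) c) * (of_int (sg a b) * (of_int (sg a b) * r (a + b) c - of_int (sg b c) * r a (b + c))) \<in> X"
      by (intro scale)
    also have "of_int (sg (a + b) c) * (of_int (sg a b) * (of_int (sg a b) * r (a + b) c - of_int (sg b c) * r a (b + c)))
      = t (a + b) c - of_int (sg (a + b) c * sg a b) * (of_int (sg b c) * r a (b + c))"
      unfolding right_diff_distrib sq t_def by (simp only: of_int_mult mult.assoc)
    also have "of_int (sg (a + b) c * sg a b) * (of_int (sg b c) * r a (b + c)) = t a (b + c)"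
      unfolding m t_def of_int_mult mult.assoc sq by (rule refl)
    finally show ?thesis .
  qed
  show ?thesis
  proof (cases "vld (emb 0 (a + b))")
    case False
    have "r a b \<in> X"
    proof (cases "r a b = 0")
      case nz: False
      have vab: "vld (emb 0 a)" "vld (emb 0 b)" using supp[OF nz] by auto
      then obtain i where i: "i \<in># a" "i \<in># b" using False unfolding valid_emb_disjoint by auto
      \<comment> \<open>Here \<open>n \<ge> 3\<close> enters: one of the words has a letter besides
        the common letter \<open>i\<close>. With \<open>i\<close> split off that word, one term of
        the cocycle identity would merge two copies of \<open>i\<close> and is zero; the other is
        \<open>r a b\<close> up to sign.\<close>
      have "size a \<ge> 2 \<or> size b \<ge> 2" using n ab(3) by linarith
      then show ?thesis
      proof
        assume s: "size b \<ge> 2"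
        define b' where "b' = b - {#i#}"
        have b: "b = {#i#} + b'" using i by (simp add: b'_def)
        then have ne: "b' \<noteq> {#}" using s by auto
        have "\<not> vld (emb 0 (a + {#i#}))" using i unfolding valid_emb_disjoint by auto
        moreover have "vld (emb 0 ({#i#} + b'))" using vab b by simp
        ultimately have "- (of_int (sg {#i#} b') * r a b) \<in> X"
          using coc[of a "{#i#}" b'] ab b ne by simp
        from scale[OF neg[OF this], of "{#i#}" b'] show ?thesis by (simp add: sq)
      next
        assume s: "size a \<ge> 2"
        define a' where "a' = a - {#i#}"
        have a: "a = a' + {#i#}" using i by (simp add: a'_def)
        then have ne: "a' \<noteq> {#}" using s by auto
        have "\<not> vld (emb 0 ({#i#} + b))" using i unfolding valid_emb_disjoint by auto
        moreover have "vld (emb 0 (a' + {#i#}))" using vab a by simp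
        ultimately have "of_int (sg a' {#i#}) * r a b \<in> X"
          using coc[of a' "{#i#}" b] ab a ne by simp
        from scale[OF this, of a' "{#i#}"] show ?thesis by (simp add: sq)
      qed
    qed (simp add: sub)
    then show ?thesis using False by simp
  next
    case True
    \<comment> \<open>Splitting off the least letter serves as the normal form of a splitting;
      \<open>v\<close> records the value there, and every other splitting is moved to it modulo
      \<open>X\<close>.\<close>
    define i where "i = Min (set_mset (a + b))"
    define m where "m = a + b - {#i#}"
    have "set_mset (a + b) \<noteq> {}" using ab by auto
    then have iab: "i \<in># a + b" unfolding i_def by (rule Min_in[OF finite_set_mset])
    have va: "v (a + b) = t {#i#} m" unfolding v_def t_def m_def i_def ..
    have "t a b - t {#i#} m \<in> X"
    proof (cases "i \<in># a")
      case ia: True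
      define a' where "a' = a - {#i#}"
      have a: "a = {#i#} + a'" using ia by (simp add: a'_def)
      have m: "m = a' + b" unfolding m_def a by simp
      show ?thesis
      proof (cases "a' = {#}")
        case True
        then show ?thesis unfolding a m by (simp add: sub)
      next
        case False
        then show ?thesis using shift[of "{#i#}" a' b] ab True unfolding m unfolding a by (simp add: add.assoc)
      qed
    next
      case False
      then have ib: "i \<in># b" using iab by simp
      define b' where "b' = b - {#i#}"
      have b: "b = b' + {#i#}" using ib by (simp add: b'_def)
      have m: "m = a + b'" unfolding m_def b by simp
      have vp: "vld (emb 0 (a + b' + {#i#}))" "vld (emb 0 ({#i#} + a + b'))" "vld (emb 0 (a + {#i#} + b'))"
        using True unfolding b by (simp_all add: ac_simps)
      show ?thesis
      proof (cases "b' = {#}")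
        case True
        text \<open>Here b = {i}; move a part of a across twice.\<close>
        then have "size a \<ge> 2" using ab n b by simp
        then obtain a1 a2 where a: "a = a1 + a2" "a1 \<noteq> {#}" "a2 \<noteq> {#}"
        proof -
          obtain x where x: "x \<in># a" using ab(1) by blast
          have "a - {#x#} \<noteq> {#}" using \<open>size a \<ge> 2\<close> x
            by (metis One_nat_def Suc_1 Suc_n_not_le_n insert_DiffM size_single)
          then show thesis using that[of "{#x#}" "a - {#x#}"] x by simp
        qed
        have sz: "size a1 + size a2 + size {#i#} = n" using ab a b True by simp
        have v0: "vld (emb 0 (a1 + a2 + {#i#}))" using vp(1) True a by simp
        have 1: "t (a1 + a2) {#i#} - t a1 (a2 + {#i#}) \<in> X" by (rule shift) (use a sz v0 in auto)
        have "t (a1 + {#i#}) a2 - t a1 ({#i#} + a2) \<in> X" by (rule shift) (use a sz v0 in \<open>auto simp: ac_simps\<close>)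
        then have 2: "t a1 (a2 + {#i#}) - t ({#i#} + a1) a2 \<in> X" using neg by (fastforce simp: ac_simps)
        have 3: "t ({#i#} + a1) a2 - t {#i#} (a1 + a2) \<in> X" by (rule shift) (use a sz v0 in \<open>auto simp: ac_simps\<close>)
        from add[OF 1 add[OF 2 3]] show ?thesis unfolding m b True a by simp
      next
        case False
        \<comment> \<open>First \<open>i\<close> is moved into the left word, then everything but
          \<open>i\<close> is moved to the right.\<close>
        have 1: "t (a + {#i#}) b' - t a ({#i#} + b') \<in> X"
          by (rule shift) (use ab b False vp in auto)
        have 2: "t ({#i#} + a) b' - t {#i#} (a + b') \<in> X"
          by (rule shift) (use ab b False vp in auto)
        from sub(2)[OF 2 1] show ?thesis unfolding m b by (simp add: ac_simps)
      qed
    qed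
    from scale[OF this, of a b] show ?thesis
      using True unfolding va right_diff_distrib by (simp add: t_def sq)
  qed
qed

end

context odd_ext begin

subsection \<open>Straightening the comultiplication\<close>

lemma D0_apply: "D0 dB f m = dB (f m)"
  by (simp add: D0_def)

lemma D0_el: "f \<in> el G \<Longrightarrow> D0 dB f \<in> el G"
proof -
  assume f: "f \<in> el G"
  have "{m. D0 dB f m \<noteq> 0} \<subseteq> {m. f m \<noteq> 0}" by (auto simp: D0_def)
  then have "finite {m. D0 dB f m \<noteq> 0}" by (rule finite_subset) (rule el_finite[OF f])
  moreover have "f m \<noteq> 0" if "D0 dB f m \<noteq> 0" for m using that by (auto simp: D0_def)
  ultimately show ?thesis using el_supp[OF f] by (auto simp: elems_def)
qed

lemma D0_filt: "f \<in> filt w n \<Longrightarrow> D0 dB f \<in> filt w n"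
  unfolding filt_def D0_def by clarsimp (metis dB_zero)

lemma D0_hg: "hg p f \<Longrightarrow> hg (Suc p) (D0 dB f)"
proof (rule hgI)
  fix m assume h: "hg p f" and "D0 dB f m \<noteq> 0"
  then have "f m \<noteq> 0" by (auto simp: D0_def)
  from hgD[OF h this] have "mdeg dg m \<le> p" "bc (p - mdeg dg m) (f m) = f m" by auto
  then show "mdeg dg m \<le> Suc p \<and> bc (Suc p - mdeg dg m) (D0 dB f m) = D0 dB f m"
    using bc_dB[of "p - mdeg dg m" "f m"] by (simp add: D0_def Suc_diff_le)
qed

lemma D0_D0: "D0 dB (D0 dB f) = 0"
  by (rule ext) (simp add: D0_def dB_dB fun_pointwise)

lemma D0_gel: "D0 dB (gel x) = 0"
  by (rule ext) (simp add: D0_def gel_def fun_pointwise)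

lemma D0_diff: "D0 dB (f - g) = D0 dB f - D0 dB g" and D0_add: "D0 dB (f + g) = D0 dB f + D0 dB g"
  and D0_zero: "D0 dB 0 = 0"
  by (rule ext, simp add: D0_def fun_pointwise dB_diff dB_add)+

lemma D0_hom:
  assumes "good img" "\<And>x. x \<in> G \<Longrightarrow> D0 dB (img x) = 0" "f \<in> el G"
  shows "D0 dB (hom img f) = hom img (D0 dB f)"
  by (rule deriv_hom_commute[OF deriv_D0 deriv_D0 assms(1,3)]) (simp add: assms(2) D0_gel)

text \<open>The elements all of whose words have a letter in each of the two factors, written with
  filtrations so that the estimates for algebra maps apply to it directly.\<close>

definition PP :: "('i, 'b) elt set" where
  "PP = el (gensk 2) \<inter> filt (wf 0) 1 \<inter> filt (wf 1) 1"

lemma PP_iff: "f \<in> PP \<longleftrightarrow> f \<in> el (gensk 2) \<and> f \<in> filt (wf 0) 1 \<and> f \<in> filt (wf 1) 1"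
  by (auto simp: PP_def)

lemma PP_add: "f \<in> PP \<Longrightarrow> g \<in> PP \<Longrightarrow> f + g \<in> PP"
  and PP_diff: "f \<in> PP \<Longrightarrow> g \<in> PP \<Longrightarrow> f - g \<in> PP"
  and PP_D0: "f \<in> PP \<Longrightarrow> D0 dB f \<in> PP"
  by (auto simp: PP_iff intro: el_add filt_add el_diff filt_diff D0_el D0_filt)

lemma wt_wf_le: "wt (wf 0) m + wt (wf 1) m \<le> wt wl m"
proof (induction m)
  case (add x m)
  have "wf 0 x + wf 1 x \<le> wl x" by (cases x) auto
  with add show ?case by simp
qed simp

lemma PP_filt: "f \<in> PP \<Longrightarrow> f \<in> filt wl 2"
proof (rule filtI)
  fix m assume "f \<in> PP" "f m \<noteq> 0"
  then have "1 \<le> wt (wf 0) m" "1 \<le> wt (wf 1) m" by (auto simp: PP_iff filt_def)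
  then show "2 \<le> wt wl m" using wt_wf_le[of m] by linarith
qed

lemma wt_emb: "wt wl (emb j m) = size m" "wt (wf k) (emb j m) = (if j = k then size m else 0)"
  by (induction m) auto

lemma mdeg_parity: "even (mdeg dg (emb 0 a + emb 1 b)) \<longleftrightarrow> even (size a + size b)"
proof -
  have "even (mdeg dg (emb j m)) \<longleftrightarrow> even (size m)" for j m
    by (induction m) (auto simp: odd_dg)
  then show ?thesis by simp
qed

text \<open>Primitives are chosen coefficient by coefficient and cut down to the correct degree. As
  \<open>z\<close> is supported inside the support of \<open>g\<close>, it is finitely supported and
  keeps support conditions such as membership in \<open>PP\<close>.\<close>

lemma exact_leading_part:
  assumes g: "g \<in> el G" "g \<in> filt wl n" "hg p g" and p: "p > 0"
    and ex: "\<And>m. wt wl m = n \<Longrightarrow> \<exists>y. g m = dB y"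
  obtains z where "z \<in> el G" "hg (p - 1) z" "\<And>m. z m \<noteq> 0 \<Longrightarrow> g m \<noteq> 0" "g - D0 dB z \<in> filt wl (Suc n)"
proof -
  have "\<exists>y. g m = dB y \<and> mdeg dg m \<le> p - 1 \<and> bc (p - 1 - mdeg dg m) y = y"
    if m: "wt wl m = n" "g m \<noteq> 0" for m
  proof -
    have h: "mdeg dg m \<le> p" "bc (p - mdeg dg m) (g m) = g m" using hgD[OF g(3) m(2)] by auto
    obtain y where y: "g m = dB y" using ex[OF m(1)] by blast
    \<comment> \<open>An exact element has no component of degree 0, so a nonzero exact coefficient
      has positive degree and leaves room for a primitive.\<close>
    have "p - mdeg dg m \<noteq> 0"
    proof
      assume "p - mdeg dg m = 0"
      then have "g m = 0" using h(2) bc_0_dB[of y] y by simp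
      with m(2) show False by simp
    qed
    then have s: "p - mdeg dg m = Suc (p - 1 - mdeg dg m)" using p by linarith
    \<comment> \<open>The primitive is replaced by its component of one degree less, which has the
      same differential because \<open>g m\<close> is homogeneous.\<close>
    have "g m = dB (bc (p - 1 - mdeg dg m) y)"
      using h(2) unfolding s y bc_dB by simp
    moreover have "mdeg dg m \<le> p - 1" using \<open>p - mdeg dg m \<noteq> 0\<close> by linarith
    ultimately show ?thesis by (intro exI[of _ "bc (p - 1 - mdeg dg m) y"]) (simp add: bc_bc)
  qed
  then obtain y where y: "\<And>m. wt wl m = n \<Longrightarrow> g m \<noteq> 0 \<Longrightarrow>
    g m = dB (y m) \<and> mdeg dg m \<le> p - 1 \<and> bc (p - 1 - mdeg dg m) (y m) = y m" by metis
  define z where "z m = (if wt wl m = n \<and> g m \<noteq> 0 then y m else 0)" for m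
  have zg: "g m \<noteq> 0" if "z m \<noteq> 0" for m using that by (auto simp: z_def split: if_splits)
  have "finite {m. z m \<noteq> 0}"
    by (rule finite_subset[OF _ el_finite[OF g(1)]]) (use zg in auto)
  then have "z \<in> el G" using zg el_supp[OF g(1)] by (auto simp: elems_def)
  moreover have "hg (p - 1) z"
    by (rule hgI) (use y in \<open>auto simp: z_def split: if_splits\<close>)
  moreover have "g - D0 dB z \<in> filt wl (Suc n)"
  proof (rule filtI)
    fix m assume nz: "(g - D0 dB z) m \<noteq> 0"
    have "wt wl m \<noteq> n"
    proof
      assume "wt wl m = n"
      then have "g m = dB (z m)" using y[of m] by (auto simp: z_def)
      then show False using nz by (simp add: D0_def fun_pointwise)
    qed
    moreover have "g m \<noteq> 0"
    proof
      assume "g m = 0"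
      then show False using nz by (simp add: D0_def z_def fun_pointwise)
    qed
    ultimately show "Suc n \<le> wt wl m" using g(2) by (force simp: filt_def)
  qed
  ultimately show thesis using that zg by blast
qed

lemma PP_subsupport: "f \<in> PP \<Longrightarrow> z \<in> el (gensk 2) \<Longrightarrow> (\<And>m. z m \<noteq> 0 \<Longrightarrow> f m \<noteq> 0) \<Longrightarrow> z \<in> PP"
  by (auto simp: PP_iff filt_def)

section \<open>Comultiplying one of two tensor factors, and the counit property\<close>

definition right_img :: "('i \<Rightarrow> ('i, 'b) elt) \<Rightarrow> 'i gen \<Rightarrow> ('i, 'b) elt" where
  "right_img c x = (case x of Gn j i \<Rightarrow> if j = 0 then c i else gel (Gn 2 i) | _ \<Rightarrow> 0)"

definition shift_img :: "'i gen \<Rightarrow> ('i, 'b) elt" where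
  "shift_img x = (case x of Gn j i \<Rightarrow> gel (Gn (Suc j) i) | Tg \<Rightarrow> gel Tg | DTg \<Rightarrow> gel DTg)"

definition left_img :: "('i \<Rightarrow> ('i, 'b) elt) \<Rightarrow> 'i gen \<Rightarrow> ('i, 'b) elt" where
  "left_img c x = (case x of Gn j i \<Rightarrow> if j = 0 then gel (Gn 0 i) else hom shift_img (c i) | _ \<Rightarrow> 0)"

lemma good_shift: "good shift_img"
  by (auto simp: good_def shift_img_def hg_gens One_nat_def split: gen.split)

definition fam2 :: "('i \<Rightarrow> ('i, 'b) elt) \<Rightarrow> bool" where
  "fam2 c \<longleftrightarrow> (\<forall>i. c i \<in> el (gensk 2) \<and> hg (dg i) (c i))"

lemma fam2_el: "fam2 c \<Longrightarrow> c i \<in> el (gensk 2)" and fam2_hg: "fam2 c \<Longrightarrow> hg (dg i) (c i)"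
  by (simp_all add: fam2_def)

lemma good_ximg2: "fam2 c \<Longrightarrow> good (ximg c)"
  by (auto simp: fam2_def good_def ximg_def intro: el_UNIV split: gen.split)

lemma good_right: "fam2 c \<Longrightarrow> good (right_img c)"
  by (auto simp: fam2_def good_def right_img_def hg_gens intro: el_UNIV split: gen.split)

lemma shift_el: "f \<in> el (gensk 2) \<Longrightarrow> hom shift_img f \<in> el {Gn j i |j i. 0 < j \<and> j < 3}"
  by (rule hom_el, assumption) (auto simp: gensk_iff shift_img_def)

lemma good_left: "fam2 c \<Longrightarrow> good (left_img c)"
proof -
  assume c: "fam2 c"
  have "hg (dg i) (hom shift_img (c i))" for i
    by (rule hom_hg[OF fam2_el[OF c] fam2_hg[OF c]]) (use good_shift in \<open>simp add: good_def\<close>)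
  then show ?thesis
    using el_UNIV[OF shift_el[OF fam2_el[OF c]]]
    by (auto simp: good_def left_img_def hg_gens split: gen.split)
qed

lemma hom_ximg2_el: "fam2 c \<Longrightarrow> f \<in> el (gensk 1) \<Longrightarrow> hom (ximg c) f \<in> el (gensk 2)"
  by (rule hom_el, assumption) (auto simp: gensk_iff fam2_el)

lemma hom_ximg2_hg: "fam2 c \<Longrightarrow> f \<in> el (gensk 1) \<Longrightarrow> hg p f \<Longrightarrow> hg p (hom (ximg c) f)"
  by (rule hom_hg, assumption, assumption) (auto simp: gensk_iff fam2_hg)

lemma right_first: "f \<in> el (gensk 1) \<Longrightarrow> hom (right_img c) f = hom (ximg c) f"
  by (rule hom_cong, assumption) (auto simp: gensk_iff right_img_def)

lemma left_first:
  assumes "f \<in> el (gensk 1)" shows "hom (left_img c) f = f"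
proof -
  have "hom (left_img c) f = hom gel f" by (rule hom_cong[OF assms]) (auto simp: gensk_iff left_img_def)
  then show ?thesis using hom_gel_id[OF el_UNIV[OF assms]] by simp
qed

lemma right_second:
  assumes c: "fam2 c" and f: "f \<in> el (gensk 1)"
  shows "hom (right_img c) (hom (cpy 1) f) = hom (cpy 2) f"
proof -
  have "hom (right_img c) (hom (cpy 1) f) = hom (\<lambda>g. hom (right_img c) (cpy 1 g)) f"
    by (rule hom_hom[OF good_right[OF c] good_cpy el_UNIV[OF f]])
  also have "\<dots> = hom (cpy 2) f"
    by (rule hom_cong[OF f]) (auto simp: gensk_iff cpy_def hom_gel_good[OF good_right[OF c]] right_img_def)
  finally show ?thesis .
qed

lemma left_second:
  assumes c: "fam2 c" and f: "f \<in> el (gensk 1)"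
  shows "hom (left_img c) (hom (cpy 1) f) = hom shift_img (hom (ximg c) f)"
proof -
  have "hom (left_img c) (hom (cpy 1) f) = hom (\<lambda>g. hom (left_img c) (cpy 1 g)) f"
    by (rule hom_hom[OF good_left[OF c] good_cpy el_UNIV[OF f]])
  also have "\<dots> = hom (\<lambda>g. hom shift_img (ximg c g)) f"
    by (rule hom_cong[OF f]) (auto simp: gensk_iff cpy_def hom_gel_good[OF good_left[OF c]] left_img_def)
  also have "\<dots> = hom shift_img (hom (ximg c) f)"
    by (rule hom_hom[OF good_shift good_ximg2[OF c] el_UNIV[OF f], symmetric])
  finally show ?thesis .
qed

lemma gel_wf: "gel (Gn j i) \<in> filt (wf j) 1"
  using gel_filt[of "Gn j i" "wf j"] by simp

lemma gel_wl: "gel (Gn j i) \<in> filt wl 1"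
  using gel_filt[of "Gn j i" wl] by simp

text \<open>The counit property. Modulo words with a letter in factor 1 the map
  \<open>hom (ximg c)\<close> is the inclusion as factor 0, and modulo words with a letter in factor
  0 it is the inclusion as factor 1. Having no constant term, \<open>f\<close> and its copy do not
  disturb the other comparison.\<close>

lemma comult_PP:
  assumes c: "fam2 c" and c_PP: "\<And>i. c i - gel (Gn 0 i) - gel (Gn 1 i) \<in> PP"
    and f: "f \<in> el (gensk 1)" "f \<in> filt wl 1"
  shows "hom (ximg c) f - f - hom (cpy 1) f \<in> PP"
proof -
  have id: "hom gel f = f" by (rule hom_gel_id[OF el_UNIV[OF f(1)]])
  \<comment> \<open>Zero weights on the source suffice: only the weight gained by exchanging
    generator images matters.\<close>
  have z: "f \<in> filt (\<lambda>_. 0) 0" by simp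
  have c0: "c i - gel (Gn 0 i) \<in> filt (wf 1) 1" for i
  proof -
    have "c i - gel (Gn 0 i) = (c i - gel (Gn 0 i) - gel (Gn 1 i)) + gel (Gn 1 i)" by simp
    also have "\<dots> \<in> filt (wf 1) 1" using c_PP[of i] by (intro filt_add gel_wf) (simp add: PP_iff)
    finally show ?thesis .
  qed
  have c1: "c i - gel (Gn 1 i) \<in> filt (wf 0) 1" for i
  proof -
    have "c i - gel (Gn 1 i) = (c i - gel (Gn 0 i) - gel (Gn 1 i)) + gel (Gn 0 i)" by simp
    also have "\<dots> \<in> filt (wf 0) 1" using c_PP[of i] by (intro filt_add gel_wf) (simp add: PP_iff)
    finally show ?thesis .
  qed
  have "hom (ximg c) f - hom gel f \<in> filt (wf 1) (0 + 1)"
    by (rule hom_diff_filt[OF f(1) z]) (auto simp: gensk_iff c0)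
  then have a: "hom (ximg c) f - f \<in> filt (wf 1) 1" by (simp add: id)
  have "hom (ximg c) f - hom (cpy 1) f \<in> filt (wf 0) (0 + 1)"
    by (rule hom_diff_filt[OF f(1) z]) (auto simp: gensk_iff cpy_def c1)
  then have b: "hom (ximg c) f - hom (cpy 1) f \<in> filt (wf 0) 1" by simp
  have "hom (cpy 1) f \<in> filt (wf 1) 1"
    by (rule hom_filt[OF f]) (auto simp: gensk_iff cpy_def gel_wf)
  from filt_diff[OF a this] have 1: "hom (ximg c) f - f - hom (cpy 1) f \<in> filt (wf 1) 1" .
  have "hom gel f \<in> filt (wf 0) 1"
    by (rule hom_filt[OF f]) (auto simp: gensk_iff gel_wf)
  from filt_diff[OF b this] have 2: "hom (ximg c) f - f - hom (cpy 1) f \<in> filt (wf 0) 1"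
    by (simp add: id algebra_simps)
  have "hom (cpy 1) f \<in> el (gensk 2)" using hom_cpy_el[OF f(1), of 1] by simp
  then have "hom (ximg c) f - f - hom (cpy 1) f \<in> el (gensk 2)"
    by (intro el_diff hom_ximg2_el[OF c f(1)] el_mono[OF gensk_mono f(1)]) simp_all
  with 1 2 show ?thesis by (simp add: PP_iff)
qed

end

section \<open>Making generators primitive up to exact terms\<close>

text \<open>With C the algebra map given by c on generators, right_img c and left_img c give the maps
  written C (x) 1 and 1 (x) C in the informal statement.\<close>
locale coassoc = odd_ext bc dB dg
  for bc :: "nat \<Rightarrow> 'b::ring_1 \<Rightarrow> 'b" and dB and dg :: "'i::wellorder \<Rightarrow> nat" +
  fixes c :: "'i \<Rightarrow> ('i, 'b) elt"
  assumes c: "fam2 c" and c_closed: "D0 dB (c i) = 0"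
    and c_PP: "c i - gel (Gn 0 i) - gel (Gn 1 i) \<in> PP"
    and coassoc: "f \<in> el (gensk 1) \<Longrightarrow> D0 dB f = 0 \<Longrightarrow>
      \<exists>h\<in>el (gensk 3). hom (right_img c) (hom (ximg c) f) - hom (left_img c) (hom (ximg c) f) = D0 dB h"
    and H_odd: "odd_cohomology_vanishes bc dB"
begin

abbreviation "cc \<equiv> hom (ximg c)"

lemmas c_el = fam2_el[OF c] and cc_el = hom_ximg2_el[OF c] and cc_hg = hom_ximg2_hg[OF c]
  and cc_PP = comult_PP[OF c c_PP]

lemma c_filt: "c i \<in> filt wl 1"
proof -
  have "c i = (c i - gel (Gn 0 i) - gel (Gn 1 i)) + gel (Gn 0 i) + gel (Gn 1 i)" by simp
  also have "\<dots> \<in> filt wl 1" by (intro filt_add gel_wl filt_le[OF PP_filt[OF c_PP]]) simp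
  finally show ?thesis .
qed

text \<open>On each generator the comultiplication differs from the standard one by an element of
  \<open>PP\<close>, whose words have length at least two.\<close>

lemma leading_cc:
  assumes "f \<in> el (gensk 1)" "f \<in> filt wl n"
  shows "cc f - hom split0 f \<in> filt wl (Suc n)"
  unfolding Suc_eq_plus1
proof (rule hom_diff_filt[OF assms])
  fix x :: "'i gen" assume "x \<in> gensk 1"
  then obtain i where x: "x = Gn 0 i" by (auto simp: gensk_iff)
  show "ximg c x \<in> filt wl (wl x)" by (simp add: x c_filt)
  show "split0 x \<in> filt wl (wl x)" by (simp add: x split0_def filt_add gel_wl)
  show "ximg c x - split0 x \<in> filt wl (wl x + 1)"
    using PP_filt[OF c_PP[of i]] by (simp add: x split0_def diff_diff_eq)
qed

lemma leading_right:
  assumes "f \<in> el (gensk 2)" "f \<in> filt wl n"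
  shows "hom (right_img c) f - hom split0 f \<in> filt wl (Suc n)"
  unfolding Suc_eq_plus1
proof (rule hom_diff_filt[OF assms])
  fix x :: "'i gen" assume "x \<in> gensk 2"
  then obtain i j where x: "x = Gn j i" by (auto simp: gensk_iff)
  show "right_img c x \<in> filt wl (wl x)" by (simp add: x c_filt right_img_def gel_wl)
  show "split0 x \<in> filt wl (wl x)" by (simp add: x split0_def filt_add gel_wl)
  show "right_img c x - split0 x \<in> filt wl (wl x + 1)"
    using PP_filt[OF c_PP[of i]] by (simp add: x split0_def right_img_def diff_diff_eq)
qed

lemma leading_left:
  assumes "f \<in> el (gensk 2)" "f \<in> filt wl n"
  shows "hom (left_img c) f - hom split1 f \<in> filt wl (Suc n)"
  unfolding Suc_eq_plus1
proof (rule hom_diff_filt[OF assms])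
  fix x :: "'i gen" assume "x \<in> gensk 2"
  then obtain i j where x: "x = Gn j i" by (auto simp: gensk_iff)
  have sh: "hom shift_img f \<in> filt wl n" if "f \<in> el (gensk 2)" "f \<in> filt wl n" for f n
    by (rule hom_filt[OF that]) (auto simp: gensk_iff shift_img_def gel_wl)
  show "left_img c x \<in> filt wl (wl x)" using sh[OF c_el c_filt] by (simp add: x left_img_def gel_wl)
  show "split1 x \<in> filt wl (wl x)" by (simp add: x split1_def filt_add gel_wl)
  have g2: "wg i \<in> el (gensk 2)" "gel (Gn 1 i) \<in> el (gensk 2)" by (simp_all add: gensk_iff)
  have "hom shift_img (c i - gel (Gn 0 i) - gel (Gn 1 i)) \<in> filt wl 2"
    using c_PP[of i] PP_filt by (intro sh) (auto simp: PP_iff)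
  moreover have "hom shift_img (c i - gel (Gn 0 i) - gel (Gn 1 i)) = hom shift_img (c i) - gel (Gn 1 i) - gel (Gn 2 i)"
    by (simp add: hom_diff[of _ "gensk 2"] el_diff c_el g2 hom_gel_good[OF good_shift] shift_img_def
        flip: One_nat_def)
  ultimately show "left_img c x - split1 x \<in> filt wl (wl x + 1)"
    by (simp add: x split1_def left_img_def diff_diff_eq)
qed

text \<open>Two corrections are available. Changing \<open>z\<close> removes a leading part with
  exact coefficients; changing \<open>x\<close> by \<open>V\<close> subtracts the reduced coproduct
  of \<open>V\<close> from the defect \<open>rr\<close>. For even \<open>n\<close> the first
  suffices, for odd \<open>n\<close> the second prepares the first.\<close>

lemma straighten_step:
  assumes n: "2 \<le> n"
    and x: "x \<in> el (gensk 1)" "hg (dg i) x" "x - wg i \<in> filt wl 2" "D0 dB x = 0"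
    and z: "z \<in> PP" "hg (dg i - 1) z"
    and r: "cc x - x - hom (cpy 1) x - D0 dB z \<in> filt wl n"
  shows "\<exists>x z. x \<in> el (gensk 1) \<and> hg (dg i) x \<and> x - wg i \<in> filt wl 2 \<and> D0 dB x = 0 \<and>
    z \<in> PP \<and> hg (dg i - 1) z \<and> cc x - x - hom (cpy 1) x - D0 dB z \<in> filt wl (Suc n)"
proof -
  define rr where "rr = cc x - x - hom (cpy 1) x - D0 dB z"
  have x1: "x \<in> filt wl 1"
  proof -
    have "x = (x - wg i) + wg i" by simp
    also have "\<dots> \<in> filt wl 1" by (intro filt_add wg_filt filt_le[OF x(3)]) simp
    finally show ?thesis .
  qed
  have dgs: "Suc (dg i - 1) = dg i" using dg_pos[of i] by simp
  have rPP: "rr \<in> PP" unfolding rr_def by (intro PP_diff[OF _ PP_D0[OF z(1)]] cc_PP x(1) x1)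
  have rel: "rr \<in> el (gensk 2)" using rPP by (simp add: PP_iff)
  have rhg: "hg (dg i) rr"
    unfolding rr_def using D0_hg[OF z(2)] dgs
    by (intro hg_diff cc_hg x hom_hg[OF x(1,2)]) (auto simp: gensk_iff cpy_def hg_gens)
  have cc0: "D0 dB (cc f) = 0" if "f \<in> el (gensk 1)" "D0 dB f = 0" for f
  proof -
    have "D0 dB (cc f) = cc (D0 dB f)"
      by (rule D0_hom[OF good_ximg2[OF c] _ that(1)]) (auto simp: gensk_iff c_closed)
    then show ?thesis using that(2) by simp
  qed
  have cpy0: "D0 dB (hom (cpy j) f) = hom (cpy j) (D0 dB f)" if "f \<in> el (gensk 1)" for f j
    by (rule D0_hom[OF good_cpy _ that]) (auto simp: gensk_iff cpy_def D0_gel)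
  have rcl: "D0 dB rr = 0"
    unfolding rr_def by (simp add: D0_diff D0_D0 cc0[OF x(1,4)] cpy0[OF x(1)] x(4))
  have rcl': "dB (rr m) = 0" for m using fun_cong[OF rcl, of m] by (simp add: D0_def fun_pointwise)
  show ?thesis
  proof (cases "even n")
    case True
    have "\<exists>y. rr m = dB y" if m: "wt wl m = n" for m
    proof (cases "rr m = 0")
      case True
      then show ?thesis by (intro exI[of _ 0]) simp
    next
      case False
      then obtain a b where ab: "m = emb 0 a + emb 1 b"
        using el_supp[OF rel] by (meson emb_decompose)
      have h: "mdeg dg m \<le> dg i" "bc (dg i - mdeg dg m) (rr m) = rr m" using hgD[OF rhg False] by auto
      have "even (mdeg dg m)" using \<open>even n\<close> m mdeg_parity[of a b] by (simp add: ab wt_emb)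
      then have "odd (dg i - mdeg dg m)" using odd_dg[of i] h(1) by simp
      then show ?thesis using H_odd h(2) rcl' unfolding odd_cohomology_vanishes_def by blast
    qed
    then obtain y where y: "y \<in> el (gensk 2)" "hg (dg i - 1) y" "\<And>m. y m \<noteq> 0 \<Longrightarrow> rr m \<noteq> 0"
      "rr - D0 dB y \<in> filt wl (Suc n)"
      using exact_leading_part[OF rel r[folded rr_def] rhg dg_pos] by blast
    have "y \<in> PP" by (rule PP_subsupport[OF rPP y(1,3)])
    moreover have "cc x - x - hom (cpy 1) x - D0 dB (z + y) = rr - D0 dB y"
      by (simp add: rr_def D0_add diff_diff_eq)
    ultimately show ?thesis using x z y by (metis PP_add hg_add)
  next
    case False
    \<comment> \<open>An odd \<open>n\<close> cannot be 2, the word length in which the cobar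
      complex has nontrivial classes of degree two.\<close>
    then have n3: "3 \<le> n" using n by (cases "n = 2") auto
    obtain h where h: "h \<in> el (gensk 3)"
      "hom (right_img c) (cc x) - hom (left_img c) (cc x) = D0 dB h" using coassoc[OF x(1,4)] by blast
    let ?R = "hom (right_img c)" and ?L = "hom (left_img c)"
    have zel: "z \<in> el (gensk 2)" using z(1) by (simp add: PP_iff)
    have x2: "x \<in> el (gensk 2)" by (rule el_mono[OF gensk_mono x(1)]) simp
    have xp: "hom (cpy 1) x \<in> el (gensk 2)" using hom_cpy_el[OF x(1), of 1] by simp
    have ccx: "cc x = x + hom (cpy 1) x + D0 dB z + rr" by (simp add: rr_def)
    have RL: "hom S (cc x) = hom S x + hom S (hom (cpy 1) x) + hom S (D0 dB z) + hom S rr" for S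
      unfolding ccx by (simp add: hom_add[of _ "gensk 2"] el_add x2 xp D0_el zel rel)
    note Rx = right_first[OF x(1), of c] and Lx = left_first[OF x(1), of c]
      and Rx' = right_second[OF c x(1)] and Lx' = left_second[OF c x(1)]
    have Rz: "?R (D0 dB z) = D0 dB (?R z)"
      by (rule D0_hom[OF good_right[OF c] _ zel, symmetric]) (auto simp: right_img_def c_closed D0_gel D0_zero split: gen.split)
    have Lz: "?L (D0 dB z) = D0 dB (?L z)"
    proof (rule D0_hom[OF good_left[OF c] _ zel, symmetric])
      have "D0 dB (hom shift_img (c i)) = 0" for i
      proof -
        have "D0 dB (hom shift_img (c i)) = hom shift_img (D0 dB (c i))"
          by (rule D0_hom[OF good_shift _ c_el]) (auto simp: gensk_iff shift_img_def D0_gel)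
        then show ?thesis by (simp add: c_closed)
      qed
      then show "D0 dB (left_img c g) = 0" for g
        by (auto simp: left_img_def D0_gel D0_zero split: gen.split)
    qed
    \<comment> \<open>The homotopy for associativity contributes \<open>D0 dB h\<close> and the
      correction \<open>z\<close> contributes its differential, so the cocycle identity for the
      coefficients of \<open>rr\<close> holds only modulo exact elements.\<close>
    define X where "X = range dB"
    have X0: "0 \<in> X" unfolding X_def by (rule range_eqI[of _ _ 0]) simp
    have Xd: "a - b \<in> X" if "a \<in> X" "b \<in> X" for a b
      using that unfolding X_def by (auto simp flip: dB_diff)
    define q where "q a b = rr (emb 0 a + emb 1 b)" for a b
    have qs: "vld (emb 0 a) \<and> vld (emb 0 b)" if "q a b \<noteq> 0" for a b
    proof -
      have "vld (emb 0 a + emb 1 b)" using el_supp[OF rel] that unfolding q_def by blast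
      then show ?thesis by (simp add: valid_emb_add valid_emb)
    qed
    have coc: "(if vld (emb 0 (a + b)) then of_int (sg a b) * q (a + b) c' else 0) -
      (if vld (emb 0 (b + c')) then of_int (sg b c') * q a (b + c') else 0) \<in> X"
      if ne: "a \<noteq> {#}" "b \<noteq> {#}" "c' \<noteq> {#}" and sz: "size a + size b + size c' = n" for a b c'
    proof -
      let ?M = "emb 0 a + emb 1 b + emb 2 c'"
      obtain i0 i2 where i0: "i0 \<in># a" and i2: "i2 \<in># c'" using ne by blast
      \<comment> \<open>The word \<open>?M\<close> has letters in all three factors. The terms
        coming from \<open>x\<close>, from its copies and from the comultiplication of a single copy
        each miss a factor and do not contribute, which leaves \<open>rr\<close> and exact
        terms.\<close>
      have g0: "f ?M = 0" if f: "f \<in> el G" "Gn 0 i0 \<notin> G \<or> Gn 2 i2 \<notin> G" for f G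
      proof (rule ccontr)
        assume "f ?M \<noteq> 0"
        then have "set_mset ?M \<subseteq> G" using el_supp[OF f(1)] by blast
        then show False using f(2) i0 i2 by auto
      qed
      have wtM: "wt wl ?M < Suc n" using sz by (simp add: wt_emb)
      have lead: "f ?M = g ?M" if "f - g \<in> filt wl (Suc n)" for f g
        using filtD[OF that wtM] by (simp add: fun_pointwise)
      have R: "?R rr ?M = (if vld (emb 0 (a + b)) then of_int (sg a b) * q (a + b) c' else 0)"
        unfolding lead[OF leading_right[OF rel r[folded rr_def]]] split0_coefficient[OF rel] q_def by (rule refl)
      have L: "?L rr ?M = (if vld (emb 0 (b + c')) then of_int (sg b c') * q a (b + c') else 0)"
        unfolding lead[OF leading_left[OF rel r[folded rr_def]]] split1_coefficient[OF rel] q_def by (rule refl)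
      have z1: "cc x ?M = 0" by (rule g0[OF cc_el[OF x(1)]]) (auto simp: gensk_iff)
      have z2: "x ?M = 0" by (rule g0[OF x(1)]) (auto simp: gensk_iff)
      have "hom (cpy 2) x \<in> el {Gn 2 i |i. True}"
        by (rule hom_el[OF x(1)]) (auto simp: gensk_iff cpy_def)
      then have z3: "hom (cpy 2) x ?M = 0" by (rule g0) auto
      have "hom shift_img (cc x) \<in> el {Gn j i |j i. 0 < j}"
        by (rule hom_el[OF cc_el[OF x(1)]]) (auto simp: gensk_iff shift_img_def)
      then have z4: "hom shift_img (cc x) ?M = 0" by (rule g0) auto
      have "(?R (cc x) - ?L (cc x)) ?M = dB (?R z ?M) + ?R rr ?M - (dB (?L z ?M) + ?L rr ?M)"
        unfolding RL[of "right_img c"] RL[of "left_img c"] Rx Rx' Rz Lx Lx' Lz by (simp only: plus_fun_apply minus_apply z1 z2 z3 z4 D0_apply add_0_left)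
      then have "?R rr ?M - ?L rr ?M = dB (h ?M) - dB (?R z ?M) + dB (?L z ?M)"
        unfolding h(2) D0_apply by (simp add: algebra_simps)
      also have "\<dots> = dB (h ?M - ?R z ?M + ?L z ?M)" by (simp only: dB_add dB_diff)
      finally show ?thesis unfolding R L X_def by simp
    qed
    define v where "v m = of_int (sg {#Min (set_mset m)#} (m - {#Min (set_mset m)#})) *
      q {#Min (set_mset m)#} (m - {#Min (set_mset m)#})" for m
    have key: "q a b - (if vld (emb 0 (a + b)) then of_int (sg a b) * v (a + b) else 0) \<in> X"
      if "a \<noteq> {#}" "b \<noteq> {#}" "size a + size b = n" for a b
      unfolding v_def by (rule cobar_cocycle[OF n3 X0 Xd qs coc that])
    define un :: "'i gen \<Rightarrow> 'i" where "un g = (case g of Gn _ i \<Rightarrow> i)" for g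
    \<comment> \<open>The cochain \<open>v\<close> as an element of one tensor factor, supported in
      word length \<open>n\<close>; its standard coproduct has the leading part of the defect as
      coefficients, modulo exact elements. The map \<open>un\<close> forgets the factor of a
      letter.\<close>
    define V where "V M = (if set_mset M \<subseteq> gensk 1 \<and> vld M \<and> size M = n then v (image_mset un M) else 0)" for M
    have un_emb: "image_mset un (emb j m) = m" for j m
      by (induction m) (auto simp: un_def)
    have Vemb: "V (emb 0 m) = (if vld (emb 0 m) \<and> size m = n then v m else 0)" for m
      unfolding V_def un_emb by (auto simp: gensk_iff)
    have Vsupp: "\<exists>m. M = emb 0 m \<and> rr (emb 0 {#Min (set_mset m)#} + emb 1 (m - {#Min (set_mset m)#})) \<noteq> 0
      \<and> m \<noteq> {#} \<and> size m = n \<and> vld M" if "V M \<noteq> 0" for M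
    proof -
      have M: "set_mset M \<subseteq> gensk 1" "vld M" "size M = n" "v (image_mset un M) \<noteq> 0"
        using that by (auto simp: V_def split: if_splits)
      have "M = emb 0 (image_mset un M)"
      proof -
        have "image_mset (\<lambda>x. Gn 0 (un x)) M = image_mset (\<lambda>x. x) M"
        proof (rule image_mset_cong)
          fix x assume "x \<in># M"
          then have "x \<in> gensk 1" using M(1) by blast
          then show "Gn 0 (un x) = x" by (auto simp: gensk_iff un_def)
        qed
        then show ?thesis by (simp add: multiset.map_comp o_def)
      qed
      moreover have "rr (emb 0 {#Min (set_mset m)#} + emb 1 (m - {#Min (set_mset m)#})) \<noteq> 0" if "v m \<noteq> 0" for m
        using that by (auto simp: v_def q_def)
      moreover have "image_mset un M \<noteq> {#}" using M(3) n3 by auto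
      ultimately show ?thesis using M by (metis size_image_mset)
    qed
    have Vel: "V \<in> el (gensk 1)"
    proof -
      let ?mg = "\<lambda>N. image_mset (\<lambda>g. Gn 0 (un g)) N"
      \<comment> \<open>A word in the support of \<open>V\<close> comes from a word in the support
        of \<open>rr\<close> by merging the two factors, so the support is finite.\<close>
      have "{M. V M \<noteq> 0} \<subseteq> ?mg ` {N. rr N \<noteq> 0}"
      proof
        fix M assume "M \<in> {M. V M \<noteq> 0}"
        then obtain m where m: "M = emb 0 m" "rr (emb 0 {#Min (set_mset m)#} + emb 1 (m - {#Min (set_mset m)#})) \<noteq> 0" "m \<noteq> {#}"
          using Vsupp by blast
        have "Min (set_mset m) \<in># m" using m(3) by (intro Min_in) auto
        then have "{#Min (set_mset m)#} + (m - {#Min (set_mset m)#}) = m" by simp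
        then have "emb 0 {#Min (set_mset m)#} + emb 0 (m - {#Min (set_mset m)#}) = M"
          unfolding image_mset_union[symmetric] m(1) by (rule arg_cong)
        then have "?mg (emb 0 {#Min (set_mset m)#} + emb 1 (m - {#Min (set_mset m)#})) = M"
          by (simp add: un_def multiset.map_comp o_def)
        then show "M \<in> ?mg ` {N. rr N \<noteq> 0}" using m(2) by (metis (mono_tags) image_eqI mem_Collect_eq)
      qed
      then have "finite {M. V M \<noteq> 0}" by (rule finite_subset) (simp add: el_finite[OF rel])
      then show ?thesis by (auto simp: elems_def V_def split: if_splits)
    qed
    have V2: "V \<in> el (gensk 2)" by (rule el_mono[OF gensk_mono Vel]) simp
    have Vcl: "D0 dB V = 0"
      by (rule ext) (auto simp: D0_def fun_pointwise V_def v_def q_def dB_of_int rcl')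
    have Vhg: "hg (dg i) V"
    proof (rule hgI)
      fix M assume nz: "V M \<noteq> 0"
      from Vsupp[OF nz] obtain m where m: "M = emb 0 m" "rr (emb 0 {#Min (set_mset m)#} + emb 1 (m - {#Min (set_mset m)#})) \<noteq> 0"
        "m \<noteq> {#}" "size m = n" "vld M" by blast
      let ?N = "emb 0 {#Min (set_mset m)#} + emb 1 (m - {#Min (set_mset m)#})"
      have mn: "Min (set_mset m) \<in># m" using m(3) by (intro Min_in) auto
      have me: "mdeg dg (emb j k) = sum_mset (image_mset dg k)" for j k
        by (induction k) auto
      \<comment> \<open>Moving letters to another factor keeps the degree, so \<open>V\<close>
        inherits its degree from \<open>rr\<close>.\<close>
      have "mdeg dg M = mdeg dg ?N"
        using arg_cong[OF insert_DiffM[OF mn], of "\<lambda>k. sum_mset (image_mset dg k)"]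
        unfolding m(1) mdeg_add me by (simp del: insert_DiffM insert_DiffM2)
      moreover have "V M = of_int (sg {#Min (set_mset m)#} (m - {#Min (set_mset m)#})) * rr ?N"
        using m by (simp add: Vemb v_def q_def)
      ultimately show "mdeg dg M \<le> dg i \<and> bc (dg i - mdeg dg M) (V M) = V M"
        using hgD[OF rhg m(2)] by (simp add: bc_of_int)
    qed
    have Vf: "V \<in> filt wl n"
      by (rule filtI) (use Vsupp wt_emb(1) in force)
    define x2 where "x2 = x - V"
    have x2el: "x2 \<in> el (gensk 1)" unfolding x2_def by (rule el_diff[OF x(1) Vel])
    have x2hg: "hg (dg i) x2" unfolding x2_def by (rule hg_diff[OF x(2) Vhg])
    have "x2 - wg i = x - wg i - V" by (simp add: x2_def algebra_simps)
    then have x2w: "x2 - wg i \<in> filt wl 2"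
      using filt_diff[OF x(3) filt_le[OF Vf n]] by (simp only:)
    have x2cl: "D0 dB x2 = 0" by (simp add: x2_def D0_diff x(4) Vcl)
    define s where "s = cc x2 - x2 - hom (cpy 1) x2 - D0 dB z"
    have seq: "s = rr - (cc V - V - hom (cpy 1) V)"
      unfolding s_def rr_def x2_def by (simp add: hom_diff[OF x(1) Vel])
    have V1: "V \<in> filt wl 1" by (rule filt_le[OF Vf]) (use n in simp)
    have sPP: "s \<in> PP" unfolding seq by (intro PP_diff rPP cc_PP Vel V1)
    have sel: "s \<in> el (gensk 2)" using sPP by (simp add: PP_iff)
    have shg: "hg (dg i) s"
      unfolding seq by (intro hg_diff rhg cc_hg Vel Vhg hom_hg[OF Vel Vhg]) (auto simp: gensk_iff cpy_def hg_gens)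
    have sf: "s \<in> filt wl n"
    proof -
      have "cc V \<in> filt wl n" by (rule hom_filt[OF Vel Vf]) (auto simp: gensk_iff c_filt)
      moreover have "hom (cpy 1) V \<in> filt wl n" by (rule hom_filt[OF Vel Vf]) (auto simp: gensk_iff cpy_def gel_wl)
      ultimately show ?thesis unfolding seq using r[folded rr_def] Vf by (intro filt_diff)
    qed
    have "\<exists>y. s m = dB y" if m: "wt wl m = n" for m
    proof (cases "s m = 0")
      case True
      then show ?thesis by (intro exI[of _ 0]) simp
    next
      case False
      then obtain a b where ab: "m = emb 0 a + emb 1 b"
        using el_supp[OF sel] by (meson emb_decompose)
      have ne: "a \<noteq> {#}" "b \<noteq> {#}" using sPP False by (auto simp: PP_iff filt_def ab wt_emb)
      then obtain i0 i1 where i0: "i0 \<in># a" and i1: "i1 \<in># b" by blast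
      have sz: "size a + size b = n" using m by (simp add: ab wt_emb)
      \<comment> \<open>Since \<open>m\<close> has letters in both factors, \<open>V\<close> and its
        copy do not contribute, and only the coproduct of \<open>V\<close> enters the new
        coefficient.\<close>
      have "V m = 0" using i1 by (auto simp: V_def ab gensk_iff)
      moreover have "hom (cpy 1) V m = 0"
      proof (rule ccontr)
        assume nz: "hom (cpy 1) V m \<noteq> 0"
        have "hom (cpy 1) V \<in> el {Gn 1 i |i. True}"
          by (rule hom_el[OF Vel]) (auto simp: gensk_iff cpy_def)
        from el_supp[OF this nz] show False using i0 by (auto simp: ab)
      qed
      moreover have "cc V m = (if vld (emb 0 (a + b)) then of_int (sg a b) * v (a + b) else 0)"
      proof -
        have "(cc V - hom split0 V) m = 0" by (rule filtD[OF leading_cc[OF Vel Vf]]) (simp add: m)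
        then have "cc V m = hom split0 V (emb 0 a + emb 1 b + emb 2 {#})" by (simp add: fun_pointwise ab)
        also have "\<dots> = (if vld (emb 0 (a + b)) then of_int (sg a b) * V (emb 0 (a + b)) else 0)"
          using split0_coefficient[OF V2, of a b "{#}"] by simp
        also have "\<dots> = (if vld (emb 0 (a + b)) then of_int (sg a b) * v (a + b) else 0)"
          unfolding Vemb using sz by (simp only: size_union if_True simp_thms cong: if_cong)
        finally show ?thesis .
      qed
      ultimately have "s m = q a b - (if vld (emb 0 (a + b)) then of_int (sg a b) * v (a + b) else 0)"
        unfolding seq by (simp add: fun_pointwise q_def ab)
      then show ?thesis using key[OF ne sz] by (auto simp: X_def)
    qed
    then obtain y where y: "y \<in> el (gensk 2)" "hg (dg i - 1) y" "\<And>m. y m \<noteq> 0 \<Longrightarrow> s m \<noteq> 0"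
      "s - D0 dB y \<in> filt wl (Suc n)"
      using exact_leading_part[OF sel sf shg dg_pos] by blast
    have "y \<in> PP" by (rule PP_subsupport[OF sPP y(1,3)])
    moreover have "cc x2 - x2 - hom (cpy 1) x2 - D0 dB (z + y) = s - D0 dB y"
      by (simp add: s_def D0_add diff_diff_eq)
    ultimately show ?thesis using x2el x2hg x2w x2cl z y by (metis PP_add hg_add)
  qed
qed

theorem primitive_generators:
  obtains x z where "fam x" "\<And>i. x i - wg i \<in> filt wl 2" "\<And>i. D0 dB (x i) = 0"
    "\<And>i. z i \<in> PP" "\<And>i. hg (dg i - 1) (z i)"
    "\<And>i. cc (x i) - x i - hom (cpy 1) (x i) = D0 dB (z i)"
proof -
  have ex: "\<exists>x z. x \<in> el (gensk 1) \<and> hg (dg i) x \<and> x - wg i \<in> filt wl 2 \<and> D0 dB x = 0 \<and>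
    z \<in> PP \<and> hg (dg i - 1) z \<and> cc x - x - hom (cpy 1) x - D0 dB z \<in> filt wl (n + 2)" for i n
  proof (induction n)
    case 0
    \<comment> \<open>The corrections start from the given generator with \<open>z = 0\<close>; the
      defect in \<open>PP\<close> has word length at least two.\<close>
    have "cc (wg i) - wg i - hom (cpy 1) (wg i) \<in> PP" by (rule cc_PP[OF wg_el wg_filt])
    then have "cc (wg i) - wg i - hom (cpy 1) (wg i) - D0 dB 0 \<in> filt wl (0 + 2)"
      using PP_filt by (simp only: D0_zero diff_zero add_0_left)
    moreover have "0 \<in> PP" by (simp add: PP_iff)
    ultimately show ?case using wg_el hg_gens(1)[of i 0] D0_gel[of "Gn 0 i"] hg_zero
      by (metis diff_self filt_zero)
  next
    case (Suc n)
    then show ?case using straighten_step[of "n + 2"] by auto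
  qed
  have "\<exists>x z. x \<in> el (gensk 1) \<and> hg (dg i) x \<and> x - wg i \<in> filt wl 2 \<and> D0 dB x = 0 \<and>
    z \<in> PP \<and> hg (dg i - 1) z \<and> cc x - x - hom (cpy 1) x = D0 dB z" for i
  proof -
    \<comment> \<open>Level \<open>dg i + 2\<close> exceeds the degree \<open>dg i\<close> of the
      remaining defect, which is therefore zero.\<close>
    obtain x z where xz: "x \<in> el (gensk 1)" "hg (dg i) x" "x - wg i \<in> filt wl 2" "D0 dB x = 0"
      "z \<in> PP" "hg (dg i - 1) z" "cc x - x - hom (cpy 1) x - D0 dB z \<in> filt wl (dg i + 2)"
      using ex[of i "dg i"] by blast
    have "hg (Suc (dg i - 1)) (D0 dB z)" by (rule D0_hg[OF xz(6)])
    then have dz: "hg (dg i) (D0 dB z)" using dg_pos[of i] by simp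
    have "hg (dg i) (cc x - x - hom (cpy 1) x - D0 dB z)"
      by (intro hg_diff cc_hg xz(1,2) dz hom_hg[OF xz(1,2)]) (auto simp: gensk_iff cpy_def hg_gens)
    then have "cc x - x - hom (cpy 1) x - D0 dB z = 0"
      by (rule filt_degree_zero[OF _ xz(7)]) simp
    then show ?thesis using xz by (metis eq_iff_diff_eq_0)
  qed
  then obtain x z where "\<And>i. x i \<in> el (gensk 1) \<and> hg (dg i) (x i) \<and> x i - wg i \<in> filt wl 2 \<and> D0 dB (x i) = 0 \<and>
    z i \<in> PP \<and> hg (dg i - 1) (z i) \<and> cc (x i) - x i - hom (cpy 1) (x i) = D0 dB (z i)"
    by metis
  then show thesis using that[of x z] by (simp add: fam_def)
qed

end

context odd_ext begin

subsection \<open>Maps of relative models as algebra extensions\<close>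

lemma comp_add: "comp dg bc n (f + g) = comp dg bc n f + comp dg bc n g"
  by (rule ext) (simp add: comp_def bc_add fun_pointwise)

lemma comp_hg: "hg p f \<Longrightarrow> comp dg bc n f = (if n = p then f else 0)"
proof (rule ext)
  fix m assume h: "hg p f"
  show "comp dg bc n f m = (if n = p then f else 0) m"
  proof (cases "f m = 0")
    case True
    then show ?thesis by (simp add: comp_def fun_pointwise)
  next
    case False
    from hgD[OF h this] have "mdeg dg m \<le> p" "bc (p - mdeg dg m) (f m) = f m" by auto
    then show ?thesis
      using bc_bc[of "n - mdeg dg m" "p - mdeg dg m" "f m"] by (auto simp: comp_def fun_pointwise)
  qed
qed

text \<open>Rational scalars act as base coefficients, so maps that fix the base and are
  multiplicative respect them.\<close>

lemma qsm_eq: "f \<in> el G \<Longrightarrow> qsm q f = inc (qsc q 1) \<odot> f"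
  by (rule ext) (simp add: qsm_def inc_tm_apply qsc_mult[of q "f _"])

lemma hom_dgmap:
  assumes g: "good img" and el: "\<And>x. x \<in> gensk 1 \<Longrightarrow> img x \<in> el G"
    and d: "\<And>f. f \<in> el (gensk 1) \<Longrightarrow> hom img (D1 f) = D2 (hom img f)"
  shows "dgmap dg bc (el (gensk 1)) D1 (el G) D2 (hom img)"
  unfolding dgmap_def
proof (intro conjI ballI allI)
  fix f assume f: "f \<in> el (gensk 1)"
  have fu: "f \<in> el UNIV" by (rule el_UNIV[OF f])
  show hf: "hom img f \<in> el G" by (rule hom_el[OF f el])
  show "hom img (D1 f) = D2 (hom img f)" by (rule d[OF f])
  show "hom img (qsm q f) = qsm q (hom img f)" for q
    unfolding qsm_eq[OF f] qsm_eq[OF hf] using hom_mult[OF g el_incl fu] by simp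
  show "hom img (comp dg bc n f) = comp dg bc n (hom img f)" for n
    using f
  proof (induction f rule: el_induct_homogeneous)
    case (add a b)
    have e: "comp dg bc n h \<in> el (gensk 1)" if "h \<in> el (gensk 1)" for h
    proof -
      have "{m. comp dg bc n h m \<noteq> 0} \<subseteq> {m. h m \<noteq> 0}" by (auto simp: comp_def split: if_splits)
      then have "finite {m. comp dg bc n h m \<noteq> 0}" by (rule finite_subset) (rule el_finite[OF that])
      moreover have "h m \<noteq> 0" if "comp dg bc n h m \<noteq> 0" for m
        using that by (auto simp: comp_def split: if_splits)
      ultimately show ?thesis using el_supp[OF that] by (auto simp: elems_def)
    qed
    show ?case
      unfolding comp_add hom_add[OF add.hyps] hom_add[OF e[OF add.hyps(1)] e[OF add.hyps(2)]] add.IH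
      by (rule refl)
  next
    case (mono b m q)
    have "hg (q + mdeg dg m) (hom img (mono b m))"
      unfolding hom_mono by (intro hg_mult hg_incl mono(1) mimg_good(2)[OF g])
    then show ?case using comp_hg[OF hg_mono[OF mono(1)]] comp_hg by simp
  qed
  fix h assume h: "h \<in> el (gensk 1)"
  show "hom img (f + h) = hom img f + hom img h" by (rule hom_add[OF f h])
  show "hom img (tmul dg bc f h) = tmul dg bc (hom img f) (hom img h)"
    using hom_mult[OF g fu el_UNIV[OF h]] by (simp add: tm_def)
qed simp

text \<open>After subtraction of the constant term, \<open>f\<close> and hence its image consist of
  words of positive length. Words made of \<open>Tg\<close> and \<open>DTg\<close> have length zero
  too, so this gives the condition over the base for maps and for homotopies alike.\<close>

lemma hom_augmentation:
  assumes f: "f \<in> el (gensk 1)" and i: "\<And>x. x \<in> gensk 1 \<Longrightarrow> img x \<in> filt wl 1" and m: "wt wl m = 0"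
  shows "hom img f m = (if m = {#} then f {#} else 0)"
proof -
  let ?g = "f - inc (f {#})"
  have g: "?g \<in> el (gensk 1)" by (intro el_diff f el_incl)
  have "?g \<in> filt wl 1"
  proof (rule filtI)
    fix n assume nz: "?g n \<noteq> 0"
    then have "n \<noteq> {#}" by (auto simp: incl_def fun_pointwise)
    then show "1 \<le> wt wl n" using size_eq_wt[of n 1] el_supp[OF g nz] by (cases n) auto
  qed
  then have "hom img ?g \<in> filt wl 1"
    by (rule hom_filt[OF g]) (use i in \<open>auto simp: gensk_iff\<close>)
  then have "hom img ?g m = 0" by (rule filtD) (simp add: m)
  then have "hom img f m = inc (f {#}) m"
    using hom_diff[OF f el_incl, of img "f {#}"] by (simp add: fun_pointwise)
  then show ?thesis by (simp add: incl_def)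
qed

lemma dgmap_eq_hom:
  assumes d: "dgmap dg bc (el (gensk 1)) D1 T D2 \<phi>" and b: "\<And>b. \<phi> (inc b) = inc b" and f: "f \<in> el (gensk 1)"
  shows "\<phi> f = hom (ximg (\<lambda>i. \<phi> (wg i))) f"
proof (rule hom_unique[OF f])
  have m: "\<phi> (g \<odot> h) = \<phi> g \<odot> \<phi> h" if "g \<in> el (gensk 1)" "h \<in> el (gensk 1)" for g h
    using d that by (simp add: dgmap_def tm_def)
  show "\<phi> (g + h) = \<phi> g + \<phi> h" if "g \<in> el (gensk 1)" "h \<in> el (gensk 1)" for g h
    using d that by (simp add: dgmap_def)
  show "\<phi> (inc c \<odot> g) = inc c \<odot> \<phi> g" if "g \<in> el (gensk 1)" for c g
    using m[OF el_incl that] b by simp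
  show "\<phi> (gel x \<odot> g) = ximg (\<lambda>i. \<phi> (wg i)) x \<odot> \<phi> g" if "x \<in> gensk 1" "g \<in> el (gensk 1)" for x g
    using m[OF el_gel[OF that(1)] that(2)] that(1) by (auto simp: gensk_iff)
qed (rule b)

lemma dgmap_hg: "dgmap dg bc S D1 T D2 \<phi> \<Longrightarrow> f \<in> S \<Longrightarrow> hg p f \<Longrightarrow> hg p (\<phi> f)"
  unfolding dgmap_def hg_def by metis

text \<open>The differential of a model is thereby identified with the derivation \<open>Dx\<close>
  generated by its own values, which is defined on all tensor factors and on polynomial
  forms.\<close>

lemma model_differential:
  assumes m: "relative_model dg bc dB D"
  shows "good_diff D" and "f \<in> el (gensk 1) \<Longrightarrow> D f = Dx dg bc dB D f"
proof -
  note dga = m[unfolded relative_model_def is_dga_def]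
  have el: "D f \<in> el (gensk 1)" if "f \<in> el (gensk 1)" for f using dga that by blast
  have add: "D (f + g) = D f + D g" if "f \<in> el (gensk 1)" "g \<in> el (gensk 1)" for f g using dga that by blast
  have deg: "comp dg bc (n + 1) (D f) = D (comp dg bc n f)" if "f \<in> el (gensk 1)" for f n using dga that by blast
  have leib: "D (f \<odot> g) = D f \<odot> g + isc ((-1) ^ n) (f \<odot> D g)"
    if "f \<in> el (gensk 1)" "g \<in> el (gensk 1)" "hg n f" for f g n
    using dga that unfolding tm_def hg_def by blast
  have inc: "D (inc b) = inc (dB b)" for b using dga by blast
  show gd: "good_diff D"
    unfolding good_diff_def
  proof (intro allI conjI)
    fix i
    show "D (wg i) \<in> el (gensk 1)" by (rule el[OF wg_el])
    show "hg (Suc (dg i)) (D (wg i))"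
      using deg[OF wg_el, of "dg i" i] hg_gens(1)[of i 0] by (simp add: hg_def flip: Suc_eq_plus1)
  qed
  show "D f = Dx dg bc dB D f" if f: "f \<in> el (gensk 1)"
  proof (rule deriv_unique[OF deriv_Dx[OF gd] f])
    show "D (f + g) = D f + D g" if "f \<in> el (gensk 1)" "g \<in> el (gensk 1)" for f g by (rule add[OF that])
    show "D (inc 1) = 0" by (simp add: inc)
    show "D (inc b \<odot> g) = inc (dB b) \<odot> g + inc (binv bc b) \<odot> D g" if g: "g \<in> el (gensk 1)" for b g
    proof (induction b rule: homogeneous_induct)
      case (add x y)
      have "D (inc (x + y) \<odot> g) = D (inc x \<odot> g) + D (inc y \<odot> g)"
        unfolding incl_add tm_add_left by (rule \<open>\<And>g f. f \<in> el (gensk 1) \<Longrightarrow> g \<in> el (gensk 1) \<Longrightarrow> D (f + g) = D f + D g\<close>; intro el_tm el_incl g)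
      then show ?case unfolding add.IH by (simp add: dB_add binv_add incl_add tm_add_left)
    next
      case (homogeneous p x)
      show ?case
        using leib[OF el_incl g hg_incl[OF homogeneous], unfolded isc_pm]
        by (cases "even p") (simp_all add: inc binv_homogeneous[OF homogeneous] incl_minus tm_minus_left)
    qed
    show "D (gel x \<odot> g) = Dx dg bc dB D (gel x) \<odot> g + par (Suc 0) (gel x) \<odot> D g"
      if x: "x \<in> gensk 1" and g: "g \<in> el (gensk 1)" for x g
    proof -
      obtain i where i: "x = Gn 0 i" using x by (auto simp: gensk_iff)
      have "hom (cpy 0) (D (wg i)) = hom gel (D (wg i))"
        by (rule hom_cong[OF el[OF wg_el]]) (auto simp: gensk_iff cpy_def)
      then have "Dx dg bc dB D (gel x) = D (gel x)"
        using hom_gel_id[OF el_UNIV[OF el[OF wg_el]]] by (simp add: i Dx_gen[OF gd])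
      then show ?thesis
        using leib[OF wg_el g hg_gens(1)[of i 0], unfolded isc_pm] odd_dg[of i]
        by (simp add: i par_hg[OF hg_gens(1)] tm_minus_left)
    qed
  qed
qed

text \<open>With \<open>k = 2\<close> and \<open>j = 0\<close> this says that multiplying the two
  factors is a chain map, which is what makes P a DG endomorphism.\<close>

lemma Dx_cpy:
  assumes gd: "good_diff D" and f: "f \<in> el (gensk k)"
  shows "Dx dg bc dB D (hom (cpy j) f) = hom (cpy j) (Dx dg bc dB D f)"
proof (rule deriv_hom_commute[OF deriv_Dx[OF gd] deriv_Dx[OF gd] good_cpy f])
  fix x :: "'i gen" assume "x \<in> gensk k"
  then obtain j' i where x: "x = Gn j' i" by (auto simp: gensk_iff)
  have e: "D (wg i) \<in> el (gensk 1)" using gd by (simp add: good_diff_def)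
  have "hom (cpy j) (hom (cpy j') (D (wg i))) = hom (\<lambda>g. hom (cpy j) (cpy j' g)) (D (wg i))"
    by (rule hom_hom[OF good_cpy good_cpy el_UNIV[OF e]])
  also have "\<dots> = hom (cpy j) (D (wg i))"
    by (rule hom_cong[OF e]) (auto simp: gensk_iff cpy_def hom_gel_good[OF good_cpy])
  finally show "Dx dg bc dB D (cpy j x) = hom (cpy j) (Dx dg bc dB D (gel x))"
    by (simp add: x Dx_gen[OF gd]) (simp add: cpy_def Dx_gen[OF gd])
qed

lemma wt_wf_member: "Gn j i \<in># m \<Longrightarrow> 1 \<le> wt (wf j) m"
  by (metis insert_DiffM le_add1 wf.simps(1) wt_add_mset)

lemma plusplus_PP: "f \<in> plusplus dg \<Longrightarrow> f \<in> PP"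
  unfolding plusplus_def PP_iff filt_def by (auto intro: wt_wf_member)

subsection \<open>Transport along a change of generators\<close>

text \<open>The substitution by \<open>x\<close> performed in every tensor factor at once.\<close>

definition timg :: "('i \<Rightarrow> ('i, 'b) elt) \<Rightarrow> 'i gen \<Rightarrow> ('i, 'b) elt" where
  "timg x g = (case g of Gn j i \<Rightarrow> hom (cpy j) (x i) | _ \<Rightarrow> 0)"

lemma timg_Gn: "timg x (Gn j i) = hom (cpy j) (x i)"
  by (simp add: timg_def)

lemma cpy_hg: "f \<in> el (gensk 1) \<Longrightarrow> hg p f \<Longrightarrow> hg p (hom (cpy j) f)"
  by (rule hom_hg) (use good_cpy in \<open>auto simp: good_def\<close>)

lemma good_timg: "fam x \<Longrightarrow> good (timg x)"
  unfolding good_def timg_def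
  by (auto simp: fam_def intro: el_UNIV[OF hom_cpy_el] cpy_hg split: gen.split)

lemma timg_el: "fam x \<Longrightarrow> f \<in> el (gensk k) \<Longrightarrow> hom (timg x) f \<in> el (gensk k)"
  by (rule hom_el, assumption)
     (auto simp: gensk_iff timg_def intro!: el_mono[OF gensk_mono hom_cpy_el] fam_el)

lemma timg_hg: "fam x \<Longrightarrow> f \<in> el (gensk k) \<Longrightarrow> hg p f \<Longrightarrow> hg p (hom (timg x) f)"
  by (rule hom_hg, assumption, assumption) (use good_timg in \<open>auto simp: good_def\<close>)

lemma hom_cpy_0: "f \<in> el (gensk 1) \<Longrightarrow> hom (cpy 0) f = f"
proof -
  assume f: "f \<in> el (gensk 1)"
  have "hom (cpy 0) f = hom gel f" by (rule hom_cong[OF f]) (auto simp: gensk_iff cpy_def)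
  then show ?thesis using hom_gel_id[OF el_UNIV[OF f]] by simp
qed

lemma timg_cpy:
  assumes x: "fam x" and f: "f \<in> el (gensk 1)"
  shows "hom (timg x) (hom (cpy j) f) = hom (cpy j) (hom (ximg x) f)"
proof -
  have "hom (timg x) (hom (cpy j) f) = hom (\<lambda>g. hom (timg x) (cpy j g)) f"
    by (rule hom_hom[OF good_timg[OF x] good_cpy el_UNIV[OF f]])
  also have "\<dots> = hom (\<lambda>g. hom (cpy j) (ximg x g)) f"
    by (rule hom_cong[OF f]) (auto simp: gensk_iff cpy_def hom_gel_good[OF good_timg[OF x]] timg_def)
  also have "\<dots> = hom (cpy j) (hom (ximg x) f)"
    by (rule hom_hom[OF good_cpy good_ximg[OF x] el_UNIV[OF f], symmetric])
  finally show ?thesis .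
qed

lemma timg_first: "fam x \<Longrightarrow> f \<in> el (gensk 1) \<Longrightarrow> hom (timg x) f = hom (ximg x) f"
  using timg_cpy[of x f 0] hom_cpy_0 hom_ximg_el by simp

lemma timg_inverse:
  assumes x: "fam x" "fam y" "\<And>i. hom (ximg x) (y i) = wg i" and f: "f \<in> el (gensk k)"
  shows "hom (timg x) (hom (timg y) f) = f"
proof -
  have "hom (timg x) (hom (timg y) f) = hom (\<lambda>g. hom (timg x) (timg y g)) f"
    by (rule hom_hom[OF good_timg[OF x(1)] good_timg[OF x(2)] el_UNIV[OF f]])
  also have "\<dots> = hom gel f"
    by (rule hom_cong[OF f])
       (auto simp: gensk_iff timg_def[of y] timg_cpy[OF x(1) fam_el[OF x(2)]] x(3) hom_gel_good[OF good_cpy] cpy_def)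
  finally show ?thesis using hom_gel_id[OF el_UNIV[OF f]] by simp
qed

text \<open>As all \<open>x i\<close> are cycles, the change of generators is a chain map from the
  trivial differential to the given one, on any number of factors.\<close>

lemma Dx_timg:
  assumes gd: "good_diff D" and x: "fam x" "\<And>i. Dx dg bc dB D (x i) = 0" and f: "f \<in> el (gensk k)"
  shows "Dx dg bc dB D (hom (timg x) f) = hom (timg x) (D0 dB f)"
proof (rule deriv_hom_commute[OF deriv_Dx[OF gd] deriv_D0 good_timg[OF x(1)] f])
  fix g :: "'i gen" assume "g \<in> gensk k"
  then obtain j i where g: "g = Gn j i" by (auto simp: gensk_iff)
  show "Dx dg bc dB D (timg x g) = hom (timg x) (D0 dB (gel g))"
    using Dx_cpy[OF gd fam_el[OF x(1)], of j i] by (simp add: g timg_def D0_gel x(2))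
qed

lemma D0_timg:
  assumes gd: "good_diff D" and x: "fam x" "\<And>i. Dx dg bc dB D (x i) = 0"
    and y: "fam y" "\<And>i. hom (ximg x) (y i) = wg i" "\<And>i. hom (ximg y) (x i) = wg i"
    and f: "f \<in> el (gensk k)"
  shows "D0 dB (hom (timg y) f) = hom (timg y) (Dx dg bc dB D f)"
proof -
  have e: "hom (timg y) f \<in> el (gensk k)" by (rule timg_el[OF y(1) f])
  have "hom (timg y) (Dx dg bc dB D f) = hom (timg y) (Dx dg bc dB D (hom (timg x) (hom (timg y) f)))"
    by (simp add: timg_inverse[OF x(1) y(1,2) f])
  also have "\<dots> = D0 dB (hom (timg y) f)"
    unfolding Dx_timg[OF gd x e] by (rule timg_inverse[OF y(1) x(1) y(3) D0_el[OF e]])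
  finally show ?thesis by simp
qed

lemma timg_PP: "fam y \<Longrightarrow> (\<And>i. y i \<in> filt wl 1) \<Longrightarrow> f \<in> PP \<Longrightarrow> hom (timg y) f \<in> PP"
proof -
  assume y: "fam y" "\<And>i. y i \<in> filt wl 1" and f: "f \<in> PP"
  then have fe: "f \<in> el (gensk 2)" by (simp add: PP_iff)
  have t: "timg y (Gn j i) \<in> filt (wf k) (wf k (Gn j i))" for j i k
  proof (cases "j = k")
    case True
    have "hom (cpy j) (y i) \<in> filt (wf j) 1"
      by (rule hom_filt[OF fam_el[OF y(1)] y(2)]) (auto simp: gensk_iff cpy_def gel_wf)
    then show ?thesis using True by (simp add: timg_def)
  qed simp
  have "hom (timg y) f \<in> filt (wf k) 1" if "f \<in> filt (wf k) 1" for k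
    by (rule hom_filt[OF fe that]) (use t in \<open>auto simp: gensk_iff\<close>)
  then show ?thesis using f timg_el[OF y(1) fe] by (simp add: PP_iff)
qed

lemma shift_cpy: "f \<in> el (gensk 1) \<Longrightarrow> hom shift_img (hom (cpy j) f) = hom (cpy (Suc j)) f"
proof -
  assume f: "f \<in> el (gensk 1)"
  have "hom shift_img (hom (cpy j) f) = hom (\<lambda>g. hom shift_img (cpy j g)) f"
    by (rule hom_hom[OF good_shift good_cpy el_UNIV[OF f]])
  also have "\<dots> = hom (cpy (Suc j)) f"
    by (rule hom_cong[OF f]) (auto simp: gensk_iff cpy_def hom_gel_good[OF good_shift] shift_img_def)
  finally show ?thesis .
qed

lemma timg_shift:
  assumes y: "fam y" and f: "f \<in> el (gensk 2)"
  shows "hom shift_img (hom (timg y) f) = hom (timg y) (hom shift_img f)"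
proof -
  have "hom shift_img (hom (timg y) f) = hom (\<lambda>g. hom shift_img (timg y g)) f"
    by (rule hom_hom[OF good_shift good_timg[OF y] el_UNIV[OF f]])
  also have "\<dots> = hom (\<lambda>g. hom (timg y) (shift_img g)) f"
    by (rule hom_cong[OF f])
       (auto simp: gensk_iff timg_Gn shift_cpy[OF fam_el[OF y]] shift_img_def hom_gel_good[OF good_timg[OF y]])
  also have "\<dots> = hom (timg y) (hom shift_img f)"
    by (rule hom_hom[OF good_timg[OF y] good_shift el_UNIV[OF f], symmetric])
  finally show ?thesis .
qed

text \<open>The comultiplication in the new generators x, where y expresses the old ones.\<close>
definition transport :: "('i \<Rightarrow> ('i, 'b) elt) \<Rightarrow> ('i \<Rightarrow> ('i, 'b) elt) \<Rightarrow> ('i \<Rightarrow> ('i, 'b) elt) \<Rightarrow> 'i \<Rightarrow> ('i, 'b) elt" where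
  "transport c x y i = hom (timg y) (hom (ximg c) (x i))"

context
  fixes c x y
  assumes c: "fam2 c" and x: "fam x" and y: "fam y"
    and xy: "\<And>i. hom (ximg x) (y i) = wg i" and yx: "\<And>i. hom (ximg y) (x i) = wg i"
begin

lemma transport_fam2: "fam2 (transport c x y)"
  unfolding fam2_def transport_def
  using timg_el[OF y hom_ximg2_el[OF c fam_el[OF x]]]
    timg_hg[OF y hom_ximg2_el[OF c fam_el[OF x]] hom_ximg2_hg[OF c fam_el[OF x] fam_hg[OF x]]] by blast

lemma hom_transport:
  assumes f: "f \<in> el (gensk 1)"
  shows "hom (ximg (transport c x y)) f = hom (timg y) (hom (ximg c) (hom (ximg x) f))"
proof -
  have "hom (timg y) (hom (ximg c) (hom (ximg x) f)) = hom (timg y) (hom (\<lambda>g. hom (ximg c) (ximg x g)) f)"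
    by (simp only: hom_hom[OF good_ximg2[OF c] good_ximg[OF x] el_UNIV[OF f]])
  also have "\<dots> = hom (\<lambda>g. hom (timg y) (hom (ximg c) (ximg x g))) f"
    by (rule hom_hom[OF good_timg[OF y] good_comp[OF good_ximg2[OF c] good_ximg[OF x]] el_UNIV[OF f]])
  also have "\<dots> = hom (ximg (transport c x y)) f"
    by (rule hom_cong[OF f]) (auto simp: gensk_iff transport_def)
  finally show ?thesis by simp
qed

text \<open>Comultiplying the first factor is compatible with changing generators in all factors at
  once; the two cases are the letters of the two factors.\<close>

lemma right_transport:
  assumes f: "f \<in> el (gensk 2)"
  shows "hom (right_img (transport c x y)) (hom (timg y) f) = hom (timg y) (hom (right_img c) f)"
proof -
  let ?t = "transport c x y"
  have "hom (right_img ?t) (hom (timg y) f) = hom (\<lambda>g. hom (right_img ?t) (timg y g)) f"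
    by (rule hom_hom[OF good_right[OF transport_fam2] good_timg[OF y] el_UNIV[OF f]])
  also have "\<dots> = hom (\<lambda>g. hom (timg y) (right_img c g)) f"
  proof (rule hom_cong[OF f])
    fix g :: "'i gen" assume "g \<in> gensk 2"
    then obtain j i where g: "g = Gn j i" "j < 2" by (auto simp: gensk_iff)
    show "hom (right_img ?t) (timg y g) = hom (timg y) (right_img c g)"
    proof (cases "j = 0")
      case True
      have "hom (right_img ?t) (y i) = hom (timg y) (c i)"
        unfolding right_first[OF fam_el[OF y]] hom_transport[OF fam_el[OF y]] xy
        using hom_gel_good[OF good_ximg2[OF c], of "Gn 0 i"] by simp
      then show ?thesis by (simp add: g(1) True timg_def[of y "Gn 0 i"] hom_cpy_0[OF fam_el[OF y]] right_img_def[of c])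
    next
      case False
      then have "j = 1" using g(2) by simp
      then show ?thesis
        using right_second[OF transport_fam2 fam_el[OF y], of i] hom_gel_good[OF good_timg[OF y], of "Gn 2 i"]
        by (simp add: g(1) timg_def[of y "Gn _ i"] right_img_def[of c])
    qed
  qed
  also have "\<dots> = hom (timg y) (hom (right_img c) f)"
    by (rule hom_hom[OF good_timg[OF y] good_right[OF c] el_UNIV[OF f], symmetric])
  finally show ?thesis .
qed

lemma left_transport:
  assumes f: "f \<in> el (gensk 2)"
  shows "hom (left_img (transport c x y)) (hom (timg y) f) = hom (timg y) (hom (left_img c) f)"
proof -
  let ?t = "transport c x y"
  have "hom (left_img ?t) (hom (timg y) f) = hom (\<lambda>g. hom (left_img ?t) (timg y g)) f"
    by (rule hom_hom[OF good_left[OF transport_fam2] good_timg[OF y] el_UNIV[OF f]])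
  also have "\<dots> = hom (\<lambda>g. hom (timg y) (left_img c g)) f"
  proof (rule hom_cong[OF f])
    fix g :: "'i gen" assume "g \<in> gensk 2"
    then obtain j i where g: "g = Gn j i" "j < 2" by (auto simp: gensk_iff)
    show "hom (left_img ?t) (timg y g) = hom (timg y) (left_img c g)"
    proof (cases "j = 0")
      case True
      then show ?thesis
        using left_first[OF fam_el[OF y], of ?t i] hom_gel_good[OF good_timg[OF y], of "Gn 0 i"]
        by (simp add: g(1) timg_def[of y "Gn _ i"] hom_cpy_0[OF fam_el[OF y]] left_img_def[of c])
    next
      case False
      then have j: "j = 1" using g(2) by simp
      have "hom (left_img ?t) (hom (cpy 1) (y i)) = hom shift_img (hom (timg y) (c i))"
        unfolding left_second[OF transport_fam2 fam_el[OF y]] hom_transport[OF fam_el[OF y]] xy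
        using hom_gel_good[OF good_ximg2[OF c], of "Gn 0 i"] by simp
      then show ?thesis
        by (simp add: g(1) j timg_def[of y "Gn _ i"] left_img_def[of c] timg_shift[OF y fam2_el[OF c]])
    qed
  qed
  also have "\<dots> = hom (timg y) (hom (left_img c) f)"
    by (rule hom_hom[OF good_timg[OF y] good_left[OF c] el_UNIV[OF f], symmetric])
  finally show ?thesis .
qed

lemma transport_PP:
  assumes PP: "\<And>i. c i - gel (Gn 0 i) - gel (Gn 1 i) \<in> PP"
    and xf: "\<And>i. x i \<in> filt wl 1" and yf: "\<And>i. y i \<in> filt wl 1"
  shows "transport c x y i - gel (Gn 0 i) - gel (Gn 1 i) \<in> PP"
proof -
  have xi: "x i \<in> el (gensk 1)" by (rule fam_el[OF x])
  have x2: "x i \<in> el (gensk 2)" by (rule el_mono[OF gensk_mono xi]) simp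
  have xp: "hom (cpy 1) (x i) \<in> el (gensk 2)" using hom_cpy_el[OF xi, of 1] by simp
  have ce: "hom (ximg c) (x i) \<in> el (gensk 2)" by (rule hom_ximg2_el[OF c xi])
  have "hom (timg y) (hom (ximg c) (x i) - x i - hom (cpy 1) (x i)) \<in> PP"
    by (rule timg_PP[OF y yf comult_PP[OF c PP xi xf]])
  also have "hom (timg y) (hom (ximg c) (x i) - x i - hom (cpy 1) (x i)) = transport c x y i - gel (Gn 0 i) - gel (Gn 1 i)"
    using timg_first[OF y xi] timg_cpy[OF y xi, of 1]
    by (simp add: hom_diff[of _ "gensk 2"] el_diff ce x2 xp transport_def yx hom_gel_good[OF good_cpy] cpy_def)
  finally show ?thesis .
qed

end

text \<open>The homotopy maps the cycle \<open>f\<close> to a cycle, so in Stokes' formula only the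
  differential of the integral remains.\<close>

lemma homotopy_exact:
  assumes gd: "good_diff D" and h: "dg_htpy dg bc dB D 3 D \<phi> \<psi>" and f: "f \<in> el (gensk 1)" "D f = 0"
  shows "\<exists>h\<in>el (gensk 3). \<phi> f - \<psi> f = Dx dg bc dB D h"
proof -
  obtain H where H: "dgmap dg bc (el (gensk 1)) D (el (gensT 3)) (Dx dg bc dB D) H"
    "ev dg bc 0 (H f) = \<phi> f" "ev dg bc 1 (H f) = \<psi> f"
    using h f(1) unfolding dg_htpy_def by blast
  have Hf: "H f \<in> el (gensT 3)" using H(1) f(1) by (simp add: dgmap_def)
  have "H (0 + 0) = H 0 + H 0" using H(1) unfolding dgmap_def using el_zero[of "gensk 1"] by blast
  then have "H 0 = 0" by simp
  then have "Dx dg bc dB D (H f) = 0" using H(1) f unfolding dgmap_def by metis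
  then have "\<psi> f - \<phi> f = Dx dg bc dB D (integ (H f))"
    using integ_homotopy[OF gd Hf] H(2,3) by (simp add: ev_eq integ_def fun_pointwise)
  then have "\<phi> f - \<psi> f = Dx dg bc dB D (- integ (H f))"
    using deriv_minus[OF deriv_Dx[OF gd] el_UNIV[OF integ_el[OF Hf]]] by (metis minus_diff_eq)
  then show ?thesis using el_minus[OF integ_el[OF Hf]] by blast
qed

subsection \<open>The classification\<close>

lemma equivalence_from_primitives:
  assumes m: "relative_model dg bc dB D" and C: "fibrewise_mult dg bc dB D C"
    and X: "fam X" "\<And>i. X i \<in> filt wl 1" "\<And>i. Dx dg bc dB D (X i) = 0"
    and X': "fam X'" "\<And>i. hom (ximg X) (X' i) = wg i" "\<And>i. hom (ximg X') (X i) = wg i"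
    and Z: "\<And>i. Z i \<in> el (gensk 2)" "\<And>i. hg (dg i - 1) (Z i)" "\<And>i. Z i \<in> filt wl 1"
    and CX: "\<And>i. C (X i) - X i - hom (cpy 1) (X i) = Dx dg bc dB D (Z i)"
  shows "equiv_BB dg bc dB D C (D0 dB) (C0 dg bc)"
proof -
  let ?d = "Dx dg bc dB D"
  note gd = model_differential(1)[OF m]
  note dd = deriv_Dx[OF gd]
  have Cd: "dgmap dg bc (el (gensk 1)) D (el (gensk 2)) ?d C" and Cb: "\<And>b. C (inc b) = inc b"
    and Cpp: "\<And>i. C (wg i) - gel (Gn 0 i) - gel (Gn 1 i) \<in> plusplus dg"
    using C unfolding fibrewise_mult_def under_over_def by auto
  define cimg where "cimg i = C (wg i)" for i
  have fc: "fam2 cimg"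
    unfolding fam2_def cimg_def using Cd wg_el dgmap_hg[OF Cd wg_el hg_gens(1)] by (auto simp: dgmap_def)
  have Ch: "C f = hom (ximg cimg) f" if "f \<in> el (gensk 1)" for f
    unfolding cimg_def by (rule dgmap_eq_hom[OF Cd Cb that])
  define \<phi> where "\<phi> = hom (ximg X)"
  have \<phi>w: "\<phi> (wg i) = X i" for i by (simp add: \<phi>_def hom_ximg_wg[OF X(1)])
  have Xe: "X i \<in> el (gensk 1)" for i by (rule fam_el[OF X(1)])
  have dphi: "\<phi> (D0 dB f) = D (\<phi> f)" if f: "f \<in> el (gensk 1)" for f
    using Dx_timg[OF gd X(1,3) f] model_differential(2)[OF m hom_ximg_el[OF X(1) f]]
    by (simp add: \<phi>_def timg_first[OF X(1)] f D0_el)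
  have 1: "dgmap dg bc (el (gensk 1)) (D0 dB) (el (gensk 1)) D \<phi>"
    unfolding \<phi>_def by (rule hom_dgmap[OF good_ximg[OF X(1)]]) (use dphi in \<open>auto simp: gensk_iff Xe \<phi>_def\<close>)
  have inv: "hom (ximg a) (hom (ximg b) f) = f"
    if "fam a" "fam b" "\<And>i. hom (ximg a) (b i) = wg i" "f \<in> el (gensk 1)" for a b f
    unfolding hom_ximg_comp[OF that(1,2,4)] by (rule hom_ximg_id[OF that(4,3)])
  have 2: "bij_betw \<phi> (el (gensk 1)) (el (gensk 1))"
    unfolding \<phi>_def
    by (rule bij_betw_byWitness[where f' = "hom (ximg X')"])
       (auto simp: inv[OF X'(1) X(1) X'(3)] inv[OF X(1) X'(1) X'(2)] hom_ximg_el X X')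
  have 3: "under_over (el (gensk 1)) \<phi>"
    unfolding under_over_def \<phi>_def
  proof (intro conjI ballI allI)
    fix f :: "('i, 'b) elt" assume "f \<in> el (gensk 1)"
    then show "hom (ximg X) f {#} = f {#}"
      by (subst hom_augmentation) (auto simp: gensk_iff X(2))
  qed simp
  have "dg_htpy dg bc dB (D0 dB) 2 D (C \<circ> \<phi>) (tens2 dg bc \<phi> \<circ> C0 dg bc)"
  proof -
    let ?t = "gel Tg" and ?dt = "gel DTg"
    \<comment> \<open>This is \<open>C (X i)\<close> minus the differential of
      \<open>Z i \<odot> ?t\<close>, as \<open>Z i\<close> has even degree. Hence it is closed, and
      it equals \<open>C (X i)\<close> at \<open>t = 0\<close> and
      \<open>C (X i) - ?d (Z i)\<close>, the sum of the two copies of \<open>X i\<close>, at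
      \<open>t = 1\<close>.\<close>
    define Y where "Y i = C (X i) - ?d (Z i) \<odot> ?t - Z i \<odot> ?dt" for i
    have CXe: "C (X i) \<in> el (gensk 2)" for i using Cd Xe by (simp add: dgmap_def)
    have dZe: "?d (Z i) \<in> el (gensk 2)" for i by (rule Dx_el[OF gd Z(1)])
    have inT: "f \<in> el (gensT 2)" if "f \<in> el (gensk 2)" for f
      by (rule el_mono[OF gensk_subset_gensT that])
    have tT: "?t \<in> el (gensT 2)" "?dt \<in> el (gensT 2)" by (simp_all add: gensT_iff)
    have Ye: "Y i \<in> el (gensT 2)" for i
      unfolding Y_def by (intro el_diff el_tm inT CXe dZe Z(1) tT)
    have dZh: "hg (dg i) (?d (Z i))" for i using Dx_hg[OF gd Z(2), of i] dg_pos[of i] by simp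
    have Yh: "hg (dg i) (Y i)" for i
    proof -
      have "hg (dg i + 0) (?d (Z i) \<odot> ?t)" by (rule hg_mult[OF dZh hg_gens(2)])
      moreover have "hg (dg i - 1 + Suc 0) (Z i \<odot> ?dt)" by (rule hg_mult[OF Z(2) hg_gens(3)])
      moreover have "dg i - 1 + Suc 0 = dg i" using dg_pos[of i] by simp
      ultimately show ?thesis
        unfolding Y_def using dgmap_hg[OF Cd Xe fam_hg[OF X(1)]] by (intro hg_diff) simp_all
    qed
    have gY: "good (ximg Y)"
      using Ye Yh by (auto simp: good_def ximg_def intro: el_UNIV split: gen.split)
    have CXf: "C (X i) \<in> filt wl 1" for i
    proof -
      have "cimg j \<in> filt wl 1" for j
      proof -
        have "cimg j = (C (wg j) - gel (Gn 0 j) - gel (Gn 1 j)) + gel (Gn 0 j) + gel (Gn 1 j)" by (simp add: cimg_def)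
        also have "\<dots> \<in> filt wl 1"
          by (intro filt_add gel_wl filt_le[OF PP_filt[OF plusplus_PP[OF Cpp]]]) simp
        finally show ?thesis .
      qed
      then show ?thesis unfolding Ch[OF Xe] by (intro hom_filt[OF Xe X(2)]) (auto simp: gensk_iff)
    qed
    have dZf: "?d (Z i) \<in> filt wl 1" for i
      unfolding CX[symmetric]
      by (intro filt_diff CXf X(2) hom_filt[OF Xe X(2)]) (auto simp: gensk_iff cpy_def gel_wl)
    have Yf: "Y i \<in> filt wl 1" for i
      unfolding Y_def by (intro filt_diff filt_tm_right CXf dZf Z(3))
    have u: "?d (Z i) \<in> el UNIV" "Z i \<in> el UNIV" "C (X i) \<in> el UNIV" "X i \<in> el UNIV"
      "hom (cpy 1) (X i) \<in> el UNIV" "?t \<in> el UNIV" "?dt \<in> el UNIV" for i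
      using el_UNIV[OF dZe] el_UNIV[OF Z(1)] el_UNIV[OF CXe] el_UNIV[OF Xe] el_UNIV[OF hom_cpy_el[OF Xe]] by simp_all
    have dCX: "?d (C (X i)) = 0" for i
    proof -
      have "?d (C (X i)) = C (D (X i))" using Cd Xe by (simp add: dgmap_def)
      also have "D (X i) = 0" using model_differential(2)[OF m Xe] X(3) by simp
      finally show ?thesis using Cb[of 0] by simp
    qed
    \<comment> \<open>\<open>?d (Z i)\<close> is a combination of the cycles \<open>C (X i)\<close>,
      \<open>X i\<close> and its copy in factor 1.\<close>
    have ddZ: "?d (?d (Z i)) = 0" for i
      unfolding CX[symmetric]
      by (simp add: deriv_diff[OF dd] el_diff u dCX X(3) Dx_cpy[OF gd Xe])
    have dY: "?d (Y i) = 0" for i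
    proof -
      have p: "par (Suc 0) (?d (Z i)) = - ?d (Z i)" using odd_dg[of i] by (simp add: par_hg[OF dZh])
      have "?d (Y i) = 0 - (- (?d (Z i) \<odot> ?dt)) - (?d (Z i) \<odot> ?dt)"
        unfolding Y_def
        by (simp add: deriv_diff[OF dd] deriv_mult[OF dd] el_diff el_tm u dCX ddZ Dx_gen[OF gd] p tm_minus_left)
      then show ?thesis by simp
    qed
    let ?H = "hom (ximg Y)"
    have "dgmap dg bc (el (gensk 1)) (D0 dB) (el (gensT 2)) ?d ?H"
    proof (rule hom_dgmap[OF gY])
      show "ximg Y x \<in> el (gensT 2)" if "x \<in> gensk 1" for x using that Ye by (auto simp: gensk_iff)
      show "?H (D0 dB f) = ?d (?H f)" if "f \<in> el (gensk 1)" for f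
        by (rule deriv_hom_commute[OF dd deriv_D0 gY that, symmetric]) (auto simp: gensk_iff dY D0_gel)
    qed
    moreover have "?H f n = (if n = {#} then f {#} else 0)"
      if "f \<in> el (gensk 1)" "set_mset n \<subseteq> {Tg, DTg}" for f n
    proof (rule hom_augmentation[OF that(1)])
      show "ximg Y x \<in> filt wl 1" if "x \<in> gensk 1" for x using that Yf by (auto simp: gensk_iff)
      show "wt wl n = 0" using that(2) by (induction n) auto
    qed
    moreover have "ev dg bc 0 (?H f) = (C \<circ> \<phi>) f" if f: "f \<in> el (gensk 1)" for f
    proof -
      have g0: "good (evi 0)" by (rule good_evi) simp
      have "hom (evi 0) (?H f) = hom (\<lambda>g. hom (evi 0) (ximg Y g)) f"
        by (rule hom_hom[OF g0 gY el_UNIV[OF f]])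
      also have "\<dots> = hom (\<lambda>g. hom (ximg cimg) (ximg X g)) f"
      proof (rule hom_cong[OF f])
        fix g :: "'i gen" assume "g \<in> gensk 1"
        then obtain i where g: "g = Gn 0 i" by (auto simp: gensk_iff)
        have "hom (evi 0) (Y i) = C (X i)"
          unfolding Y_def
          by (simp add: hom_diff[of _ UNIV] el_diff el_tm u hom_mult[OF g0] hom_gel_good[OF g0] hom_evi[OF CXe])
        then show "hom (evi 0) (ximg Y g) = hom (ximg cimg) (ximg X g)" by (simp add: g Ch[OF Xe])
      qed
      also have "\<dots> = hom (ximg cimg) (hom (ximg X) f)"
        by (rule hom_hom[OF good_ximg2[OF fc] good_ximg[OF X(1)] el_UNIV[OF f], symmetric])
      finally show ?thesis by (simp add: ev_eq \<phi>_def Ch[OF hom_ximg_el[OF X(1) f]])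
    qed
    moreover have "ev dg bc 1 (?H f) = (tens2 dg bc \<phi> \<circ> C0 dg bc) f" if f: "f \<in> el (gensk 1)" for f
    proof -
      \<comment> \<open>At the other endpoint, evaluation must give the standard multiplication
        followed by the change of generators in both factors.\<close>
      have g1: "good (evi 1)" by (rule good_evi) (simp add: bc_one)
      define ci where "ci g = (case g of Gn _ i \<Rightarrow> gel (Gn 0 i) + gel (Gn 1 i) | _ \<Rightarrow> (0 :: ('i, 'b) elt))" for g
      have C0: "C0 dg bc = hom ci" by (simp add: C0_def hom_def ci_def[abs_def] cong: gen.case_cong)
      have T: "tens2 dg bc \<phi> = hom (timg X)"
        by (simp add: tens2_def hom_def timg_def[abs_def] copy_to_eq \<phi>w cong: gen.case_cong)
      have gci: "good ci"
        unfolding good_def ci_def by (auto intro!: el_add hg_add hg_gens split: gen.split)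
      have "hom (evi 1) (?H f) = hom (\<lambda>g. hom (evi 1) (ximg Y g)) f"
        by (rule hom_hom[OF g1 gY el_UNIV[OF f]])
      also have "\<dots> = hom (\<lambda>g. hom (timg X) (ci g)) f"
      proof (rule hom_cong[OF f])
        fix g :: "'i gen" assume "g \<in> gensk 1"
        then obtain i where g: "g = Gn 0 i" by (auto simp: gensk_iff)
        have "hom (evi 1) (Y i) = C (X i) - ?d (Z i)"
          unfolding Y_def
          by (simp add: hom_diff[of _ UNIV] el_diff el_tm u hom_mult[OF g1] hom_gel_good[OF g1]
              hom_evi[OF CXe] hom_evi[OF dZe] tm_inc_1[OF dZe])
        also have "\<dots> = X i + hom (cpy 1) (X i)" unfolding CX[symmetric] by simp
        also have "\<dots> = hom (timg X) (ci g)"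
          by (simp add: g ci_def hom_add[of _ UNIV] hom_gel_good[OF good_timg[OF X(1)]])
             (simp add: timg_def hom_cpy_0[OF Xe])
        finally show "hom (evi 1) (ximg Y g) = hom (timg X) (ci g)" by (simp add: g)
      qed
      also have "\<dots> = hom (timg X) (hom ci f)"
        by (rule hom_hom[OF good_timg[OF X(1)] gci el_UNIV[OF f], symmetric])
      finally show ?thesis by (simp add: ev_eq C0 T)
    qed
    ultimately show ?thesis unfolding dg_htpy_def by (intro exI[of _ ?H]) simp
  qed
  with 1 2 3 show ?thesis unfolding equiv_BB_def by blast
qed

theorem associative_equiv_trivial:
  assumes m: "relative_model dg bc dB D" and proj: "projection_dg dB (el (gensk 1)) D"
    and C: "fibrewise_mult dg bc dB D C" and H: "odd_cohomology_vanishes bc dB"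
    and assoc: "associative dg bc dB D C"
  shows "equiv_BB dg bc dB D C (D0 dB) (C0 dg bc)"
proof -
  let ?d = "Dx dg bc dB D"
  note gd = model_differential(1)[OF m] and Dd = model_differential(2)[OF m]
  note dd = deriv_Dx[OF gd]
  have Cd: "dgmap dg bc (el (gensk 1)) D (el (gensk 2)) ?d C" and Cb: "\<And>b. C (inc b) = inc b"
    and Cpp: "\<And>i. C (wg i) - gel (Gn 0 i) - gel (Gn 1 i) \<in> plusplus dg"
    using C unfolding fibrewise_mult_def under_over_def by auto
  define c where "c i = C (wg i)" for i
  have fc: "fam2 c"
    unfolding fam2_def c_def using Cd wg_el dgmap_hg[OF Cd wg_el hg_gens(1)] by (auto simp: dgmap_def)
  have cPP: "c i - gel (Gn 0 i) - gel (Gn 1 i) \<in> PP" for i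
    using plusplus_PP[OF Cpp] by (simp add: c_def)
  have Ch: "C f = hom (ximg c) f" if "f \<in> el (gensk 1)" for f
    unfolding c_def by (rule dgmap_eq_hom[OF Cd Cb that])
  have Del: "D f \<in> el (gensk 1)" and DD: "D (D f) = 0" if "f \<in> el (gensk 1)" for f
    using m that unfolding relative_model_def is_dga_def by blast+
  have Dbelow: "D (wg i) \<in> el (gens_below i)" for i
    using m unfolding relative_model_def gens_below_def by blast
  have Dw: "dgen D (Gn 0 i) = D (wg i)" for i
    using hom_cpy_0[OF Del[OF wg_el]] by (simp add: dgen_def)
  \<comment> \<open>The projection onto the base is a chain map, so the differential of a generator
    has no constant term.\<close>
  have Dwf: "D (wg i) \<in> filt wl 1" for i
  proof (rule filtI)
    fix n assume nz: "D (wg i) n \<noteq> 0"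
    have "D (wg i) {#} = dB (wg i {#})" using proj wg_el unfolding projection_dg_def by blast
    then have "n \<noteq> {#}" using nz by (auto simp: gel_def)
    then show "1 \<le> wt wl n" using size_eq_wt[of n 1] el_supp[OF Del[OF wg_el] nz] by (cases n) auto
  qed
  \<comment> \<open>\<open>cpy 0\<close> multiplies the two factors, so the substitution by
    \<open>p\<close> is the endomorphism P obtained from C.\<close>
  define p where "p i = hom (cpy 0) (c i)" for i
  have cpy0: "hom (cpy 0) f \<in> el (gensk 1)" if "f \<in> el (gensk 2)" for f
    by (rule hom_el[OF that]) (auto simp: gensk_iff cpy_def)
  have fp: "fam p"
    unfolding fam_def p_def
  proof (intro allI conjI)
    fix i
    show "hom (cpy 0) (c i) \<in> el (gensk 1)" by (rule cpy0[OF fam2_el[OF fc]])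
    show "hg (dg i) (hom (cpy 0) (c i))"
      by (rule hom_hg[OF fam2_el[OF fc] fam2_hg[OF fc]]) (use good_cpy in \<open>simp add: good_def\<close>)
  qed
  have p2: "p i - inc (of_int 2) \<odot> wg i \<in> filt wl 2" for i
  proof -
    have e: "wg i \<in> el (gensk 2)" "gel (Gn 1 i) \<in> el (gensk 2)" by (simp_all add: gensk_iff)
    have ce: "c i - wg i - gel (Gn 1 i) \<in> el (gensk 2)" by (intro el_diff fam2_el[OF fc] e)
    have "hom (cpy 0) (c i - wg i - gel (Gn 1 i)) \<in> filt wl 2"
      by (rule hom_filt[OF ce PP_filt[OF cPP]]) (auto simp: gensk_iff cpy_def gel_wl)
    also have "hom (cpy 0) (c i - wg i - gel (Gn 1 i)) = p i - wg i - wg i"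
      by (simp add: hom_diff[of _ "gensk 2"] el_diff e fam2_el[OF fc] hom_gel_good[OF good_cpy] p_def cpy_def)
    also have "\<dots> = p i - inc (of_int 2) \<odot> wg i"
      using incl_add[of 1 1] inc_1_tm[OF wg_el, of i] by (simp add: tm_add_left diff_diff_eq)
    finally show ?thesis .
  qed
  have dp: "?d (hom (ximg p) f) = hom (ximg p) (?d f)" if f: "f \<in> el (gensk 1)" for f
  proof (rule deriv_hom_commute[OF dd dd good_ximg[OF fp] f])
    fix g :: "'i gen" assume "g \<in> gensk 1"
    then obtain i where g: "g = Gn 0 i" by (auto simp: gensk_iff)
    have e: "D (wg i) \<in> el (gensk 1)" by (rule Del[OF wg_el])
    have "?d (p i) = hom (cpy 0) (?d (c i))" unfolding p_def by (rule Dx_cpy[OF gd fam2_el[OF fc]])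
    also have "?d (c i) = C (D (wg i))" using Cd wg_el by (simp add: dgmap_def c_def)
    also have "C (D (wg i)) = hom (ximg c) (D (wg i))" by (rule Ch[OF e])
    also have "hom (cpy 0) (hom (ximg c) (D (wg i))) = hom (\<lambda>g. hom (cpy 0) (ximg c g)) (D (wg i))"
      by (rule hom_hom[OF good_cpy good_ximg2[OF fc] el_UNIV[OF e]])
    also have "\<dots> = hom (ximg p) (D (wg i))"
      by (rule hom_cong[OF e]) (auto simp: gensk_iff p_def)
    finally show "?d (ximg p g) = hom (ximg p) (?d (gel g))" using Dd[OF wg_el] by (simp add: g)
  qed
  have "\<exists>x. tri x \<and> (\<forall>i. ?d (x i) = 0)"
  proof (rule closed_generators[OF H dd Dx_hg[OF gd] _ _ _ _ _ fp p2 dp])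
    show "?d f \<in> filt wl n" if "f \<in> el (gensk 1)" "f \<in> filt wl n" for f n
      unfolding Dx_eq by (rule der_filt[OF gooddiff_dgen[OF gd] _ that]) (auto simp: gensk_iff Dw Dwf)
    show "?d f \<in> el (gens_below i)" if "f \<in> el (gens_below i)" for f i
      unfolding Dx_eq
    proof (rule der_el[OF gooddiff_dgen[OF gd] _ that])
      fix g assume "g \<in> gens_below i"
      then obtain j where j: "g = Gn 0 j" "j < i" by (auto simp: gens_below_def)
      then have "gens_below j \<subseteq> gens_below i" by (auto simp: gens_below_def)
      then show "dgen D g \<in> el (gens_below i)" using el_mono[OF _ Dbelow] by (simp add: j Dw)
    qed
    show "?d (wg i) \<in> el (gens_below i)" for i using Dbelow Dd[OF wg_el] by simp
    show "?d (?d f) = 0" if "f \<in> el (gensk 1)" for f using DD[OF that] Dd that Del by simp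
    show "?d f \<in> el (gensk 1)" if "f \<in> el (gensk 1)" for f by (rule Dx_el[OF gd that])
    show "\<exists>x. tri x \<and> (\<forall>i. ?d (x i) = 0)" if "tri x" "\<And>i. ?d (x i) = 0" for x
      using that by blast
  qed
  then obtain x where x: "tri x" "\<And>i. ?d (x i) = 0" by blast
  obtain y where y: "tri y" "\<And>i. hom (ximg x) (y i) = wg i" "\<And>i. hom (ximg y) (x i) = wg i"
    by (rule tri_inverse[OF x(1)]) blast
  note fx = tri_fam[OF x(1)] and fy = tri_fam[OF y(1)]
  note tr = fc fx fy y(2,3)
  let ?c = "transport c x y"
  have Cx0: "?d (C (x i)) = 0" for i
  proof -
    have "?d (C (x i)) = C (D (x i))" using Cd fam_el[OF fx] by (simp add: dgmap_def)
    also have "D (x i) = 0" using Dd[OF fam_el[OF fx]] x(2) by simp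
    finally show ?thesis using Cb[of 0] by simp
  qed
  have D0T: "D0 dB (hom (timg y) f) = hom (timg y) (?d f)" if "f \<in> el (gensk k)" for f k
    by (rule D0_timg[OF gd fx x(2) fy y(2,3) that])
  \<comment> \<open>In the closed generators \<open>x\<close> the differential is
    \<open>D0 dB\<close>. A closed \<open>f\<close> there corresponds to a cycle \<open>F\<close> of
    the given model, to which the homotopy for associativity can be applied; the resulting exact
    difference is carried back by \<open>y\<close>.\<close>
  interpret t: coassoc bc dB dg ?c
  proof
    show "fam2 ?c" by (rule transport_fam2[OF tr])
    show "D0 dB (?c i) = 0" for i
      using D0T[OF hom_ximg2_el[OF fc fam_el[OF fx]]] Cx0[of i]
      by (simp add: transport_def Ch[OF fam_el[OF fx]])
    show "?c i - gel (Gn 0 i) - gel (Gn 1 i) \<in> PP" for i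
      by (rule transport_PP[OF tr cPP tri_filt[OF x(1)] tri_filt[OF y(1)]])
    show "odd_cohomology_vanishes bc dB" by (rule H)
    fix f assume f: "f \<in> el (gensk 1)" "D0 dB f = 0"
    define F where "F = hom (ximg x) f"
    have F: "F \<in> el (gensk 1)" unfolding F_def by (rule hom_ximg_el[OF fx f(1)])
    have "?d F = 0"
      using Dx_timg[OF gd fx x(2) f(1)] timg_first[OF fx f(1)] f(2) by (simp add: F_def)
    then have "D F = 0" using Dd[OF F] by simp
    from homotopy_exact[OF gd assoc[unfolded associative_def] F this]
    obtain h where h: "h \<in> el (gensk 3)" "C_tens_1 dg bc C (C F) - one_tens_C dg bc C (C F) = ?d h" by auto
    have R: "C_tens_1 dg bc C = hom (right_img c)"
      unfolding C_tens_1_def hom_def right_img_def[abs_def] c_def by (rule refl)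
    have sh: "shift1 dg bc = hom shift_img"
      unfolding shift1_def hom_def shift_img_def[abs_def] by (rule refl)
    have L: "one_tens_C dg bc C = hom (left_img c)"
      unfolding one_tens_C_def sh unfolding hom_def left_img_def[abs_def] c_def by (rule refl)
    have CF: "hom (ximg c) F \<in> el (gensk 2)" by (rule hom_ximg2_el[OF fc F])
    have RL: "hom (right_img c) (hom (ximg c) F) \<in> el UNIV" "hom (left_img c) (hom (ximg c) F) \<in> el UNIV"
      using good_right[OF fc] good_left[OF fc] by (auto intro!: hom_el[OF CF] simp: good_def)
    have "hom (right_img ?c) (hom (ximg ?c) f) - hom (left_img ?c) (hom (ximg ?c) f)
      = hom (timg y) (hom (right_img c) (hom (ximg c) F)) - hom (timg y) (hom (left_img c) (hom (ximg c) F))"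
      unfolding hom_transport[OF tr f(1)] F_def[symmetric] right_transport[OF tr CF] left_transport[OF tr CF] by (rule refl)
    also have "\<dots> = hom (timg y) (?d h)"
      using h(2) by (simp add: R L Ch[OF F] hom_diff[OF RL, symmetric])
    also have "\<dots> = D0 dB (hom (timg y) h)" by (rule D0T[OF h(1), symmetric])
    finally show "\<exists>h\<in>el (gensk 3). hom (right_img ?c) (hom (ximg ?c) f) - hom (left_img ?c) (hom (ximg ?c) f) = D0 dB h"
      using timg_el[OF fy h(1)] by blast
  qed
  obtain u z where u: "fam u" "\<And>i. u i - wg i \<in> filt wl 2" "\<And>i. D0 dB (u i) = 0"
    and z: "\<And>i. z i \<in> PP" "\<And>i. hg (dg i - 1) (z i)"
      "\<And>i. hom (ximg ?c) (u i) - u i - hom (cpy 1) (u i) = D0 dB (z i)"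
    by (rule t.primitive_generators) blast
  have ut: "tri u"
    unfolding tri_def using u by (auto intro!: bexI[of _ 0])
  obtain v where v: "tri v" "\<And>i. hom (ximg u) (v i) = wg i" "\<And>i. hom (ximg v) (u i) = wg i"
    by (rule tri_inverse[OF ut]) blast
  note fv = tri_fam[OF v(1)]
  \<comment> \<open>The primitive generators \<open>u\<close> are expressed in the closed
    generators, so their substitution by \<open>x\<close> gives the final generators; the inverse
    substitutions compose in the opposite order.\<close>
  define X where "X i = hom (ximg x) (u i)" for i
  define X' where "X' i = hom (ximg v) (y i)" for i
  define Z where "Z i = hom (timg x) (z i)" for i
  have ue: "u i \<in> el (gensk 1)" for i by (rule fam_el[OF u(1)])
  have Xe: "X i \<in> el (gensk 1)" for i unfolding X_def by (rule hom_ximg_el[OF fx ue])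
  have fX: "fam X" unfolding fam_def using Xe hom_ximg_hg[OF fx ue fam_hg[OF u(1)]] by (simp add: X_def)
  have fX': "fam X'"
    unfolding fam_def X'_def using hom_ximg_el[OF fv fam_el[OF fy]] hom_ximg_hg[OF fv fam_el[OF fy] fam_hg[OF fy]] by simp
  have comp: "hom (ximg X) f = hom (ximg x) (hom (ximg u) f)" "hom (ximg X') f = hom (ximg v) (hom (ximg y) f)"
    if "f \<in> el (gensk 1)" for f
    unfolding hom_ximg_comp[OF fx u(1) that] hom_ximg_comp[OF fv fy that] X_def X'_def by (rule refl)+
  have ze: "z i \<in> el (gensk 2)" for i using z(1) by (simp add: PP_iff)
  have inv: "hom (ximg a) (hom (ximg b) f) = f"
    if "fam a" "fam b" "\<And>i. hom (ximg a) (b i) = wg i" "f \<in> el (gensk 1)" for a b f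
    unfolding hom_ximg_comp[OF that(1,2,4)] by (rule hom_ximg_id[OF that(4,3)])
  show ?thesis
  proof (rule equivalence_from_primitives[OF m C fX _ _ fX'])
    show "X i \<in> filt wl 1" for i
      unfolding X_def by (rule hom_ximg_filt[OF ue tri_filt[OF ut] tri_filt[OF x(1)]])
    show "?d (X i) = 0" for i
      using Dx_timg[OF gd fx x(2) ue] timg_first[OF fx ue] u(3) by (simp add: X_def)
    show "hom (ximg X) (X' i) = wg i" for i
    proof -
      have "hom (ximg u) (X' i) = y i" unfolding X'_def by (rule inv[OF u(1) fv v(2) fam_el[OF fy]])
      then show ?thesis using comp(1)[OF fam_el[OF fX'], of i] y(2) by simp
    qed
    show "hom (ximg X') (X i) = wg i" for i
    proof -
      have "hom (ximg y) (X i) = u i" unfolding X_def by (rule inv[OF fy fx y(3) ue])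
      then show ?thesis using comp(2)[OF Xe, of i] v(3) by simp
    qed
    show "Z i \<in> el (gensk 2)" for i unfolding Z_def by (rule timg_el[OF fx ze])
    show "hg (dg i - 1) (Z i)" for i unfolding Z_def by (rule timg_hg[OF fx ze z(2)])
    show "Z i \<in> filt wl 1" for i
      unfolding Z_def by (rule filt_le[OF PP_filt[OF timg_PP[OF fx tri_filt[OF x(1)] z(1)]]]) simp
    show "C (X i) - X i - hom (cpy 1) (X i) = ?d (Z i)" for i
    proof -
      have e: "hom (ximg ?c) (u i) \<in> el (gensk 2)" "u i \<in> el (gensk 2)" "hom (cpy 1) (u i) \<in> el (gensk 2)"
        using hom_ximg2_el[OF transport_fam2[OF tr] ue] el_mono[OF gensk_mono[of 1 2] ue] hom_cpy_el[OF ue, of 1 i]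
        by simp_all
      \<comment> \<open>Undoing the transport turns the primitivity of \<open>u\<close> for the
        conjugated comultiplication into that of \<open>X\<close> for the original C.\<close>
      have "hom (timg x) (hom (ximg ?c) (u i)) = hom (ximg c) (X i)"
        unfolding hom_transport[OF tr ue] X_def[symmetric]
        by (rule timg_inverse[OF fx fy y(2) hom_ximg2_el[OF fc Xe]])
      then have "hom (timg x) (hom (ximg ?c) (u i) - u i - hom (cpy 1) (u i)) = C (X i) - X i - hom (cpy 1) (X i)"
        by (simp add: hom_diff[of _ "gensk 2"] el_diff e Ch[OF hom_ximg_el[OF fx ue]] timg_first[OF fx ue] timg_cpy[OF fx ue] X_def)
      then show ?thesis
        unfolding z(3) Z_def Dx_timg[OF gd fx x(2) ze] by simp
    qed
  qed
qed

end

theorem mainTheorem7: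
  fixes dg :: "'i::wellorder \<Rightarrow> nat"
    and bc :: "nat \<Rightarrow> 'b::ring_1 \<Rightarrow> 'b"
    and dB :: "'b \<Rightarrow> 'b"
    and D C :: "('i, 'b) elt \<Rightarrow> ('i, 'b) elt"
  assumes "cdga bc dB"
    and "relative_model dg bc dB D"
    and "projection_dg dB (elems dg (gensk 1)) D"
    and "fibrewise_mult dg bc dB D C"
    and "finite_type_B bc"
    and "\<forall>n. finite {i. dg i = n}"
    and "odd_cohomology_vanishes bc dB"
    and "\<forall>i. odd (dg i)"
    and "associative dg bc dB D C"
  shows "equiv_BB dg bc dB D C (D0 dB) (C0 dg bc)"
proof -
  interpret odd_ext bc dB dg
    by unfold_locales (use assms(1,8) in auto)
  show ?thesis
    by (rule associative_equiv_trivial[OF assms(2-4,7,9)])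
qed

end
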